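(* Let $f:\mathbb{R}^n\to\mathbb{R}\cup\{+\infty\}$ and $g:\mathbb{R}^m\to\mathbb{R}\cup\{+\infty\}$ be proper closed convex functions and let $A\in\mathbb{R}^{m\times n}$. Assume that: (1) a primal-dual solution pair of $\min_x f(x)+g(Ax)$ and $\min_z f^*(-A^Tz)+g^*(z)$ exists; (2) $f$ is $\mu_f$-strongly convex with $\mu_f>0$; (3) $z\mapsto g^*(z)+f^*(-A^Tz)$ is coercive, i.e. $\lim_{\|z\|\to\infty}g^*(z)+f^*(-A^Tz)=\infty$; (4) $g^*$ is a KŁ function. Let $M_1\in\mathbb{R}^{n\times n}$, $M_2\in\mathbb{R}^{m\times m}$ be symmetric positive definite, let $S$ be an iterator for the $z$-subproblem and $p\ge1$ an inner iteration number such that the $z$-subproblem is solved to a bounded relative error with constant $c(p)$ in every outer iteration, and suppose $$C_1=\tfrac12M_1^{-1}-\frac{\|M_1\|}{\mu_f^2}I_{n\times n}\succ0,\qquad C_2=M_2-\tfrac12AM_1^{-1}A^T-c(p)I_{m\times m}\succ0.$$ Then the sequence $\{(x^k,z^k)\}$ generated by the iPrePDHG algorithm converges, as $k\to\infty$, to a primal-dual solution pair.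
   Context: $\|\cdot\|$ is the Euclidean norm (spectral norm for matrices), $\|v\|_M^2=\langle v,Mv\rangle$, $M\succ0$ means symmetric positive definite, and $f^*,g^*$ are convex conjugates. A primal-dual solution pair is $(x^\star,z^\star)$ with $\mathbf{0}\in\partial f(x^\star)+A^Tz^\star$ and $\mathbf{0}\in\partial g(Ax^\star)-z^\star$. $\mathrm{Prox}^M_\phi(x)=\arg\min_y\{\phi(y)+\frac12\|y-x\|_M^2\}$. iPrePDHG algorithm, started at $(x^0,z^0)$, for $k=0,1,\dots$: $x^{k+1}=\mathrm{Prox}^{M_1}_f(x^k-M_1^{-1}A^Tz^k)$; $z^{k+1}_0=z^k$; $z^{k+1}_{i+1}=S(z^{k+1}_i,x^{k+1},x^k)$ for $i=0,\dots,p-1$; $z^{k+1}=z^{k+1}_p$, which approximates $\mathrm{Prox}^{M_2}_{g^*}(z^k+M_2^{-1}A(2x^{k+1}-x^k))$ (the $z$-subproblem). The $z$-subproblem is solved to a bounded relative error with constant $c(p)>0$ (depending on $S$, $M_2$, $p$ but not on $k$) if for every $k$ there is $\varepsilon^{k+1}\in\mathbb{R}^m$ with $\mathbf{0}\in\partial g^*(z^{k+1})+M_2\big(z^{k+1}-z^k-M_2^{-1}A(2x^{k+1}-x^k)\big)+\varepsilon^{k+1}$ and $\|\varepsilon^{k+1}\|\le c(p)\|z^{k+1}-z^k\|$. KŁ function: a proper closed function $h$ such that for each $x_0\in\mathrm{dom}\,h$ there exist $\eta\in(0,\infty]$, a neighborhood $U$ of $x_0$, and a continuous concave function $\psi:[0,\eta)\to\mathbb{R}_+$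 with $\psi(0)=0$, $\psi$ is $C^1$ on $(0,\eta)$, $\psi'(s)>0$ for all $s\in(0,\eta)$, and $\psi'(h(x)-h(x_0))\,\mathrm{dist}(0,\partial h(x))\ge1$ for all $x\in U\cap\{x: h(x_0)<h(x)<h(x_0)+\eta\}$. *)

theory Defs
  imports "HOL-Analysis.Analysis"
begin

definition proper_fun :: "('a \<Rightarrow> ereal) \<Rightarrow> bool" where
  "proper_fun f \<longleftrightarrow> (\<forall>x. f x \<noteq> -\<infinity>) \<and> (\<exists>x. f x \<noteq> \<infinity>)"

definition closed_fun :: "('a::topological_space \<Rightarrow> ereal) \<Rightarrow> bool" where
  "closed_fun f \<longleftrightarrow> closed {(x, r::real). f x \<le> ereal r}"

definition convex_fun :: "('a::real_vector \<Rightarrow> ereal) \<Rightarrow> bool" where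
  "convex_fun f \<longleftrightarrow> (\<forall>x y t. 0 < t \<and> t < 1 \<longrightarrow>
     f ((1 - t) *\<^sub>R x + t *\<^sub>R y) \<le> ereal (1 - t) * f x + ereal t * f y)"

definition strongly_convex_fun :: "real \<Rightarrow> ('a::real_normed_vector \<Rightarrow> ereal) \<Rightarrow> bool" where
  "strongly_convex_fun \<mu> f \<longleftrightarrow> (\<forall>x y t. 0 < t \<and> t < 1 \<longrightarrow>
     f ((1 - t) *\<^sub>R x + t *\<^sub>R y) + ereal (\<mu> / 2 * t * (1 - t) * (norm (x - y))\<^sup>2)
       \<le> ereal (1 - t) * f x + ereal t * f y)"

definition conjugate :: "('a::real_inner \<Rightarrow> ereal) \<Rightarrow> 'a \<Rightarrow> ereal" where
  "conjugate f v = (SUP x. ereal (v \<bullet> x) - f x)"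

text \<open>The subdifferential of convex analysis. For proper \<open>f\<close> it is empty outside the
  effective domain.\<close>

definition subdiff :: "('a::real_inner \<Rightarrow> ereal) \<Rightarrow> 'a \<Rightarrow> 'a set" where
  "subdiff f x = {v. \<forall>y. f x + ereal (v \<bullet> (y - x)) \<le> f y}"

definition pos_def :: "real^'n^'n \<Rightarrow> bool" where
  "pos_def M \<longleftrightarrow> transpose M = M \<and> (\<forall>v. v \<noteq> 0 \<longrightarrow> 0 < v \<bullet> (M *v v))"

text \<open>The instance \<^term>\<open>norm\<close> on \<^typ>\<open>real^'n^'m\<close> is the Frobenius norm, so the
  spectral norm is taken as an operator norm.\<close>

definition spectral_norm :: "real^'n^'m \<Rightarrow> real" where
  "spectral_norm M = onorm (\<lambda>v. M *v v)"

definition prox :: "real^'n^'n \<Rightarrow> (real^'n \<Rightarrow> ereal) \<Rightarrow> real^'n \<Rightarrow> real^'n" where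
  "prox M \<phi> x = (ARG_MIN (\<lambda>y. \<phi> y + ereal (1 / 2 * ((y - x) \<bullet> (M *v (y - x))))) y. True)"

text \<open>The infimum is taken in \<^typ>\<open>ereal\<close>, so that the distance to the empty set is
  \<open>\<infinity>\<close> (\<^const>\<open>infdist\<close> would give 0).\<close>

definition dist_zero :: "('a::real_normed_vector) set \<Rightarrow> ereal" where
  "dist_zero V = (INF v\<in>V. ereal (norm v))"

text \<open>Since \<^const>\<open>subdiff\<close> is the convex subdifferential, this is the usual
  Kurdyka-Lojasiewicz notion for convex \<open>h\<close>.\<close>

definition KL_function :: "('a::real_inner \<Rightarrow> ereal) \<Rightarrow> bool" where
  "KL_function h \<longleftrightarrow> proper_fun h \<and> closed_fun h \<and>
     (\<forall>x0. h x0 < \<infinity> \<longrightarrow>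
       (\<exists>(\<eta>::ereal) U (\<psi>::real \<Rightarrow> real) (\<psi>'::real \<Rightarrow> real).
          0 < \<eta> \<and> open U \<and> x0 \<in> U \<and>
          continuous_on {s. 0 \<le> s \<and> ereal s < \<eta>} \<psi> \<and>
          concave_on {s. 0 \<le> s \<and> ereal s < \<eta>} \<psi> \<and>
          (\<forall>s. 0 \<le> s \<and> ereal s < \<eta> \<longrightarrow> 0 \<le> \<psi> s) \<and>
          \<psi> 0 = 0 \<and>
          (\<forall>s. 0 < s \<and> ereal s < \<eta> \<longrightarrow> (\<psi> has_real_derivative \<psi>' s) (at s)) \<and>
          continuous_on {s. 0 < s \<and> ereal s < \<eta>} \<psi>' \<and>
          (\<forall>s. 0 < s \<and> ereal s < \<eta> \<longrightarrow> 0 < \<psi>' s) \<and>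
          (\<forall>x\<in>U. h x0 < h x \<and> h x < h x0 + \<eta> \<longrightarrow>
             1 \<le> ereal (\<psi>' (real_of_ereal (h x - h x0))) * dist_zero (subdiff h x))))"

definition primal_dual_solution ::
  "(real^'n \<Rightarrow> ereal) \<Rightarrow> (real^'m \<Rightarrow> ereal) \<Rightarrow> real^'n^'m \<Rightarrow> real^'n \<Rightarrow> real^'m \<Rightarrow> bool" where
  "primal_dual_solution f g A xs zs \<longleftrightarrow>
     (\<exists>u\<in>subdiff f xs. u + transpose A *v zs = 0) \<and>
     (\<exists>v\<in>subdiff g (A *v xs). v - zs = 0)"

text \<open>\<open>S w x' x\<close> is one inner step from \<open>w\<close>, where \<open>x'\<close> is the new and \<open>x\<close> the old primal
  iterate; the starting point \<open>(x 0, z 0)\<close> is arbitrary.\<close>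

definition iPrePDHG ::
  "(real^'n \<Rightarrow> ereal) \<Rightarrow> real^'n^'m \<Rightarrow> real^'n^'n \<Rightarrow>
   (real^'m \<Rightarrow> real^'n \<Rightarrow> real^'n \<Rightarrow> real^'m) \<Rightarrow> nat \<Rightarrow>
   (nat \<Rightarrow> real^'n) \<Rightarrow> (nat \<Rightarrow> real^'m) \<Rightarrow> bool" where
  "iPrePDHG f A M1 S p x z \<longleftrightarrow> (\<forall>k.
     x (Suc k) = prox M1 f (x k - matrix_inv M1 *v (transpose A *v z k)) \<and>
     z (Suc k) = ((\<lambda>w. S w (x (Suc k)) (x k)) ^^ p) (z k))"

definition bounded_relative_error ::
  "(real^'m \<Rightarrow> ereal) \<Rightarrow> real^'n^'m \<Rightarrow> real^'m^'m \<Rightarrow> real \<Rightarrow>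
   (nat \<Rightarrow> real^'n) \<Rightarrow> (nat \<Rightarrow> real^'m) \<Rightarrow> bool" where
  "bounded_relative_error g A M2 c x z \<longleftrightarrow> (\<forall>k. \<exists>\<epsilon>.
     (\<exists>u\<in>subdiff (conjugate g) (z (Suc k)).
        u + M2 *v (z (Suc k) - z k
                   - matrix_inv M2 *v (A *v (2 *\<^sub>R x (Suc k) - x k))) + \<epsilon> = 0) \<and>
     norm \<epsilon> \<le> c * norm (z (Suc k) - z k))"

end

theory Submission
  imports Defs
begin

text \<open>
  The algorithm is a linearised ADMM for the dual problem with an inexact second step, and an
  augmented Lagrangian \<open>L\<close> decreases along it: with
  \<open>r\<^sub>k = \<parallel>z\<^sub>k\<^sub>+\<^sub>1 - z\<^sub>k\<parallel> + \<parallel>y\<^sub>k\<^sub>+\<^sub>1 - y\<^sub>k\<parallel>\<close> one has \<open>L\<^sub>k - L\<^sub>k\<^sub>+\<^sub>1 \<ge> a r\<^sub>k\<^sup>2\<close>, while the dual objective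
  \<open>F\<close> lies below \<open>L\<close> and has an approximate subgradient of norm \<open>O(r\<^sub>k)\<close> at \<open>z\<^sub>k\<^sub>+\<^sub>1\<close>.
  The Kurdyka-Lojasiewicz property of \<open>g\<^sup>*\<close> does not pass to
  \<open>F(z) = g\<^sup>*(z) + f\<^sup>*(- A\<^sup>T z)\<close>, so summability of \<open>r\<close> cannot be read off from it;
  it is derived from the convexity of \<open>F\<close> in finite dimension instead.

  By convexity the normal \<open>n\<^sub>k\<close> of a sublevel set at \<open>z\<^sub>k\<close> satisfies \<open>n\<^sub>k \<bullet> (z\<^sub>s - z\<^sub>k) \<le> - a l\<^sub>k\<close>
  for all later \<open>s\<close>, where \<open>l\<^sub>k\<close> is the length of the current stretch of the path: the path moves into
  the half space in which it has to stay. Such a path has finite length, by induction on the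
  dimension. If at every time all future points are seen in a strict cone, then each step lowers
  the support function of the future in one of finitely many directions, which bounds the length.
  Otherwise some point of the path is almost surrounded by future points, so that for a while all
  normals are almost orthogonal to a fixed direction \<open>v\<close>; projecting along \<open>v\<close> one obtains a path
  of the same kind in lower dimension, up to an error proportional to its length. The
  induction hypothesis shows that the path cannot leave the neighbourhood in time to visit those
  future points.
\<close>

section \<open>Paths that stay in the half spaces they enter\<close>

text \<open>The term with \<open>\<delta>\<close> is the error caused by projecting out a direction to which the normals are
  only almost orthogonal.\<close>

definition chain :: "real \<Rightarrow> real \<Rightarrow> 'a::euclidean_space set \<Rightarrow> (nat \<Rightarrow> 'a) \<Rightarrow> (nat \<Rightarrow> 'a) \<Rightarrow>
    (nat \<Rightarrow> real) \<Rightarrow> nat \<Rightarrow> nat \<Rightarrow> bool" where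
  "chain a \<delta> V y n l p q \<longleftrightarrow>
     (\<forall>i\<in>{p..q}. y i \<in> V) \<and>
     (\<forall>i\<in>{p..<q}. n i \<in> V \<and> norm (n i) \<le> 1 \<and> 0 \<le> l i \<and> norm (y (Suc i) - y i) \<le> l i) \<and>
     (\<forall>i j. p \<le> i \<and> i < j \<and> j \<le> q \<longrightarrow>
        n i \<bullet> (y j - y i) \<le> - a * l i + \<delta> * sum l {i..<j})"

text \<open>The bound concerns the weights \<open>l\<close> and not the distances actually moved: a
  projected path keeps the weights of the original one, so a bound in lower dimension controls the
  original path as well.\<close>

definition length_bounded :: "'a::euclidean_space set \<Rightarrow> real \<Rightarrow> real \<Rightarrow> real \<Rightarrow> bool" where
  "length_bounded V a \<delta> M \<longleftrightarrow> (\<forall>y n l p q D. chain a \<delta> V y n l p q \<and> p \<le> q \<and>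
     (\<forall>i\<in>{p..q}. norm (y i - y p) \<le> D) \<longrightarrow> sum l {p..<q} \<le> M * D)"

text \<open>The point \<open>c\<close> plays the role of a future point of the path: a path that has to come back to
  (the vicinity of) \<open>c\<close> cannot get far away from it.\<close>

definition confined :: "'a::euclidean_space set \<Rightarrow> real \<Rightarrow> real \<Rightarrow> real \<Rightarrow> real \<Rightarrow> bool" where
  "confined V a \<delta> \<Lambda> K \<longleftrightarrow> (\<forall>y n l p q c \<rho>. chain a \<delta> V y n l p q \<and> p \<le> q \<and> c \<in> V \<and> 0 < \<rho> \<and>
     norm (y p - c) \<le> \<rho> \<and> sum l {p..<q} \<le> K * \<rho> \<and>
     (\<forall>i\<in>{p..<q}. n i \<bullet> (c - y i) \<le> - a * l i + \<delta> * \<rho>) \<longrightarrow>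
     (\<forall>i\<in>{p..q}. norm (y i - c) \<le> \<Lambda> * \<rho>))"

text \<open>The conditions on the normals are required only while the path is inside the ball of
  radius \<open>B * R\<close>, because that is where future points enforce them; the conclusion is
  that this phase never ends. As in \<open>confined\<close>, \<open>c\<close> is a virtual future
  point.\<close>

definition squeezed :: "'a::euclidean_space set \<Rightarrow> real \<Rightarrow> real \<Rightarrow> real \<Rightarrow> bool" where
  "squeezed V a \<sigma> B \<longleftrightarrow> (\<forall>y n l p q v c R. chain a \<sigma> V y n l p q \<and> p \<le> q \<and> v \<in> V \<and> norm v = 1 \<and>
     c \<in> V \<and> 0 < R \<and> norm (y p - c) \<le> R \<and>
     (\<forall>i\<in>{p..<q}. norm (y i - y p) < B * R \<longrightarrow>
        \<bar>n i \<bullet> v\<bar> \<le> \<sigma> \<and> n i \<bullet> (c - y i) \<le> - a * l i + \<sigma> * R) \<longrightarrow>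
     (\<forall>i\<in>{p..q}. norm (y i - y p) < B * R))"

section \<open>Elementary estimates for chains\<close>

lemma chainD:
  assumes "chain a \<delta> V y n l p q"
  shows "p \<le> i \<Longrightarrow> i \<le> q \<Longrightarrow> y i \<in> V"
    and "p \<le> i \<Longrightarrow> i < q \<Longrightarrow> n i \<in> V"
    and "p \<le> i \<Longrightarrow> i < q \<Longrightarrow> norm (n i) \<le> 1"
    and "p \<le> i \<Longrightarrow> i < q \<Longrightarrow> 0 \<le> l i"
    and "p \<le> i \<Longrightarrow> i < q \<Longrightarrow> norm (y (Suc i) - y i) \<le> l i"
    and "p \<le> i \<Longrightarrow> i < j \<Longrightarrow> j \<le> q \<Longrightarrow> n i \<bullet> (y j - y i) \<le> - a * l i + \<delta> * sum l {i..<j}"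
  using assms unfolding chain_def by auto

lemma chain_subinterval:
  assumes "chain a \<delta> V y n l p q" "p \<le> p'" "q' \<le> q"
  shows "chain a \<delta> V y n l p' q'"
  using assms unfolding chain_def by auto

lemma chain_sum_nonneg:
  assumes "chain a \<delta> V y n l p q" "p \<le> i" "j \<le> q"
  shows "0 \<le> sum l {i..<j}"
  by (rule sum_nonneg) (use chainD(4)[OF assms(1)] assms in auto)

lemma chain_sum_mono:
  assumes "chain a \<delta> V y n l p q" "p \<le> i" "j \<le> q" "i \<le> i'" "j' \<le> j"
  shows "sum l {i'..<j'} \<le> sum l {i..<j}"
  by (rule sum_mono2) (use chainD(4)[OF assms(1)] assms in auto)

lemma chain_slack_mono:
  assumes "chain a \<delta> V y n l p q" "\<delta> \<le> \<delta>'"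
  shows "chain a \<delta>' V y n l p q"
proof -
  have "n i \<bullet> (y j - y i) \<le> - a * l i + \<delta>' * sum l {i..<j}" if "p \<le> i" "i < j" "j \<le> q" for i j
  proof -
    have "\<delta> * sum l {i..<j} \<le> \<delta>' * sum l {i..<j}"
      using chain_sum_nonneg[OF assms(1), of i j] that assms(2) by (intro mult_right_mono) auto
    with chainD(6)[OF assms(1) that] show ?thesis by linarith
  qed
  then show ?thesis using assms(1) unfolding chain_def by blast
qed

lemma chain_dist:
  assumes "chain a \<delta> V y n l p q" "p \<le> i" "i \<le> j" "j \<le> q"
  shows "norm (y j - y i) \<le> sum l {i..<j}"
  using assms(3,4)
proof (induction j rule: dec_induct)
  case base then show ?case by simp
next
  case (step k)
  have "norm (y (Suc k) - y i) \<le> norm (y (Suc k) - y k) + norm (y k - y i)"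
    using norm_triangle_ineq[of "y (Suc k) - y k" "y k - y i"] by simp
  moreover have "norm (y (Suc k) - y k) \<le> l k"
    using chainD(5)[OF assms(1), of k] assms(2) step by auto
  ultimately show ?case using step by auto
qed

text \<open>Normals have norm at most 1, so a point that counts as future limits the length of the
  next step. This controls how far a path overshoots a ball when it leaves it.\<close>

lemma chain_step_le:
  assumes "0 < a" "chain a \<delta> V y n l p q" "p \<le> i" "i < q" "n i \<bullet> (c - y i) \<le> - a * l i + e"
  shows "l i \<le> (norm (y i - c) + e) / a"
proof -
  have "\<bar>n i \<bullet> (c - y i)\<bar> \<le> norm (n i) * norm (c - y i)"
    by (rule Cauchy_Schwarz_ineq2)
  also have "\<dots> \<le> 1 * norm (c - y i)"
    using chainD(3)[OF assms(2-4)] by (intro mult_right_mono) auto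
  finally have "a * l i \<le> norm (y i - c) + e"
    using assms(5) by (simp add: norm_minus_commute)
  then show ?thesis using assms(1) by (simp add: field_simps)
qed

section \<open>Projection to one dimension less\<close>

text \<open>Projecting along \<open>v\<close> gives a chain in dimension \<open>k\<close> with the
  same weights \<open>l\<close>, the projection error going into the slack. Up to the first exit,
  \<open>length_bounded\<close> gives a crude length bound; this makes \<open>confined\<close>
  applicable, and the smaller radius obtained is put back into \<open>length_bounded\<close>. The
  length is then less than \<open>B * R\<close>, too short for an exit.\<close>

lemma squeezed_step:
  fixes a :: real
  assumes a: "0 < a"
    and T: "0 < \<delta>\<^sub>0" "0 < M" "\<And>V::'a::euclidean_space set. subspace V \<Longrightarrow> dim V = k \<Longrightarrow> length_bounded V a \<delta>\<^sub>0 M"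
    and E: "1 \<le> \<Lambda>" "\<And>K. 0 < K \<Longrightarrow> \<exists>\<delta>>0. \<forall>V::'a set. subspace V \<and> dim V = k \<longrightarrow> confined V a \<delta> \<Lambda> K"
  shows "\<exists>\<sigma>>0. \<exists>B>1. \<forall>V::'a set. subspace V \<and> dim V = Suc k \<longrightarrow> squeezed V a \<sigma> B"
proof -
  \<comment> \<open>The order of choices matters: \<open>B\<close> depends on \<open>M\<close> and
    \<open>\<Lambda>\<close>, then \<open>K\<close> on \<open>B\<close>, then the slack
    \<open>\<delta>\<^sub>1\<close> on \<open>K\<close>. Hence \<open>\<Lambda>\<close> must not
    depend on \<open>K\<close>. \<open>D\<close> is \<open>B\<close> plus the overshoot of the exit
    step.\<close>
  define B where "B = 2 * M * \<Lambda> + 1"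
  define D where "D = B + (B + 2) / a"
  define K where "K = M * D"
  have B1: "1 < B" using T(2) E(1) by (simp add: B_def)
  have Dpos: "0 < D" "B \<le> D" using B1 a by (auto simp: D_def add_pos_pos)
  have "0 < K" using Dpos T(2) by (simp add: K_def)
  then obtain \<delta>\<^sub>1 where d1: "0 < \<delta>\<^sub>1" "\<And>V::'a set. subspace V \<Longrightarrow> dim V = k \<Longrightarrow> confined V a \<delta>\<^sub>1 \<Lambda> K"
    using E(2) by blast
  define \<sigma> where "\<sigma> = min 1 (min (\<delta>\<^sub>0 / 2) (\<delta>\<^sub>1 / (B + 2)))"
  have "0 < \<sigma>" unfolding \<sigma>_def using T(1) d1(1) B1 by simp
  moreover have "\<sigma> \<le> 1" "\<sigma> \<le> \<delta>\<^sub>0 / 2" and s4: "\<sigma> \<le> \<delta>\<^sub>1 / (B + 2)"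
    unfolding \<sigma>_def by (meson min.cobounded1 min.cobounded2 order_trans)+
  ultimately have s: "0 < \<sigma>" "\<sigma> \<le> 1" "2 * \<sigma> \<le> \<delta>\<^sub>0" by simp_all
  have s': "\<sigma> * (B + 2) \<le> \<delta>\<^sub>1" using s4 B1 by (simp add: field_simps)
  have s'': "2 * \<sigma> \<le> \<delta>\<^sub>1"
  proof -
    have "\<sigma> * 2 \<le> \<sigma> * (B + 2)" using s(1) B1 by (intro mult_left_mono) auto
    with s' show ?thesis by simp
  qed
  have "squeezed V a \<sigma> B" if V: "subspace V" "dim V = Suc k" for V :: "'a set"
    unfolding squeezed_def
  proof (intro allI impI, elim conjE)
    fix y n :: "nat \<Rightarrow> 'a" and l p q v c R
    assume ch: "chain a \<sigma> V y n l p q" and pq: "p \<le> q" and v: "v \<in> V" "norm v = 1"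
      and c: "c \<in> V" and R: "0 < R" "norm (y p - c) \<le> R"
      and nv': "\<forall>i\<in>{p..<q}. norm (y i - y p) < B * R \<longrightarrow> \<bar>n i \<bullet> v\<bar> \<le> \<sigma> \<and> n i \<bullet> (c - y i) \<le> - a * l i + \<sigma> * R"
    show "\<forall>i\<in>{p..q}. norm (y i - y p) < B * R"
    proof (rule ccontr)
      assume "\<not> (\<forall>i\<in>{p..q}. norm (y i - y p) < B * R)"
      then have ex: "\<exists>e. p \<le> e \<and> e \<le> q \<and> B * R \<le> norm (y e - y p)" by (auto simp: not_less)
      define e where "e = (LEAST e. p \<le> e \<and> e \<le> q \<and> B * R \<le> norm (y e - y p))"
      have e: "p \<le> e" "e \<le> q" "B * R \<le> norm (y e - y p)"
        using LeastI_ex[OF ex] by (auto simp: e_def)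
      have before: "norm (y i - y p) < B * R" if "p \<le> i" "i < e" for i
        using not_less_Least[of i "\<lambda>e. p \<le> e \<and> e \<le> q \<and> B * R \<le> norm (y e - y p)"] that e
        by (auto simp: e_def[symmetric])
      have nv: "\<forall>i\<in>{p..<e}. \<bar>n i \<bullet> v\<bar> \<le> \<sigma> \<and> n i \<bullet> (c - y i) \<le> - a * l i + \<sigma> * R"
        using nv' before e by auto
      have BR: "0 < B * R" using B1 R by simp
      have pe: "p < e" using e BR by (cases "p = e") auto
      have cy: "norm (y i - c) \<le> (B + 1) * R" if "p \<le> i" "i < e" for i
      proof -
        have "norm (y i - c) \<le> norm (y i - y p) + norm (y p - c)"
          using norm_triangle_ineq[of "y i - y p" "y p - c"] by simp
        then show ?thesis using before[OF that] R(2) by (simp add: algebra_simps)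
      qed
      have che: "chain a \<sigma> V y n l p e" using chain_subinterval[OF ch] e by auto
      define V' where "V' = {w \<in> V. \<forall>x\<in>span {v}. orthogonal x w}"
      have vv: "v \<bullet> v = 1" using v(2) by (simp add: dot_square_norm)
      have V'alt: "w \<in> V' \<longleftrightarrow> w \<in> V \<and> w \<bullet> v = 0" for w
        unfolding V'_def by (auto simp: span_singleton orthogonal_def inner_commute)
      have V': "subspace V'"
        using V(1) unfolding subspace_def by (auto simp: V'alt inner_add_left)
      have "dim V' + dim (span {v}) = dim V"
        unfolding V'_def
        by (rule dim_subspace_orthogonal_to_vectors) (use V v in \<open>auto simp: span_minimal\<close>)
      moreover have "dim (span {v}) = 1" using v by (auto simp: dim_span)
      ultimately have dimV': "dim V' = k" using V(2) by simp
      define P where "P w = w - (w \<bullet> v) *\<^sub>R v" for w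
      have PV: "P w \<in> V'" if "w \<in> V" for w
        using that v V(1) vv unfolding V'alt P_def
        by (auto simp: subspace_diff subspace_scale inner_diff_left)
      have Pd: "P w - P u = P (w - u)" for w u
        by (simp add: P_def algebra_simps)
      have Pin: "P w \<bullet> P u = w \<bullet> u - (w \<bullet> v) * (u \<bullet> v)" for w u
        by (simp add: P_def inner_diff_left inner_diff_right vv inner_commute)
      have Pn: "norm (P w) \<le> norm w" for w
        using Pin[of w w] by (simp add: norm_le)
      have sv: "\<bar>w \<bullet> v\<bar> \<le> norm w" for w using Cauchy_Schwarz_ineq2[of w v] v by simp
      have prod: "\<bar>(n i \<bullet> v) * (u \<bullet> v)\<bar> \<le> \<sigma> * norm u" if "p \<le> i" "i < e" for i u
        unfolding abs_mult using nv that e sv s(1) by (intro mult_mono) auto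
      \<comment> \<open>\<open>P (n i) \<bullet> P u\<close> differs from
        \<open>n i \<bullet> u\<close> by the product of the \<open>v\<close>-components, which is
        at most \<open>\<sigma> * norm u\<close>. For a difference of path points this is at most
        \<open>\<sigma>\<close> times the length in between, whence the second
        \<open>\<sigma>\<close>.\<close>
      have ch': "chain a (2 * \<sigma>) V' (\<lambda>i. P (y i)) (\<lambda>i. P (n i)) l p e"
        unfolding chain_def
      proof (intro conjI ballI allI impI)
        fix i assume "i \<in> {p..e}" then show "P (y i) \<in> V'" using chainD(1)[OF che] PV by auto
      next
        fix i assume i: "i \<in> {p..<e}"
        then show "P (n i) \<in> V'" "0 \<le> l i" using chainD(2,4)[OF che] PV by auto
        show "norm (P (n i)) \<le> 1" using chainD(3)[OF che, of i] i Pn[of "n i"] by auto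
        show "norm (P (y (Suc i)) - P (y i)) \<le> l i"
          using chainD(5)[OF che, of i] i Pn[of "y (Suc i) - y i"] by (auto simp: Pd)
      next
        fix i j assume ij: "p \<le> i \<and> i < j \<and> j \<le> e"
        have "\<sigma> * norm (y j - y i) \<le> \<sigma> * sum l {i..<j}"
          using chain_dist[OF che, of i j] ij s(1) by auto
        moreover have "\<bar>(n i \<bullet> v) * ((y j - y i) \<bullet> v)\<bar> \<le> \<sigma> * norm (y j - y i)"
          using prod ij by auto
        ultimately show "P (n i) \<bullet> (P (y j) - P (y i)) \<le> - a * l i + 2 * \<sigma> * sum l {i..<j}"
          unfolding Pd Pin using chainD(6)[OF che, of i j] ij by linarith
      qed
      have T': "sum l {p..<e} \<le> M * D'" if "\<And>i. p \<le> i \<Longrightarrow> i \<le> e \<Longrightarrow> norm (P (y i) - P (y p)) \<le> D'" for D'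
        using T(3)[OF V' dimV'] chain_slack_mono[OF ch' s(3)] pe that
        unfolding length_bounded_def by (metis atLeastAtMost_iff less_imp_le)
      have DR: "norm (y i - y p) \<le> D * R" if "p \<le> i" "i \<le> e" for i
      proof (cases "i = e")
        case False
        have "norm (y i - y p) \<le> B * R" using before[of i] that False by auto
        also have "\<dots> \<le> D * R" using Dpos R by auto
        finally show ?thesis .
      next
        case True
        define i' where "i' = e - 1"
        have i': "Suc i' = e" "p \<le> i'" "i' < e" using pe by (auto simp: i'_def)
        have "l i' \<le> (norm (y i' - c) + \<sigma> * R) / a"
          by (rule chain_step_le[OF a che]) (use i' nv e in auto)
        also have "\<dots> \<le> ((B + 1) * R + 1 * R) / a"
          using cy[OF i'(2,3)] a s R by (intro divide_right_mono add_mono mult_right_mono) auto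
        finally have "norm (y e - y i') \<le> (B + 2) / a * R"
          using chainD(5)[OF che i'(2,3)] i'(1) by (simp add: algebra_simps)
        moreover have "norm (y e - y p) \<le> norm (y e - y i') + norm (y i' - y p)"
          using norm_triangle_ineq[of "y e - y i'" "y i' - y p"] by simp
        ultimately show ?thesis using before[OF i'(2,3)] True by (simp add: D_def algebra_simps)
      qed
      \<comment> \<open>A crude bound, to meet the length hypothesis of
        \<open>confined\<close>.\<close>
      have "sum l {p..<e} \<le> M * (D * R)"
      proof (rule T')
        fix i assume "p \<le> i" "i \<le> e"
        then show "norm (P (y i) - P (y p)) \<le> D * R"
          using DR[of i] Pn[of "y i - y p"] unfolding Pd by linarith
      qed
      then have KR: "sum l {p..<e} \<le> K * R" by (simp add: K_def)
      have virt: "P (n i) \<bullet> (P c - P (y i)) \<le> - a * l i + \<delta>\<^sub>1 * R" if "p \<le> i" "i < e" for i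
      proof -
        have "\<bar>(n i \<bullet> v) * ((c - y i) \<bullet> v)\<bar> \<le> \<sigma> * norm (c - y i)" using prod that by auto
        also have "\<dots> \<le> \<sigma> * ((B + 1) * R)"
          using cy[OF that] s(1) by (intro mult_left_mono) (auto simp: norm_minus_commute)
        finally have "\<bar>(n i \<bullet> v) * ((c - y i) \<bullet> v)\<bar> \<le> \<sigma> * ((B + 1) * R)" .
        moreover have "n i \<bullet> (c - y i) \<le> - a * l i + \<sigma> * R" using nv that e by auto
        moreover have "\<sigma> * (B + 2) * R \<le> \<delta>\<^sub>1 * R" using s' R by (intro mult_right_mono) auto
        ultimately show ?thesis unfolding Pd Pin by (simp add: algebra_simps)
      qed
      have conf: "norm (P (y i) - P c) \<le> \<Lambda> * R" if "p \<le> i" "i \<le> e" for i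
      proof -
        have "norm (P (y p) - P c) \<le> R" using R(2) Pn[of "y p - c"] unfolding Pd by linarith
        then show ?thesis
          using d1(2)[OF V' dimV', unfolded confined_def, rule_format,
              of "\<lambda>i. P (y i)" "\<lambda>i. P (n i)" l p e "P c" R i]
            chain_slack_mono[OF ch' s''] pe PV[OF c] R(1) KR virt that by auto
      qed
      \<comment> \<open>Second use of \<open>length_bounded\<close>, now with the diameter that
        confinement provides. Since \<open>l\<close> was not projected, this bounds the displacement
        in \<open>V\<close> itself.\<close>
      have "sum l {p..<e} \<le> M * (2 * \<Lambda> * R)"
      proof (rule T')
        fix i assume i: "p \<le> i" "i \<le> e"
        have "norm (P (y i) - P (y p)) \<le> norm (P (y i) - P c) + norm (P (y p) - P c)"
          using norm_triangle_ineq4[of "P (y i) - P c" "P (y p) - P c"] by simp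
        then show "norm (P (y i) - P (y p)) \<le> 2 * \<Lambda> * R"
          using conf[OF i] conf[of p] pe by simp
      qed
      also have "\<dots> < B * R" using R(1) by (simp add: B_def algebra_simps)
      finally show False using e(3) chain_dist[OF che, of p e] pe by simp
    qed
  qed
  then show ?thesis using s(1) B1 by blast
qed

section \<open>Nearly parallel exits and confinement\<close>

lemma sphere_net:
  fixes \<omega> :: real
  assumes "0 < \<omega>"
  obtains S :: "'a::euclidean_space set" where "finite S"
    "\<And>u. norm u = 1 \<Longrightarrow> \<exists>m\<in>S. norm m = 1 \<and> norm (u - m) < \<omega>"
proof -
  have "compact (sphere (0::'a) 1)" by simp
  then obtain S where S: "S \<subseteq> sphere (0::'a) 1" "finite S" "sphere 0 1 \<subseteq> (\<Union>c\<in>S. ball c \<omega>)"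
    by (rule compactE_image[where C = "sphere (0::'a) 1" and f = "\<lambda>c. ball c \<omega>"])
      (use assms in \<open>auto simp: intro: centre_in_ball[THEN iffD2]\<close>)
  show ?thesis
  proof (rule that[OF S(2)])
    fix u :: 'a assume "norm u = 1"
    then have "u \<in> sphere 0 1" by simp
    then have "u \<in> (\<Union>c\<in>S. ball c \<omega>)" using S(3) by blast
    then show "\<exists>m\<in>S. norm m = 1 \<and> norm (u - m) < \<omega>"
      using S(1) by (force simp: dist_norm norm_minus_commute)
  qed
qed

lemma close_directions:
  fixes \<omega> :: real
  assumes "0 < \<omega>"
  obtains N :: nat where "\<And>u :: nat \<Rightarrow> 'a::euclidean_space. (\<And>h. h < N \<Longrightarrow> norm (u h) = 1) \<Longrightarrow>
    \<exists>h h'. h < h' \<and> h' < N \<and> norm (u h - u h') \<le> \<omega>"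
proof -
  obtain S :: "'a set" where S: "finite S" "\<And>u. norm u = 1 \<Longrightarrow> \<exists>m\<in>S. norm m = 1 \<and> norm (u - m) < \<omega> / 2"
    using sphere_net[of "\<omega> / 2"] assms by auto
  show ?thesis
  proof (rule that[of "Suc (card S)"])
    fix u :: "nat \<Rightarrow> 'a" assume u: "\<And>h. h < Suc (card S) \<Longrightarrow> norm (u h) = 1"
    then have "\<forall>h\<in>{..<Suc (card S)}. \<exists>m\<in>S. norm (u h - m) < \<omega> / 2" using S(2) by blast
    then obtain f where f: "\<And>h. h < Suc (card S) \<Longrightarrow> f h \<in> S \<and> norm (u h - f h) < \<omega> / 2"
      by (metis lessThan_iff)
    have "\<not> inj_on f {..<Suc (card S)}"
    proof
      assume "inj_on f {..<Suc (card S)}"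
      then have "card {..<Suc (card S)} \<le> card S"
        by (rule card_inj_on_le) (use f S in auto)
      then show False by simp
    qed
    then obtain h h' where h: "h < h'" "h' < Suc (card S)" "f h = f h'"
      unfolding inj_on_def by (metis lessThan_iff linorder_neqE_nat)
    have "norm (u h - u h') \<le> norm (u h - f h) + norm (u h' - f h')"
      using norm_triangle_ineq4[of "u h - f h" "u h' - f h'"] h(3) by simp
    also have "\<dots> \<le> \<omega>" using f[of h] f[of h'] h by simp
    finally show "\<exists>h h'. h < h' \<and> h' < Suc (card S) \<and> norm (u h - u h') \<le> \<omega>"
      using h by blast
  qed
qed

text \<open>If the path gets far from \<open>c\<close>, then among its first exits from balls of
  geometrically growing radii about \<open>c\<close> two lie in almost the same direction, by the
  pigeonhole principle, say at times \<open>j < s\<close>. A point \<open>b\<close> near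
  \<open>y j\<close> lies on the segment between \<open>c\<close> and \<open>y s\<close>, which both
  count as future, so near \<open>b\<close> the normals are almost orthogonal to the segment. Now
  \<open>squeezed\<close> keeps the path near \<open>y j\<close>, and it cannot reach
  \<open>y s\<close>. The number of radii depends only on \<open>\<sigma>\<close> and
  \<open>B\<close>, so \<open>\<Lambda>\<close> is fixed before \<open>K\<close>.\<close>

lemma confined_step:
  fixes a :: real
  assumes a: "0 < a" and s: "0 < \<sigma>" "1 < B"
    and sq: "\<And>V::'a::euclidean_space set. subspace V \<Longrightarrow> dim V = k \<Longrightarrow> squeezed V a \<sigma> B"
  shows "\<exists>\<Lambda>\<ge>1. \<forall>K>0. \<exists>\<delta>>0. \<forall>V::'a set. subspace V \<and> dim V = k \<longrightarrow> confined V a \<delta> \<Lambda> K"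
proof -
  define \<omega> where "\<omega> = min (\<sigma> / 2) 1 / (B + 1)"
  have w: "0 < \<omega>" using s by (simp add: \<omega>_def)
  have w1: "(B + 1) * \<omega> \<le> \<sigma> / 2" "(B + 1) * \<omega> \<le> 1" using s by (auto simp: \<omega>_def)
  have Bw: "B * \<omega> \<le> 1" using w1(2) w by (simp add: algebra_simps)
  have wh: "\<omega> \<le> 1 / 2"
  proof -
    have "2 * \<omega> \<le> (B + 1) * \<omega>" using s w by (intro mult_right_mono) auto
    with w1(2) show ?thesis by simp
  qed
  obtain N :: nat where N: "\<And>u :: nat \<Rightarrow> 'a. (\<And>h. h < N \<Longrightarrow> norm (u h) = 1) \<Longrightarrow>
    \<exists>h h'. h < h' \<and> h' < N \<and> norm (u h - u h') \<le> \<omega>"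
    using close_directions[OF w] by blast
  \<comment> \<open>A step from within distance \<open>X \<ge> \<rho>\<close> of \<open>c\<close> is
    at most \<open>2 / a * X\<close> long, so the first exit from radius \<open>X\<close> is at
    distance at most \<open>G * X / 2\<close>. The factor 2 separates the exits from different
    balls.\<close>
  define G where "G = 2 * (1 + 2 / a)"
  have G: "1 \<le> G" using a by (simp add: G_def)
  have Gp: "1 \<le> G ^ h" for h using G by simp
  have "\<exists>\<delta>>0. \<forall>V::'a set. subspace V \<and> dim V = k \<longrightarrow> confined V a \<delta> (G ^ N) K" if K: "0 < K" for K
  proof -
    define \<delta> where "\<delta> = min 1 (\<sigma> * \<omega> / (K + 1))"
    have d: "0 < \<delta>" using K s w by (simp add: \<delta>_def)
    have d1: "\<delta> \<le> 1" by (simp add: \<delta>_def)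
    have "\<delta> \<le> \<sigma> * \<omega> / (K + 1)" by (simp add: \<delta>_def)
    then have dK: "\<delta> * (1 + K) \<le> \<sigma> * \<omega>" using K by (simp add: field_simps)
    moreover have "\<delta> \<le> \<delta> * (1 + K)" "\<delta> * K \<le> \<delta> * (1 + K)" using K d by (simp_all add: algebra_simps)
    moreover have "\<sigma> * \<omega> \<le> \<sigma> * (1 / 2)" using wh s by (intro mult_left_mono) auto
    ultimately have d2: "\<delta> \<le> \<sigma> / 2" "\<delta> * K \<le> \<sigma> / 2" by linarith+
    have "confined V a \<delta> (G ^ N) K" if V: "subspace V" "dim V = k" for V :: "'a set"
      unfolding confined_def
    proof (intro allI impI, elim conjE, rule ccontr)
      fix y n :: "nat \<Rightarrow> 'a" and l p q c \<rho>
      assume ch: "chain a \<delta> V y n l p q" and pq: "p \<le> q" and c: "c \<in> V" and r0: "0 < \<rho>"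
        "norm (y p - c) \<le> \<rho>" and K': "sum l {p..<q} \<le> K * \<rho>"
        and virt: "\<forall>i\<in>{p..<q}. n i \<bullet> (c - y i) \<le> - a * l i + \<delta> * \<rho>"
        and "\<not> (\<forall>i\<in>{p..q}. norm (y i - c) \<le> G ^ N * \<rho>)"
      then obtain i0 where i0: "p \<le> i0" "i0 \<le> q" "G ^ N * \<rho> < norm (y i0 - c)" by auto
      define Q where "Q h t \<longleftrightarrow> p \<le> t \<and> t \<le> q \<and> G ^ h * \<rho> < norm (y t - c)" for h t
      define t where "t h = (LEAST t. Q h t)" for h
      have Q: "Q h (t h)" if "h < N" for h
      proof -
        have "G ^ h * \<rho> \<le> G ^ N * \<rho>"
          using that G r0 by (intro mult_right_mono power_increasing) auto
        then have "Q h i0" using i0 by (auto simp: Q_def)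
        then show ?thesis unfolding t_def by (rule LeastI)
      qed
      have rho_le: "\<rho> \<le> G ^ h * \<rho>" for h using Gp[of h] r0 by simp
      have tp: "p < t h" if "h < N" for h
        using Q[OF that] rho_le[of h] r0 by (cases "t h = p") (auto simp: Q_def)
      have upper: "2 * norm (y (t h) - c) \<le> G ^ Suc h * \<rho>" if "h < N" for h
      proof -
        define i where "i = t h - 1"
        have i: "Suc i = t h" "p \<le> i" "i < q" using tp[OF that] Q[OF that] by (auto simp: i_def Q_def)
        have "\<not> Q h i" using not_less_Least[of i "Q h"] i by (auto simp: t_def[symmetric])
        then have yi: "norm (y i - c) \<le> G ^ h * \<rho>" using i by (auto simp: Q_def)
        have "l i \<le> (norm (y i - c) + \<delta> * \<rho>) / a"
          by (rule chain_step_le[OF a ch i(2,3)]) (use virt i in auto)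
        also have "\<dots> \<le> (G ^ h * \<rho> + 1 * (G ^ h * \<rho>)) / a"
          using yi rho_le[of h] d1 d r0 a by (intro divide_right_mono add_mono mult_mono) auto
        finally have "norm (y (t h) - y i) \<le> 2 / a * (G ^ h * \<rho>)"
          using chainD(5)[OF ch i(2,3)] i(1) by (simp add: mult.commute)
        moreover have "norm (y (t h) - c) \<le> norm (y (t h) - y i) + norm (y i - c)"
          using norm_triangle_ineq[of "y (t h) - y i" "y i - c"] by simp
        moreover have "G * X = 2 * X + 2 * (2 / a * X)" for X
          by (simp add: G_def algebra_simps)
        ultimately have "2 * norm (y (t h) - c) \<le> G * (G ^ h * \<rho>)"
          using yi by simp
        then show ?thesis by simp
      qed
      have pos: "0 < norm (y (t h) - c)" if "h < N" for h
        using Q[OF that] rho_le[of h] r0 unfolding Q_def by linarith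
      define u where "u h = (y (t h) - c) /\<^sub>R norm (y (t h) - c)" for h
      have "norm (u h) = 1" if "h < N" for h using pos[OF that] by (simp add: u_def)
      then obtain h h' where h: "h < h'" "h' < N" "norm (u h - u h') \<le> \<omega>" using N by blast
      define j s r d where "j = t h" and "s = t h'" and "r = norm (y j - c)" and "d = norm (y s - c)"
      note defs = j_def s_def
      have hN: "h < N" using h by simp
      have r: "0 < r" "\<rho> \<le> r" using pos[OF hN] Q[OF hN] rho_le[of h] by (auto simp: r_def defs Q_def)
      have "G ^ Suc h * \<rho> \<le> G ^ h' * \<rho>"
        using h G r0 by (intro mult_right_mono power_increasing) auto
      then have dr: "2 * r \<le> d" using upper[OF hN] Q[OF h(2)] by (simp add: d_def r_def defs Q_def)
      have "G ^ h * \<rho> < r" using Q[OF hN] by (simp add: Q_def r_def defs)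
      then have "G ^ h * \<rho> < norm (y s - c)" using dr r by (simp add: d_def)
      then have "Q h s" using Q[OF h(2)] by (auto simp: Q_def defs)
      then have "j \<le> s" unfolding j_def t_def by (rule Least_le)
      moreover have "j \<noteq> s" using dr r by (auto simp: d_def r_def)
      ultimately have js: "p \<le> j" "j < s" "s \<le> q" using Q[OF h(2)] Q[OF hN] by (auto simp: Q_def defs)
      define v where "v = u h'"
      have v: "norm v = 1" "y s - c = d *\<^sub>R v" using pos[OF h(2)] by (auto simp: v_def u_def d_def defs)
      have ysV: "y s \<in> V" using chainD(1)[OF ch] js by auto
      have vV: "v \<in> V" unfolding v_def u_def defs[symmetric]
        using ysV c V(1) by (simp add: subspace_diff subspace_scale)
      define b where "b = c + r *\<^sub>R v"
      have bV: "b \<in> V" unfolding b_def using c vV V(1) by (simp add: subspace_add subspace_scale)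
      have yj: "y j - c = r *\<^sub>R u h" using r by (simp add: u_def r_def defs)
      have yjb: "norm (y j - b) \<le> \<omega> * r"
      proof -
        have "y j - b = r *\<^sub>R (u h - v)" using yj by (simp add: b_def algebra_simps)
        then show ?thesis using h(3) r by (simp add: v_def mult.commute)
      qed
      have chs: "chain a \<sigma> V y n l j s"
        by (rule chain_slack_mono[OF chain_subinterval[OF ch]]) (use js d2 s in auto)
      \<comment> \<open>\<open>c\<close> and \<open>y s\<close> lie on opposite sides of
        \<open>b\<close> along \<open>v\<close>, and both lie almost in the half space of
        \<open>n i\<close>: the first gives the lower bound on \<open>n i \<bullet> v\<close>, the
        second the upper one. For the other inequality, \<open>b\<close> is written as a convex
        combination of the two.\<close>
      have cond: "\<bar>n i \<bullet> v\<bar> \<le> \<sigma> \<and> n i \<bullet> (b - y i) \<le> - a * l i + \<sigma> * (\<omega> * r)"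
        if i: "j \<le> i" "i < s" "norm (y i - y j) < B * (\<omega> * r)" for i
      proof -
        have ipq: "p \<le> i" "i < q" using i js by auto
        have li: "0 \<le> a * l i" using chainD(4)[OF ch ipq] a by simp
        have 1: "n i \<bullet> (c - y i) \<le> - a * l i + \<delta> * \<rho>" using virt ipq by auto
        have "sum l {i..<s} \<le> K * \<rho>"
          using chain_sum_mono[OF ch, of p q i s] i js K' by auto
        then have "\<delta> * sum l {i..<s} \<le> \<delta> * (K * \<rho>)" using d by (intro mult_left_mono) auto
        then have 2: "n i \<bullet> (y s - y i) \<le> - a * l i + \<delta> * K * \<rho>"
          using chainD(6)[OF ch, of i s] i js by simp
        have "norm (b - y i) \<le> norm (y j - b) + norm (y i - y j)"
          using norm_triangle_ineq[of "y i - y j" "y j - b"] by (simp add: norm_minus_commute)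
        also have "\<dots> \<le> (B + 1) * \<omega> * r" using yjb i by (simp add: algebra_simps)
        finally have biy: "norm (b - y i) \<le> (B + 1) * \<omega> * r" .
        have "\<bar>n i \<bullet> (b - y i)\<bar> \<le> norm (n i) * norm (b - y i)" by (rule Cauchy_Schwarz_ineq2)
        also have "\<dots> \<le> 1 * norm (b - y i)"
          using chainD(3)[OF ch ipq] by (intro mult_right_mono) auto
        finally have 3: "\<bar>n i \<bullet> (b - y i)\<bar> \<le> \<sigma> / 2 * r"
          using biy mult_right_mono[OF w1(1) less_imp_le[OF r(1)]] by linarith
        have dr1: "\<delta> * \<rho> \<le> \<sigma> / 2 * r" "\<delta> * K * \<rho> \<le> \<sigma> / 2 * r"
          using d2 d K r r0 s by (intro mult_mono; simp)+
        have "r * (n i \<bullet> v) = n i \<bullet> (b - y i) - n i \<bullet> (c - y i)"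
          by (simp add: b_def inner_simps algebra_simps)
        then have "r * (- \<sigma>) \<le> r * (n i \<bullet> v)"
          using 1 3 dr1 li by (simp only: mult_minus_right mult_minus_left mult.commute[of r \<sigma>])
        then have low: "- \<sigma> \<le> n i \<bullet> v" using r(1) by (rule mult_left_le_imp_le)
        have bs: "y s - b = (d - r) *\<^sub>R v" using v(2) by (simp add: b_def algebra_simps)
        have "(d - r) * (n i \<bullet> v) = n i \<bullet> (y s - b)" unfolding bs by simp
        also have "\<dots> = n i \<bullet> (y s - y i) - n i \<bullet> (b - y i)"
          by (simp add: inner_simps)
        also have "\<dots> \<le> \<sigma> * r" using 2 3 dr1 li by (simp only: mult_minus_left)
        also have "\<dots> \<le> \<sigma> * (d - r)" using dr s by (intro mult_left_mono) auto
        finally have "(d - r) * (n i \<bullet> v) \<le> (d - r) * \<sigma>" by (simp add: mult.commute)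
        then have up: "n i \<bullet> v \<le> \<sigma>" by (rule mult_left_le_imp_le) (use dr r in simp)
        define \<theta> where "\<theta> = r / d"
        have th: "0 \<le> \<theta>" "\<theta> \<le> 1" "\<theta> * d = r" using dr r by (auto simp: \<theta>_def)
        have beq: "b = (1 - \<theta>) *\<^sub>R c + \<theta> *\<^sub>R y s"
        proof -
          have "y s = c + d *\<^sub>R v" using v(2) by (simp add: algebra_simps)
          then show ?thesis using th(3) by (simp add: b_def algebra_simps)
        qed
        have "n i \<bullet> (b - y i) = (1 - \<theta>) * (n i \<bullet> (c - y i)) + \<theta> * (n i \<bullet> (y s - y i))"
          unfolding beq by (simp add: inner_simps algebra_simps)
        also have "\<dots> \<le> (1 - \<theta>) * (- a * l i + \<delta> * (1 + K) * \<rho>) + \<theta> * (- a * l i + \<delta> * (1 + K) * \<rho>)"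
        proof (intro add_mono mult_left_mono)
          have "0 \<le> \<delta> * \<rho>" "0 \<le> \<delta> * K * \<rho>" using d K r0 by auto
          then show "n i \<bullet> (c - y i) \<le> - a * l i + \<delta> * (1 + K) * \<rho>"
            "n i \<bullet> (y s - y i) \<le> - a * l i + \<delta> * (1 + K) * \<rho>"
            using 1 2 by (simp_all add: algebra_simps)
        qed (use th in auto)
        also have "\<dots> = - a * l i + \<delta> * (1 + K) * \<rho>" by (simp add: algebra_simps)
        also have "\<delta> * (1 + K) * \<rho> \<le> \<sigma> * \<omega> * r"
          by (rule mult_mono[OF dK]) (use r r0 s w in auto)
        finally show ?thesis using low up by (simp add: abs_le_iff mult.assoc)
      qed
      \<comment> \<open>\<open>squeezed\<close> confines the path to a ball about \<open>y j\<close>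
        of radius at most \<open>r\<close>, but \<open>y s\<close> is at distance at least
        \<open>r\<close>.\<close>
      have "norm (y s - y j) < B * (\<omega> * r)"
        using sq[OF V, unfolded squeezed_def, rule_format, of y n l j s v b "\<omega> * r" s]
          chs js vV v(1) bV w r yjb cond by auto
      moreover have "r \<le> norm (y s - y j)"
        using norm_triangle_ineq2[of "y s - c" "y j - c"] dr by (simp add: d_def r_def)
      moreover have "B * (\<omega> * r) \<le> r" using mult_right_mono[OF Bw, of r] r by simp
      ultimately show False by linarith
    qed
    then show ?thesis using d by blast
  qed
  then show ?thesis using Gp[of N] by blast
qed

section \<open>Balanced directions and strict cones\<close>

text \<open>Dropping the small weights of a short convex combination keeps it short relative to
  the remaining weights, because the thresholds \<^term>\<open>c\<close> decrease fast enough.\<close>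

lemma short_combination_large_weights:
  fixes c :: "nat \<Rightarrow> real" and S :: "'a::real_normed_vector set"
  assumes "finite S" "S \<noteq> {}" "\<And>v. v \<in> S \<Longrightarrow> norm v = 1" "\<And>v. v \<in> S \<Longrightarrow> 0 \<le> u v" "sum u S = 1"
    "norm (\<Sum>v\<in>S. u v *\<^sub>R v) \<le> c (card S)"
    and c: "c 1 < 1" "\<And>k. 0 < c k" "\<And>k. c (Suc k) \<le> c k / 4" "c 0 \<le> 1"
  shows "\<exists>S'\<subseteq>S. \<exists>u'. 2 \<le> card S' \<and> (\<forall>v\<in>S'. c (card S' - 1) / 4 \<le> u' v) \<and> sum u' S' = 1 \<and>
    norm (\<Sum>v\<in>S'. u' v *\<^sub>R v) \<le> c (card S')"
  using assms(1-6)
proof (induction "card S" arbitrary: S u rule: less_induct)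
  case less
  have u1: "u v = 1" if "card S = 1" "v \<in> S" for v
    using that less(6) by (auto simp: card_1_singleton_iff)
  have "card S \<noteq> 1"
  proof
    assume 1: "card S = 1"
    then obtain v where v: "S = {v}" by (auto simp: card_1_singleton_iff)
    then have "norm (\<Sum>v\<in>S. u v *\<^sub>R v) = 1" using less(4)[of v] u1[of v] 1 by simp
    then show False using less(7) 1 c(1) by simp
  qed
  moreover have "card S \<noteq> 0" using less by simp
  ultimately have 2: "2 \<le> card S" by simp
  define k where "k = card S - 1"
  have k: "card S = Suc k" "1 \<le> k" using 2 by (auto simp: k_def)
  show ?case
  proof (cases "\<forall>v\<in>S. c k / 4 \<le> u v")
    case True
    then show ?thesis using 2 less(6,7) k by (intro exI[of _ S] conjI exI[of _ u]) auto
  next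
    case False
    \<comment> \<open>The light vector \<open>w\<close> is dropped and the other weights, of total
      at least 3/4, are rescaled. The old sum and the dropped term have norm at most
      \<open>c k / 4\<close> each, so the new norm is at most
      \<open>4 / 3 * (c k / 2)\<close>.\<close>
    then obtain w where w: "w \<in> S" "u w < c k / 4" by auto
    have "c i \<le> 1" for i
    proof (induction i)
      case (Suc i) then show ?case using c(3)[of i] by linarith
    qed (rule c(4))
    then have ck: "c k \<le> 1" .
    define t where "t = 1 - u w"
    have t: "3 / 4 \<le> t" using w ck by (simp add: t_def)
    define S' where "S' = S - {w}"
    have S': "finite S'" "card S' = k" "S' \<subseteq> S" using less(2) w k by (auto simp: S'_def)
    have sums: "sum f S = f w + sum f S'" for f :: "'a \<Rightarrow> 'b::comm_monoid_add"
      unfolding S'_def using less(2) w(1) by (rule sum.remove)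
    define u' where "u' v = u v / t" for v
    have su: "sum u' S' = 1"
      using sums[of u] less(6) t unfolding u'_def sum_divide_distrib[symmetric] by (simp add: t_def)
    have eq: "(\<Sum>v\<in>S'. u' v *\<^sub>R v) = (1 / t) *\<^sub>R ((\<Sum>v\<in>S. u v *\<^sub>R v) - u w *\<^sub>R w)"
      unfolding sums[of "\<lambda>v. u v *\<^sub>R v"] by (simp add: u'_def scaleR_sum_right)
    have "norm (\<Sum>v\<in>S'. u' v *\<^sub>R v) = (1 / t) * norm ((\<Sum>v\<in>S. u v *\<^sub>R v) - u w *\<^sub>R w)"
      unfolding eq using t by simp
    also have "\<dots> \<le> (4 / 3) * (c k / 4 + c k / 4)"
    proof (intro mult_mono)
      show "1 / t \<le> 4 / 3" using t by (simp add: field_simps)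
      have "norm (u w *\<^sub>R w) \<le> c k / 4" using less(4)[OF w(1)] less(5)[OF w(1)] w(2) by simp
      moreover have "norm (\<Sum>v\<in>S. u v *\<^sub>R v) \<le> c k / 4" using less(7) c(3)[of k] k by simp
      ultimately show "norm ((\<Sum>v\<in>S. u v *\<^sub>R v) - u w *\<^sub>R w) \<le> c k / 4 + c k / 4"
        using norm_triangle_ineq4[of "\<Sum>v\<in>S. u v *\<^sub>R v" "u w *\<^sub>R w"] by linarith
    qed auto
    also have "\<dots> \<le> c (card S')" using c(2)[of k] S' by simp
    finally have "\<exists>S''\<subseteq>S'. \<exists>u'. 2 \<le> card S'' \<and> (\<forall>v\<in>S''. c (card S'' - 1) / 4 \<le> u' v) \<and> sum u' S'' = 1 \<and>
        norm (\<Sum>v\<in>S''. u' v *\<^sub>R v) \<le> c (card S'')"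
      using S' k less(4,5) t su
      by (intro less(1)[of S' u']) (auto simp: u'_def)
    then show ?thesis using S'(3) by blast
  qed
qed

text \<open>The point of the convex hull of \<open>F\<close> nearest to 0 decides. If it is far from
  0, its negative direction is the axis of a strict cone. If it is close, Caratheodory's theorem
  writes it with at most \<open>DIM('a) + 1\<close> vectors, and light weights are then
  removed.\<close>

lemma strict_cone_or_balanced:
  fixes c :: "nat \<Rightarrow> real" and F :: "'a::euclidean_space set"
  assumes F: "finite F" "\<And>v. v \<in> F \<Longrightarrow> norm v = 1"
    and c: "c 1 < 1" "\<And>k. 0 < c k" "\<And>k. c (Suc k) \<le> c k / 4" "c 0 \<le> 1"
  shows "(\<exists>m. norm m = 1 \<and> (\<forall>v\<in>F. m \<bullet> v \<le> - c (DIM('a) + 1))) \<or>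
    (\<exists>S\<subseteq>F. \<exists>u. 2 \<le> card S \<and> (\<forall>v\<in>S. c (card S - 1) / 4 \<le> u v) \<and> sum u S = 1 \<and>
      norm (\<Sum>v\<in>S. u v *\<^sub>R v) \<le> c (card S) \<and> card S \<le> DIM('a) + 1)"
proof (cases "F = {}")
  case True
  obtain m :: 'a where "norm m = 1" using vector_choose_size[of 1] by auto
  then show ?thesis using True by auto
next
  case False
  define H where "H = convex hull F"
  have H: "convex H" "closed H" "H \<noteq> {}"
    using F(1) False by (auto simp: H_def finite_imp_compact_convex_hull compact_imp_closed)
  define x where "x = closest_point H 0"
  have xH: "x \<in> H" unfolding x_def by (rule closest_point_in_set[OF H(2,3)])
  have anti: "decseq c"
  proof (rule decseq_SucI)
    show "c (Suc i) \<le> c i" for i using c(2)[of i] c(3)[of i] by linarith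
  qed
  show ?thesis
  proof (cases "norm x \<le> c (DIM('a) + 1)")
    case True
    from xH obtain S where S: "finite S" "S \<subseteq> F" "card S \<le> DIM('a) + 1" "x \<in> convex hull S"
      unfolding H_def caratheodory[of F] by auto
    then obtain u where u: "\<forall>v\<in>S. 0 \<le> u v" "sum u S = 1" "(\<Sum>v\<in>S. u v *\<^sub>R v) = x"
      by (auto simp: convex_hull_finite)
    have "norm x \<le> c (card S)" using True decseqD[OF anti S(3)] by linarith
    then have "\<exists>S'\<subseteq>S. \<exists>u'. 2 \<le> card S' \<and> (\<forall>v\<in>S'. c (card S' - 1) / 4 \<le> u' v) \<and> sum u' S' = 1 \<and>
        norm (\<Sum>v\<in>S'. u' v *\<^sub>R v) \<le> c (card S')"
      using S u F(2) by (intro short_combination_large_weights[OF _ _ _ _ _ _ c]) auto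
    then obtain S' u' where S': "S' \<subseteq> S" "2 \<le> card S'" "\<forall>v\<in>S'. c (card S' - 1) / 4 \<le> u' v"
      "sum u' S' = 1" "norm (\<Sum>v\<in>S'. u' v *\<^sub>R v) \<le> c (card S')" by blast
    have "card S' \<le> DIM('a) + 1" using card_mono[OF S(1) S'(1)] S(3) by simp
    moreover have "S' \<subseteq> F" using S'(1) S(2) by blast
    ultimately show ?thesis using S' by blast
  next
    case False
    then have x: "0 < norm x" using c(2)[of "DIM('a) + 1"] by linarith
    have "- (x /\<^sub>R norm x) \<bullet> v \<le> - c (DIM('a) + 1)" if "v \<in> F" for v
    proof -
      have "v \<in> H" using that by (simp add: H_def hull_inc)
      from closest_point_dot[OF H(1,2) this, of 0]
      have "norm x * norm x \<le> x \<bullet> v"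
        by (simp add: x_def[symmetric] inner_diff_right power2_norm_eq_inner[symmetric] power2_eq_square)
      then have "norm x \<le> (x /\<^sub>R norm x) \<bullet> v" using x by (simp add: field_simps)
      then show ?thesis using False by simp
    qed
    moreover have "norm (- (x /\<^sub>R norm x)) = 1" using x by simp
    ultimately show ?thesis by blast
  qed
qed

text \<open>Each time \<open>j\<close> in \<open>J\<close> puts \<open>m \<bullet> y j\<close> at
  least \<open>l j\<close> above all later values, so these drops add up whatever happens in
  between. The witness \<open>t\<close> is the first time in \<open>J\<close>, or \<open>q\<close>
  if there is none.\<close>

lemma descending_sum_le:
  fixes y :: "nat \<Rightarrow> 'a::real_inner"
  assumes "p \<le> q" "\<And>j s. j \<in> J \<Longrightarrow> p \<le> j \<Longrightarrow> j < s \<Longrightarrow> s \<le> q \<Longrightarrow> m \<bullet> (y s - y j) \<le> - l j"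
  shows "\<exists>t\<in>{p..q}. sum l (J \<inter> {p..<q}) \<le> m \<bullet> y t - m \<bullet> y q"
  using assms
proof (induction p rule: inc_induct)
  case base then show ?case by auto
next
  case (step p)
  then obtain t where t: "t \<in> {Suc p..q}" "sum l (J \<inter> {Suc p..<q}) \<le> m \<bullet> y t - m \<bullet> y q"
    by (metis Suc_leD)
  show ?case
  proof (cases "p \<in> J")
    case True
    have "J \<inter> {p..<q} = insert p (J \<inter> {Suc p..<q})" using True step(2) by auto
    moreover have "m \<bullet> (y t - y p) \<le> - l p" using t True by (intro step(4)) auto
    ultimately show ?thesis using t(2) step(2) by (intro bexI[of _ p]) (auto simp: inner_diff_right)
  next
    case False
    then have "J \<inter> {p..<q} = J \<inter> {Suc p..<q}" using le_eq_less_or_eq by (auto simp: Suc_le_eq)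
    then show ?thesis using t by (intro bexI[of _ t]) auto
  qed
qed

text \<open>Without a strict cone, finitely many directions to future points are balanced with
  weights bounded below, so \<open>y j\<close> is nearly a convex combination \<open>b\<close> of
  future points. Until the first of these is visited, each of them bounds the normals from above in
  its direction, and balance turns this into almost orthogonality. Then \<open>squeezed\<close>
  keeps the path closer to \<open>y j\<close> than any of these points. The hypothesis
  \<open>good\<close> turns slack proportional to length into slack proportional to
  distance.\<close>

lemma future_cone:
  fixes a K :: real and V :: "'a::euclidean_space set"
  assumes a: "0 < a" and s: "0 < \<sigma>" "1 < B" and V: "subspace V" "squeezed V a \<sigma> B"
    and c: "c 1 < 1" "\<And>k. 0 < c k" "\<And>k. c (Suc k) \<le> c k / 8" "c 0 \<le> 1"
    and c2: "\<And>k. c (Suc k) * (1 + B) \<le> (c k / 4)\<^sup>2 * (\<sigma> / 2)" "\<And>k. B * c (Suc k) \<le> c k / 4"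
    and K: "0 < \<delta>" "\<delta> \<le> \<sigma>" "\<delta> * K \<le> 1" "\<And>k. k \<le> DIM('a) + 1 \<Longrightarrow> \<delta> * K \<le> \<sigma> * c k" "0 \<le> K"
    and ch: "chain a \<delta> V y n l p q"
    and good: "\<And>i j. p \<le> i \<Longrightarrow> i < j \<Longrightarrow> j \<le> q \<Longrightarrow> sum l {i..<j} \<le> K * norm (y j - y i)"
    and j: "p \<le> j" "j < q" "0 < l j"
  shows "\<exists>m. norm m = 1 \<and> (\<forall>s\<in>{j<..q}. m \<bullet> (y s - y j) \<le> - c (DIM('a) + 1) * norm (y s - y j) \<and>
    a / 2 * l j \<le> norm (y s - y j))"
proof -
  have c4: "c (Suc k) \<le> c k / 4" for k using c(2,3)[of k] by linarith
  have far: "a / 2 * l j \<le> norm (y s - y j)" if "s \<in> {j<..q}" for s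
  proof -
    have s: "j < s" "s \<le> q" using that by auto
    have "- norm (y s - y j) \<le> n j \<bullet> (y s - y j)"
    proof -
      have "\<bar>n j \<bullet> (y s - y j)\<bar> \<le> norm (n j) * norm (y s - y j)" by (rule Cauchy_Schwarz_ineq2)
      also have "\<dots> \<le> 1 * norm (y s - y j)"
        using chainD(3)[OF ch j(1,2)] by (intro mult_right_mono) auto
      finally show ?thesis by linarith
    qed
    moreover have "n j \<bullet> (y s - y j) \<le> - a * l j + \<delta> * sum l {j..<s}"
      by (rule chainD(6)[OF ch j(1) s])
    moreover have "\<delta> * sum l {j..<s} \<le> \<delta> * (K * norm (y s - y j))"
      using good[OF j(1) s] K(1) by (intro mult_left_mono) auto
    moreover have "\<delta> * K * norm (y s - y j) \<le> 1 * norm (y s - y j)"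
      using K(3) by (intro mult_right_mono) auto
    ultimately show ?thesis by (simp add: algebra_simps)
  qed
  have pos: "0 < norm (y s - y j)" if "s \<in> {j<..q}" for s
    using far[OF that] mult_pos_pos[OF half_gt_zero[OF a] j(3)] by linarith
  define e where "e s = (y s - y j) /\<^sub>R norm (y s - y j)" for s
  define F where "F = e ` {j<..q}"
  have F: "finite F" "\<And>v. v \<in> F \<Longrightarrow> norm v = 1" using pos by (auto simp: F_def e_def)
  have unbal: "\<not> (\<exists>S\<subseteq>F. \<exists>u. 2 \<le> card S \<and> (\<forall>v\<in>S. c (card S - 1) / 4 \<le> u v) \<and> sum u S = 1 \<and>
      norm (\<Sum>v\<in>S. u v *\<^sub>R v) \<le> c (card S) \<and> card S \<le> DIM('a) + 1)"
  proof (intro notI, elim exE conjE)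
    fix S u
    assume S: "S \<subseteq> F" "2 \<le> card S" "\<forall>v\<in>S. c (card S - 1) / 4 \<le> u v" "sum u S = 1"
      "norm (\<Sum>v\<in>S. u v *\<^sub>R v) \<le> c (card S)" "card S \<le> DIM('a) + 1"
    define k where "k = card S - 1"
    define \<kappa> where "\<kappa> = c k / 4"
    have k: "card S = Suc k" using S(2) by (simp add: k_def)
    have lam: "0 < \<kappa>" "\<kappa> \<le> 1"
    proof -
      show "0 < \<kappa>" using c(2)[of k] by (simp add: \<kappa>_def)
      have "c i \<le> 1" for i
      proof (induction i)
        case (Suc i) then show ?case using c(3)[of i] by linarith
      qed (rule c(4))
      from this[of k] show "\<kappa> \<le> 1" by (simp add: \<kappa>_def)
    qed
    have fS: "finite S" "S \<noteq> {}" using S(1,2) F finite_subset by auto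
    have ul: "\<kappa> \<le> u v" "0 < u v" if "v \<in> S" for v
      using S(3) that lam by (auto simp: \<kappa>_def k_def)
    have "\<forall>v\<in>S. \<exists>s. s \<in> {j<..q} \<and> v = e s" using S(1) unfolding F_def by blast
    from bchoice[OF this] obtain g where g: "\<And>v. v \<in> S \<Longrightarrow> g v \<in> {j<..q} \<and> v = e (g v)" by blast
    define r where "r v = norm (y (g v) - y j)" for v
    have r: "0 < r v" "y (g v) - y j = r v *\<^sub>R v" if "v \<in> S" for v
    proof -
      show "0 < r v" using pos g that by (auto simp: r_def)
      have "v = (y (g v) - y j) /\<^sub>R r v" using g[OF that] by (simp add: e_def r_def)
      then have "r v *\<^sub>R v = r v *\<^sub>R ((y (g v) - y j) /\<^sub>R r v)" by simp
      then show "y (g v) - y j = r v *\<^sub>R v" using \<open>0 < r v\<close> by simp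
    qed
    \<comment> \<open>\<open>v0\<close> belongs to the nearest of the selected points, and
      \<open>t\<close> is the first time at which one of them is visited; these may be different
      points.\<close>
    define \<rho> where "\<rho> = Min (r ` S)"
    have "\<rho> \<in> r ` S" unfolding \<rho>_def using fS by (intro Min_in) auto
    then obtain v0 where v0: "v0 \<in> S" "\<rho> = r v0" by blast
    have rho: "0 < \<rho>" "\<And>v. v \<in> S \<Longrightarrow> \<rho> \<le> r v"
    proof -
      show "0 < \<rho>" using r(1)[OF v0(1)] v0(2) by simp
      show "\<rho> \<le> r v" if "v \<in> S" for v unfolding \<rho>_def by (rule Min_le) (use fS that in auto)
    qed
    define t where "t = Min (g ` S)"
    have "t \<in> g ` S" unfolding t_def using fS by (intro Min_in) auto
    then obtain v1 where v1: "v1 \<in> S" "t = g v1" by blast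
    have t: "j < t" "t \<le> q" "\<And>v. v \<in> S \<Longrightarrow> t \<le> g v"
    proof -
      show "j < t" "t \<le> q" using v1(2) g[OF v1(1)] by auto
      show "t \<le> g v" if "v \<in> S" for v unfolding t_def by (rule Min_le) (use fS that in auto)
    qed
    \<comment> \<open>The weights \<open>u v\<close> balance unit directions. Dividing them by the
      distances \<open>r v\<close> and normalising by \<open>T\<close> balances the points
      themselves: \<open>b - y j\<close> is \<open>1 / T\<close> times the short sum.\<close>
    define T where "T = (\<Sum>v\<in>S. u v / r v)"
    have "u v0 / r v0 \<le> T"
      unfolding T_def by (rule member_le_sum) (use v0 ul r fS in \<open>auto intro: divide_nonneg_pos less_imp_le\<close>)
    moreover have "\<kappa> / \<rho> \<le> u v0 / r v0" using ul[OF v0(1)] rho v0 by (auto intro: divide_right_mono)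
    ultimately have T: "\<kappa> / \<rho> \<le> T" by linarith
    have T0: "0 < T" using T divide_pos_pos[OF lam(1) rho(1)] by linarith
    have iT: "1 / T \<le> \<rho> / \<kappa>" using T T0 lam rho by (simp add: field_simps)
    define \<mu> where "\<mu> v = u v / (r v * T)" for v
    have mu: "sum \<mu> S = 1" "\<And>v. v \<in> S \<Longrightarrow> 0 \<le> \<mu> v"
    proof -
      have "sum \<mu> S = T / T"
        unfolding T_def[of] sum_divide_distrib by (rule sum.cong) (auto simp: \<mu>_def T_def)
      then show "sum \<mu> S = 1" using T0 by simp
      show "0 \<le> \<mu> v" if "v \<in> S" for v using ul[OF that] r[OF that] T0 by (simp add: \<mu>_def)
    qed
    have mur: "\<mu> v * r v = u v / T" if "v \<in> S" for v using r[OF that] by (simp add: \<mu>_def)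
    define b where "b = (\<Sum>v\<in>S. \<mu> v *\<^sub>R y (g v))"
    have inner_b: "w \<bullet> (b - x) = (\<Sum>v\<in>S. \<mu> v * (w \<bullet> (y (g v) - x)))" for w x
    proof -
      have "b - x = (\<Sum>v\<in>S. \<mu> v *\<^sub>R (y (g v) - x))"
        using mu(1) by (simp add: b_def scaleR_diff_right sum_subtractf scaleR_sum_left[symmetric])
      then show ?thesis by (simp add: inner_sum_right)
    qed
    have bV: "b \<in> V" unfolding b_def
    proof (intro subspace_sum subspace_scale V(1) chainD(1)[OF ch])
      show "p \<le> g v" "g v \<le> q" if "v \<in> S" for v using g[OF that] j by auto
    qed
    \<comment> \<open>The radius must cover the distance from \<open>y j\<close> to
      \<open>b\<close>, while by \<open>c2\<close> even the open ball of radius \<open>B * R\<close>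
      about \<open>y j\<close> contains none of the selected points.\<close>
    define R where "R = c (Suc k) / \<kappa> * \<rho>"
    have R: "0 < R" "B * R \<le> \<rho>"
    proof -
      show "0 < R" using c(2) lam rho by (simp add: R_def)
      have "B * c (Suc k) \<le> \<kappa>" using c2(2) by (simp add: \<kappa>_def)
      then have "B * c (Suc k) / \<kappa> \<le> 1" using lam by (simp add: field_simps)
      from mult_right_mono[OF this, of \<rho>] rho show "B * R \<le> \<rho>" by (simp add: R_def)
    qed
    have yb: "norm (y j - b) \<le> R"
    proof -
      have "b - y j = (\<Sum>v\<in>S. \<mu> v *\<^sub>R (y (g v) - y j))"
        using mu(1) by (simp add: b_def scaleR_diff_right sum_subtractf scaleR_sum_left[symmetric])
      also have "\<dots> = (\<Sum>v\<in>S. (u v / T) *\<^sub>R v)"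
        by (rule sum.cong) (auto simp: r(2) mur)
      also have "\<dots> = (1 / T) *\<^sub>R (\<Sum>v\<in>S. u v *\<^sub>R v)" by (simp add: scaleR_sum_right)
      finally have "norm (b - y j) = 1 / T * norm (\<Sum>v\<in>S. u v *\<^sub>R v)" using T0 by simp
      also have "\<dots> \<le> \<rho> / \<kappa> * c (Suc k)"
        using iT S(5) k T0 rho lam by (intro mult_mono) auto
      finally show ?thesis by (simp add: R_def norm_minus_commute mult.commute)
    qed
    have v0V: "v0 \<in> V"
    proof -
      have "p \<le> g v0" "g v0 \<le> q" using g[OF v0(1)] j by auto
      then have "e (g v0) \<in> V"
        unfolding e_def by (intro subspace_scale subspace_diff V(1) chainD(1)[OF ch]) (use j in auto)
      then show ?thesis using g[OF v0(1)] by simp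
    qed
    have cond: "\<bar>n i \<bullet> v0\<bar> \<le> \<sigma> \<and> n i \<bullet> (b - y i) \<le> - a * l i + \<sigma> * R"
      if i: "j \<le> i" "i < t" "norm (y i - y j) < B * R" for i
    proof -
      have ipq: "p \<le> i" "i < q" using i j t by auto
      have al: "0 \<le> a * l i" using chainD(4)[OF ch ipq] a by simp
      have fut: "n i \<bullet> (y (g v) - y i) \<le> - a * l i + \<delta> * K * r v" if "v \<in> S" for v
      proof -
        have gv: "j < g v" "i < g v" "g v \<le> q" using g[OF that] t(3)[OF that] i by auto
        have "sum l {i..<g v} \<le> sum l {j..<g v}"
          using chain_sum_mono[OF ch, of j "g v" i "g v"] j i gv by auto
        also have "\<dots> \<le> K * r v" using good[of j "g v"] j gv by (simp add: r_def)
        finally have "\<delta> * sum l {i..<g v} \<le> \<delta> * (K * r v)" using K(1) by (intro mult_left_mono) auto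
        then show ?thesis using chainD(6)[OF ch ipq(1) gv(2,3)] by simp
      qed
      define h where "h = \<delta> * K + B * c (Suc k) / \<kappa>"
      have BRh: "B * R = B * c (Suc k) / \<kappa> * \<rho>" by (simp add: R_def)
      have Bc: "0 \<le> B * c (Suc k) / \<kappa>" using s c(2)[of "Suc k"] lam by simp
      have nv: "n i \<bullet> v \<le> h" if "v \<in> S" for v
      proof -
        have "\<bar>n i \<bullet> (y i - y j)\<bar> \<le> norm (n i) * norm (y i - y j)" by (rule Cauchy_Schwarz_ineq2)
        also have "\<dots> \<le> 1 * norm (y i - y j)"
          using chainD(3)[OF ch ipq] by (intro mult_right_mono) auto
        finally have 1: "n i \<bullet> (y i - y j) \<le> B * R" using i(3) by linarith
        have 2: "B * R \<le> B * c (Suc k) / \<kappa> * r v"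
          unfolding BRh using rho(2)[OF that] Bc by (intro mult_left_mono) auto
        have "r v * (n i \<bullet> v) = n i \<bullet> (y (g v) - y j)" by (simp add: r(2)[OF that])
        also have "\<dots> = n i \<bullet> (y (g v) - y i) + n i \<bullet> (y i - y j)" by (simp add: inner_diff_right)
        also have "\<dots> \<le> \<delta> * K * r v + B * c (Suc k) / \<kappa> * r v"
          using fut[OF that] 1 2 al by (simp only: mult_minus_left)
        also have "\<dots> = r v * h" by (simp add: h_def algebra_simps)
        finally show ?thesis using r(1)[OF that] by (rule mult_left_le_imp_le)
      qed
      have dKl: "\<delta> * K \<le> \<sigma> * c (Suc k)" using K(4) S(6) k by simp
      have hs: "c (Suc k) + h \<le> \<sigma> * \<kappa>"
      proof -
        have 1: "c (Suc k) * (1 + B) \<le> \<kappa>\<^sup>2 * (\<sigma> / 2)" using c2(1) by (simp add: \<kappa>_def)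
        have "c (Suc k) + B * c (Suc k) / \<kappa> \<le> c (Suc k) * (1 + B) / \<kappa>"
        proof -
          have "c (Suc k) * \<kappa> \<le> c (Suc k) * 1" using c(2)[of "Suc k"] lam by (intro mult_left_mono) auto
          then show ?thesis using lam by (simp add: field_simps)
        qed
        also have "\<dots> \<le> \<kappa>\<^sup>2 * (\<sigma> / 2) / \<kappa>" using 1 lam by (intro divide_right_mono) auto
        also have "\<dots> = \<sigma> * \<kappa> / 2" using lam by (simp add: power2_eq_square)
        finally have 2: "c (Suc k) + B * c (Suc k) / \<kappa> \<le> \<sigma> * \<kappa> / 2" .
        have "c (Suc k) \<le> \<kappa> / 2" using c(3)[of k] by (simp add: \<kappa>_def)
        then have "\<sigma> * c (Suc k) \<le> \<sigma> * (\<kappa> / 2)" using s by (intro mult_left_mono) auto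
        then have "\<delta> * K \<le> \<sigma> * \<kappa> / 2" using dKl by simp
        then show ?thesis using 2 unfolding h_def by linarith
      qed
      \<comment> \<open>The sum of the \<open>u v * (n i \<bullet> v)\<close> is nearly 0 or larger,
        and every term is at most \<open>u v * h\<close>, so no single term can be very negative.
        Dividing by \<open>u v0 \<ge> \<kappa>\<close> then bounds \<open>n i \<bullet> v0\<close>
        from below.\<close>
      have low: "- (c (Suc k) + h) \<le> u v0 * (n i \<bullet> v0)"
      proof -
        have "\<bar>n i \<bullet> (\<Sum>v\<in>S. u v *\<^sub>R v)\<bar> \<le> norm (n i) * norm (\<Sum>v\<in>S. u v *\<^sub>R v)"
          by (rule Cauchy_Schwarz_ineq2)
        also have "\<dots> \<le> 1 * c (Suc k)"
          using chainD(3)[OF ch ipq] S(5) k by (intro mult_mono) auto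
        finally have "- c (Suc k) \<le> (\<Sum>v\<in>S. u v * (n i \<bullet> v))" by (simp add: inner_sum_right)
        also have "\<dots> = u v0 * (n i \<bullet> v0) + (\<Sum>v\<in>S - {v0}. u v * (n i \<bullet> v))"
          by (rule sum.remove[OF fS(1) v0(1)])
        also have "(\<Sum>v\<in>S - {v0}. u v * (n i \<bullet> v)) \<le> (\<Sum>v\<in>S - {v0}. u v * h)"
          using nv ul by (intro sum_mono mult_left_mono) (auto intro: less_imp_le)
        also have "\<dots> = (sum u S - u v0) * h"
          using fS(1) v0(1) by (simp add: sum_distrib_right[symmetric] sum_diff1)
        also have "\<dots> \<le> 1 * h"
          using S(4) ul[OF v0(1)] Bc K(1,5) by (intro mult_right_mono) (auto simp: h_def)
        finally show ?thesis by simp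
      qed
      have "- \<sigma> \<le> n i \<bullet> v0"
      proof (rule ccontr)
        assume "\<not> - \<sigma> \<le> n i \<bullet> v0"
        then have neg: "n i \<bullet> v0 < - \<sigma>" by simp
        have "u v0 * (n i \<bullet> v0) < u v0 * (- \<sigma>)" using neg ul[OF v0(1)] by (intro mult_strict_left_mono) auto
        also have "\<dots> \<le> \<kappa> * (- \<sigma>)" using ul[OF v0(1)] s by (intro mult_right_mono_neg) auto
        finally show False using low hs by (simp add: mult.commute)
      qed
      moreover have "n i \<bullet> v0 \<le> \<sigma>"
      proof -
        have "\<sigma> * \<kappa> \<le> \<sigma> * 1" using lam s by (intro mult_left_mono) auto
        then show ?thesis using nv[OF v0(1)] hs c(2)[of "Suc k"] by linarith
      qed
      moreover have "n i \<bullet> (b - y i) \<le> - a * l i + \<sigma> * R"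
      proof -
        have "n i \<bullet> (b - y i) \<le> (\<Sum>v\<in>S. \<mu> v * (- a * l i + \<delta> * K * r v))"
          unfolding inner_b using fut mu(2) by (intro sum_mono mult_left_mono)
        also have "\<dots> = (\<Sum>v\<in>S. \<mu> v * (- a * l i)) + (\<Sum>v\<in>S. \<delta> * K * (u v / T))"
          unfolding sum.distrib[symmetric] by (rule sum.cong) (auto simp: algebra_simps mur[symmetric])
        also have "\<dots> = - a * l i + \<delta> * K * (1 / T)"
          by (simp only: sum_distrib_left[symmetric] sum_distrib_right[symmetric] sum_divide_distrib[symmetric]
              mu(1) S(4) mult_1)
        also have "\<delta> * K * (1 / T) \<le> \<sigma> * c (Suc k) * (\<rho> / \<kappa>)"
          by (rule mult_mono[OF dKl iT]) (use T0 s c(2)[of "Suc k"] in \<open>auto simp: less_imp_le\<close>)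
        also have "\<dots> = \<sigma> * R" by (simp add: R_def)
        finally show ?thesis by simp
      qed
      ultimately show ?thesis by (simp add: abs_le_iff)
    qed
    have "chain a \<sigma> V y n l j t"
      by (rule chain_slack_mono[OF chain_subinterval[OF ch]]) (use j t K in auto)
    then have "norm (y t - y j) < B * R"
      using V(2)[unfolded squeezed_def, rule_format, of y n l j t v0 b R t] t v0V F(2) S(1) v0(1)
        bV R(1) yb cond by auto
    moreover have "\<rho> \<le> norm (y t - y j)" using rho(2)[OF v1(1)] v1(2) by (simp add: r_def)
    ultimately show False using R(2) by linarith
  qed
  have "\<exists>m. norm m = 1 \<and> (\<forall>v\<in>F. m \<bullet> v \<le> - c (DIM('a) + 1))"
    by (rule disjE[OF strict_cone_or_balanced[OF F c(1,2) c4 c(4)]]) (assumption | erule notE[OF unbal])+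
  then obtain m where m: "norm m = 1" "\<forall>v\<in>F. m \<bullet> v \<le> - c (DIM('a) + 1)" by blast
  have "m \<bullet> (y s - y j) \<le> - c (DIM('a) + 1) * norm (y s - y j)" if "s \<in> {j<..q}" for s
  proof -
    have "m \<bullet> e s \<le> - c (DIM('a) + 1)" using m(2) that by (auto simp: F_def)
    moreover have "m \<bullet> (y s - y j) = norm (y s - y j) * (m \<bullet> e s)" using pos[OF that] by (simp add: e_def)
    ultimately show ?thesis using mult_left_mono[of "m \<bullet> e s" "- c (DIM('a) + 1)" "norm (y s - y j)"]
      by (simp add: mult.commute)
  qed
  then show ?thesis using m(1) far by blast
qed

section \<open>Length bounds\<close>

text \<open>Rounding the axes of the cones from \<open>future_cone\<close> to a finite net leaves
  finitely many linear functionals, and the steps assigned to one of them have bounded total length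
  by \<open>descending_sum_le\<close>. The opening of the cones depends only on
  \<open>\<sigma>\<close>, \<open>B\<close> and the dimension, and \<open>K\<close> affects only the
  admissible slack; this is why \<open>C\<close> can be fixed before \<open>K\<close>.\<close>

lemma length_bounded_good:
  fixes a :: real
  assumes a: "0 < a" and s: "0 < \<sigma>" "1 < B"
  shows "\<exists>C>0. \<forall>K\<ge>1. \<exists>\<delta>>0. \<forall>(V::'a::euclidean_space set) y n l p q D.
    subspace V \<and> squeezed V a \<sigma> B \<and> chain a \<delta> V y n l p q \<and> p \<le> q \<and>
    (\<forall>i j. p \<le> i \<and> i < j \<and> j \<le> q \<longrightarrow> sum l {i..<j} \<le> K * norm (y j - y i)) \<and>
    (\<forall>i\<in>{p..q}. norm (y i - y p) \<le> D) \<longrightarrow> sum l {p..<q} \<le> C * D"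
proof -
  define \<zeta> where "\<zeta> = min 1 \<sigma> / (32 * (1 + B))"
  \<comment> \<open>In \<open>future_cone\<close> the next threshold is divided by the smallest
    weight twice, once in the radius \<open>R\<close> and once to isolate a single direction; hence
    the quadratic recursion.\<close>
  define c :: "nat \<Rightarrow> real" where "c = rec_nat (1/2) (\<lambda>_ x. \<zeta> * x\<^sup>2)"
  have c0: "c 0 = 1/2" and cS: "c (Suc k) = \<zeta> * (c k)\<^sup>2" for k by (simp_all add: c_def)
  have z: "0 < \<zeta>" "\<zeta> \<le> 1 / 32" "\<zeta> * (1 + B) \<le> \<sigma> / 32" "\<zeta> * (1 + B) \<le> 1 / 32"
  proof -
    have "\<zeta> * (1 + B) = min 1 \<sigma> / 32" using s by (simp add: \<zeta>_def field_simps)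
    then show "\<zeta> * (1 + B) \<le> \<sigma> / 32" "\<zeta> * (1 + B) \<le> 1 / 32" by auto
    show "0 < \<zeta>" using s by (simp add: \<zeta>_def)
    have "\<zeta> * 1 \<le> \<zeta> * (1 + B)" using \<open>0 < \<zeta>\<close> s by (intro mult_left_mono) auto
    then show "\<zeta> \<le> 1 / 32" using \<open>\<zeta> * (1 + B) \<le> 1 / 32\<close> by simp
  qed
  have c12: "0 < c k \<and> c k \<le> 1 / 2" for k
  proof (induction k)
    case (Suc k)
    have "\<zeta> * (c k)\<^sup>2 \<le> 1 * (1 / 2)\<^sup>2" using Suc z by (intro mult_mono power_mono) auto
    then show ?case using Suc z(1) by (auto simp: cS power2_eq_square)
  qed (simp add: c0)
  have csq: "(c k)\<^sup>2 \<le> c k * (1 / 2)" "0 < (c k)\<^sup>2" for k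
    using c12[of k] by (auto simp: power2_eq_square)
  have c3: "c (Suc k) \<le> c k / 8" for k
  proof -
    have "c (Suc k) \<le> 1 / 32 * (c k * (1 / 2))"
      unfolding cS using csq[of k] z by (intro mult_mono) auto
    then show ?thesis using c12[of k] by linarith
  qed
  have c5: "c (Suc k) * (1 + B) \<le> (c k / 4)\<^sup>2 * (\<sigma> / 2)" for k
    using mult_right_mono[OF z(3), of "(c k)\<^sup>2"] by (simp add: cS power_divide algebra_simps)
  have c6: "B * c (Suc k) \<le> c k / 4" for k
  proof -
    have "B * \<zeta> \<le> 1 / 32" using z by (simp add: algebra_simps)
    then have "B * \<zeta> * (c k)\<^sup>2 \<le> 1 / 32 * (c k * (1 / 2))"
      using csq[of k] by (intro mult_mono) auto
    then show ?thesis using c12[of k] by (simp add: cS)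
  qed
  have c1: "c 1 < 1" using c12[of 1] by simp
  define N where "N = DIM('a) + 1"
  have anti: "decseq c"
  proof (rule decseq_SucI)
    show "c (Suc i) \<le> c i" for i using c12[of i] c3[of i] by linarith
  qed
  obtain S :: "'a set" where S: "finite S" "\<And>u. norm u = 1 \<Longrightarrow> \<exists>m\<in>S. norm m = 1 \<and> norm (u - m) < c N / 2"
    using sphere_net[of "c N / 2"] c12[of N] by auto
  define e where "e = c N / 2 * (a / 2)"
  have e: "0 < e" using a c12[of N] by (simp add: e_def)
  \<comment> \<open>Adding 1 makes \<open>C\<close> positive without an appeal to the net being
    nonempty.\<close>
  define C where "C = (real (card S) + 1) * (2 / e)"
  have C: "0 < C" using e by (simp add: C_def)
  have "\<exists>\<delta>>0. \<forall>(V::'a set) y n l p q D.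
    subspace V \<and> squeezed V a \<sigma> B \<and> chain a \<delta> V y n l p q \<and> p \<le> q \<and>
    (\<forall>i j. p \<le> i \<and> i < j \<and> j \<le> q \<longrightarrow> sum l {i..<j} \<le> K * norm (y j - y i)) \<and>
    (\<forall>i\<in>{p..q}. norm (y i - y p) \<le> D) \<longrightarrow> sum l {p..<q} \<le> C * D" if K: "1 \<le> K" for K
  proof -
    define \<delta> where "\<delta> = min 1 \<sigma> * c N / K"
    have d: "0 < \<delta>" using K s c12[of N] by (simp add: \<delta>_def)
    have dK: "\<delta> * K = min 1 \<sigma> * c N" using K by (simp add: \<delta>_def)
    have "\<delta> * 1 \<le> \<delta> * K" using d K by (intro mult_left_mono) auto
    also have "\<dots> \<le> \<sigma> * 1" unfolding dK using c12[of N] s by (intro mult_mono) auto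
    finally have d2: "\<delta> \<le> \<sigma>" by simp
    have "\<delta> * K \<le> 1 * 1" unfolding dK using c12[of N] s by (intro mult_mono) auto
    then have d3: "\<delta> * K \<le> 1" by simp
    have d4: "\<delta> * K \<le> \<sigma> * c k" if "k \<le> DIM('a) + 1" for k
      unfolding dK using decseqD[OF anti that] c12[of N] s by (intro mult_mono) (auto simp: N_def)
    have "sum l {p..<q} \<le> C * D"
      if V: "subspace V" "squeezed V a \<sigma> B" and ch: "chain a \<delta> V y n l p q" and pq: "p \<le> q"
        and good: "\<And>i j. p \<le> i \<Longrightarrow> i < j \<Longrightarrow> j \<le> q \<Longrightarrow> sum l {i..<j} \<le> K * norm (y j - y i)"
        and D: "\<And>i. i \<in> {p..q} \<Longrightarrow> norm (y i - y p) \<le> D"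
      for V :: "'a set" and y n l p q D
    proof -
      define J where "J = {j \<in> {p..<q}. 0 < l j}"
      have "\<forall>j\<in>J. \<exists>m. m \<in> S \<and> norm m = 1 \<and> (\<forall>s\<in>{j<..q}. m \<bullet> (y s - y j) \<le> - (e * l j))"
      proof
        fix j assume "j \<in> J"
        then have j: "p \<le> j" "j < q" "0 < l j" by (auto simp: J_def)
        obtain m where m: "norm m = 1" "\<And>s. s \<in> {j<..q} \<Longrightarrow>
            m \<bullet> (y s - y j) \<le> - c N * norm (y s - y j) \<and> a / 2 * l j \<le> norm (y s - y j)"
          using future_cone[of a \<sigma> B V c, OF a s V c1 _ c3 _ c5 c6 d d2 d3 d4 _ ch good j] c12 K c0
          unfolding N_def by force
        obtain m' where m': "m' \<in> S" "norm m' = 1" "norm (m - m') < c N / 2" using S(2)[OF m(1)] by blast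
        have "m' \<bullet> (y s - y j) \<le> - (e * l j)" if "s \<in> {j<..q}" for s
        proof -
          have "\<bar>(m - m') \<bullet> (y s - y j)\<bar> \<le> norm (m - m') * norm (y s - y j)" by (rule Cauchy_Schwarz_ineq2)
          also have "\<dots> \<le> c N / 2 * norm (y s - y j)" using m'(3) by (intro mult_right_mono) auto
          finally have "m' \<bullet> (y s - y j) \<le> - (c N / 2 * norm (y s - y j))"
            using conjunct1[OF m(2)[OF that]] unfolding inner_diff_left by linarith
          moreover have "c N / 2 * (a / 2 * l j) \<le> c N / 2 * norm (y s - y j)"
            using m(2)[OF that] c12[of N] by (intro mult_left_mono) auto
          moreover have "e * l j = c N / 2 * (a / 2 * l j)" by (simp add: e_def)
          ultimately show ?thesis by linarith
        qed
        then show "\<exists>m. m \<in> S \<and> norm m = 1 \<and> (\<forall>s\<in>{j<..q}. m \<bullet> (y s - y j) \<le> - (e * l j))"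
          using m' by blast
      qed
      from bchoice[OF this] obtain f where f: "\<And>j. j \<in> J \<Longrightarrow> f j \<in> S \<and> norm (f j) = 1 \<and>
          (\<forall>s\<in>{j<..q}. f j \<bullet> (y s - y j) \<le> - (e * l j))"
        by blast
      have D0: "0 \<le> D" using D[of p] pq by auto
      have part: "e * sum l {j \<in> J. f j = m} \<le> 2 * D" for m
      proof (cases "{j \<in> J. f j = m} = {}")
        case True
        show ?thesis unfolding True using D0 by simp
      next
        case False
        then have m1: "norm m = 1" using f by auto
        have "\<exists>t\<in>{p..q}. sum (\<lambda>j. e * l j) ({j \<in> J. f j = m} \<inter> {p..<q}) \<le> m \<bullet> y t - m \<bullet> y q"
          using f by (intro descending_sum_le pq) auto
        then obtain t where t: "t \<in> {p..q}"
          "sum (\<lambda>j. e * l j) ({j \<in> J. f j = m} \<inter> {p..<q}) \<le> m \<bullet> y t - m \<bullet> y q" by blast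
        have "{j \<in> J. f j = m} \<inter> {p..<q} = {j \<in> J. f j = m}" by (auto simp: J_def)
        then have "e * sum l {j \<in> J. f j = m} \<le> m \<bullet> (y t - y q)"
          using t(2) by (simp add: sum_distrib_left inner_diff_right)
        also have "\<dots> \<le> norm m * norm (y t - y q)" by (rule norm_cauchy_schwarz)
        also have "\<dots> \<le> norm (y t - y p) + norm (y q - y p)"
          using norm_triangle_ineq4[of "y t - y p" "y q - y p"] m1 by simp
        also have "\<dots> \<le> 2 * D" using D[OF t(1)] D[of q] pq by simp
        finally show ?thesis .
      qed
      have fJ: "finite J" by (simp add: J_def)
      have "sum l {p..<q} = sum l J"
        by (rule sum.mono_neutral_right) (use chainD(4)[OF ch] in \<open>force simp: J_def\<close>)+
      also have "\<dots> = (\<Sum>m\<in>S. sum l {j \<in> J. f j = m})"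
        by (rule sum.group[symmetric]) (use fJ S f in auto)
      also have "\<dots> \<le> (\<Sum>m\<in>S. 2 * D / e)"
        using part e by (intro sum_mono) (simp add: field_simps)
      also have "\<dots> = real (card S) * (2 * D / e)" by simp
      also have "\<dots> \<le> (real (card S) + 1) * (2 * D / e)"
        using D0 e by (intro mult_right_mono) auto
      also have "\<dots> = C * D" by (simp add: C_def)
      finally show ?thesis .
    qed
    then show ?thesis using d by blast
  qed
  then show ?thesis using C by blast
qed

text \<open>Once every piece of the chain is at most \<open>K\<close> times as long as its chord,
  \<open>length_bounded_good\<close> applies. In a shortest piece violating this, all shorter pieces
  are good, so its length is at most \<open>C'\<close> times its radius \<open>D'\<close>. As its
  chord is short, it ends close to its start; \<open>confined\<close> then puts it into a ball about
  its last point that is too small for the radius \<open>D'\<close>.\<close>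

lemma length_bounded_step:
  fixes a :: real
  assumes a: "0 < a" and s: "0 < \<sigma>" "1 < B"
    and sq: "\<And>V::'a::euclidean_space set. subspace V \<Longrightarrow> dim V = k \<Longrightarrow> squeezed V a \<sigma> B"
    and E: "1 \<le> \<Lambda>" "\<And>K. 0 < K \<Longrightarrow> \<exists>\<delta>>0. \<forall>V::'a set. subspace V \<and> dim V = k \<longrightarrow> confined V a \<delta> \<Lambda> K"
  shows "\<exists>\<delta>>0. \<exists>M>0. \<forall>V::'a set. subspace V \<and> dim V = k \<longrightarrow> length_bounded V a \<delta> M"
proof -
  obtain C where C: "0 < C" and C2: "\<forall>K\<ge>1. \<exists>\<delta>>0. \<forall>(V::'a set) y n l p q D.
    subspace V \<and> squeezed V a \<sigma> B \<and> chain a \<delta> V y n l p q \<and> p \<le> q \<and>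
    (\<forall>i j. p \<le> i \<and> i < j \<and> j \<le> q \<longrightarrow> sum l {i..<j} \<le> K * norm (y j - y i)) \<and>
    (\<forall>i\<in>{p..q}. norm (y i - y p) \<le> D) \<longrightarrow> sum l {p..<q} \<le> C * D"
    using length_bounded_good[OF a s] by (elim exE conjE) (rule that)
  \<comment> \<open>The term \<open>4 / a\<close> pays for the last step of a minimal bad piece,
    which its good part omits. The choice of \<open>K\<close> makes
    \<open>(\<Lambda> + 1) * C' / K\<close> less than 1.\<close>
  define C' where "C' = C + 4 / a"
  define K where "K = (\<Lambda> + 1) * C' + 1"
  have C': "0 < C'" using C a by (simp add: C'_def add_pos_pos)
  have K: "1 \<le> K" using C' E(1) by (simp add: K_def)
  obtain \<delta>\<^sub>1 where d1: "0 < \<delta>\<^sub>1" and d1': "\<forall>(V::'a set) y n l p q D.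
    subspace V \<and> squeezed V a \<sigma> B \<and> chain a \<delta>\<^sub>1 V y n l p q \<and> p \<le> q \<and>
    (\<forall>i j. p \<le> i \<and> i < j \<and> j \<le> q \<longrightarrow> sum l {i..<j} \<le> K * norm (y j - y i)) \<and>
    (\<forall>i\<in>{p..q}. norm (y i - y p) \<le> D) \<longrightarrow> sum l {p..<q} \<le> C * D"
    using C2[rule_format, OF K] by (elim exE conjE) (rule that)
  have good_sum: "sum l {p..<q} \<le> C * D"
    if "subspace V" "squeezed V a \<sigma> B" "chain a \<delta>\<^sub>1 V y n l p q" "p \<le> q"
      "\<And>i j. p \<le> i \<Longrightarrow> i < j \<Longrightarrow> j \<le> q \<Longrightarrow> sum l {i..<j} \<le> K * norm (y j - y i)"
      "\<And>i. i\<in>{p..q} \<Longrightarrow> norm (y i - y p) \<le> D" for V :: "'a set" and y n l p q D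
    by (rule d1'[rule_format, of V y n l p q D]) (use that in auto)
  obtain \<delta>\<^sub>2 where d2: "0 < \<delta>\<^sub>2" "\<And>V::'a set. subspace V \<Longrightarrow> dim V = k \<Longrightarrow> confined V a \<delta>\<^sub>2 \<Lambda> K"
    using E(2)[of K] K by auto
  define \<delta> where "\<delta> = min (a / 2) (min \<delta>\<^sub>1 (\<delta>\<^sub>2 / K))"
  have d: "0 < \<delta>" using a d1 d2 K by (simp add: \<delta>_def)
  have dle: "\<delta> \<le> a / 2" "\<delta> \<le> \<delta>\<^sub>1" "\<delta> \<le> \<delta>\<^sub>2 / K"
    unfolding \<delta>_def by (meson min.cobounded1 min.cobounded2 order_trans)+
  have dK: "\<delta> * K \<le> \<delta>\<^sub>2" using dle(3) K by (simp add: field_simps)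
  have "\<delta> * 1 \<le> \<delta> * K" using d K by (intro mult_left_mono) auto
  with dK have dle2: "\<delta> \<le> \<delta>\<^sub>2" by simp
  have "length_bounded V a \<delta> C" if V: "subspace V" "dim V = k" for V :: "'a set"
    unfolding length_bounded_def
  proof (intro allI impI, elim conjE)
    fix y n :: "nat \<Rightarrow> 'a" and l p q D
    assume ch: "chain a \<delta> V y n l p q" and pq: "p \<le> q" and D: "\<forall>i\<in>{p..q}. norm (y i - y p) \<le> D"
    define bad where "bad i j \<longleftrightarrow> p \<le> i \<and> i < j \<and> j \<le> q \<and> K * norm (y j - y i) < sum l {i..<j}" for i j
    have "\<not> bad i j" for i j
    proof (induction "j - i" arbitrary: i j rule: less_induct)
      case less
      show ?case
      proof
        assume b: "bad i j"
        then have ij: "p \<le> i" "i < j" "j \<le> q" "K * norm (y j - y i) < sum l {i..<j}" by (auto simp: bad_def)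
        define j' where "j' = j - 1"
        have j': "Suc j' = j" "i \<le> j'" "j' < j" using ij by (auto simp: j'_def)
        define D' where "D' = Max ((\<lambda>t. norm (y t - y i)) ` {i..j})"
        have D': "norm (y t - y i) \<le> D'" if "t \<in> {i..j}" for t
          unfolding D'_def by (rule Max_ge) (use that in auto)
        have "D' \<in> (\<lambda>t. norm (y t - y i)) ` {i..j}"
          unfolding D'_def by (rule Max_in) (use ij in auto)
        then obtain t0 where t0: "t0 \<in> {i..j}" "D' = norm (y t0 - y i)" by auto
        have good: "sum l {i'..<j''} \<le> K * norm (y j'' - y i')" if "i \<le> i'" "i' < j''" "j'' \<le> j'" for i' j''
          using less[of j'' i'] that j' ij by (auto simp: bad_def not_less)
        have s1: "sum l {i..<j'} \<le> C * D'"
          by (rule good_sum[OF V(1) sq[OF V] chain_slack_mono[OF chain_subinterval[OF ch] dle(2)] j'(2) good])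
            (use ij j' D' in auto)
        have "l j' \<le> 4 / a * D'"
        proof -
          have j'q: "p \<le> j'" "j' < q" using ij j' by auto
          have "sum l {j'..<Suc j'} = l j'" by simp
          then have A: "sum l {j'..<j} = l j'" unfolding j'(1) .
          have "n j' \<bullet> (y j - y j') \<le> - a * l j' + \<delta> * l j'"
            using chainD(6)[OF ch j'q(1) lessI] j'q(2) unfolding j'(1) A using ij(3) by blast
          moreover have "\<delta> * l j' \<le> a / 2 * l j'"
            using dle(1) chainD(4)[OF ch j'q] by (intro mult_right_mono)
          ultimately have "n j' \<bullet> (y j - y j') \<le> - (a / 2 * l j')" by (simp add: algebra_simps)
          moreover have "\<bar>n j' \<bullet> (y j - y j')\<bar> \<le> norm (n j') * norm (y j - y j')" by (rule Cauchy_Schwarz_ineq2)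
          moreover have "norm (n j') * norm (y j - y j') \<le> 1 * norm (y j - y j')"
            using chainD(3)[OF ch j'q] by (intro mult_right_mono) auto
          moreover have "norm (y j - y j') \<le> norm (y j - y i) + norm (y j' - y i)"
            using norm_triangle_ineq4[of "y j - y i" "y j' - y i"] by simp
          moreover have "norm (y j - y i) \<le> D'" "norm (y j' - y i) \<le> D'" using D' ij j' by auto
          ultimately have "a / 2 * l j' \<le> 2 * D'" by linarith
          then show ?thesis using a by (simp add: field_simps)
        qed
        moreover have "sum l {i..<Suc j'} = sum l {i..<j'} + l j'" using j'(2) by simp
        then have "sum l {i..<j} = sum l {i..<j'} + l j'" unfolding j'(1) .
        ultimately have s2: "sum l {i..<j} \<le> C' * D'" using s1 by (simp add: C'_def algebra_simps)
        \<comment> \<open>With this radius \<open>K * \<rho>\<close> is the length bound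
          \<open>C' * D'\<close>, as \<open>confined\<close> demands, and badness makes the chord at
          most \<open>\<rho>\<close>. The last point \<open>y j\<close> takes the role of
          \<open>c\<close>.\<close>
        define \<rho> where "\<rho> = C' / K * D'"
        have Kr: "K * \<rho> = C' * D'" using K by (simp add: \<rho>_def)
        have D'0: "0 < D'"
        proof (rule ccontr)
          assume "\<not> 0 < D'"
          then have "C' * D' \<le> 0" using C' by (simp add: mult_le_0_iff)
          moreover have "0 \<le> K * norm (y j - y i)" using K by simp
          ultimately show False using ij(4) s2 by linarith
        qed
        have rho: "0 < \<rho>" using D'0 C' K by (simp add: \<rho>_def)
        have "K * norm (y j - y i) < K * \<rho>" using ij(4) s2 Kr by linarith
        then have chord: "norm (y i - y j) \<le> \<rho>" using K by (simp add: norm_minus_commute)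
        have virt: "n t \<bullet> (y j - y t) \<le> - a * l t + \<delta>\<^sub>2 * \<rho>" if "t \<in> {i..<j}" for t
        proof -
          have "sum l {t..<j} \<le> sum l {i..<j}"
            using chain_sum_mono[OF ch, of i j t j] that ij by auto
          then have "\<delta> * sum l {t..<j} \<le> \<delta> * (K * \<rho>)" using s2 Kr d by (intro mult_left_mono) auto
          also have "\<dots> \<le> \<delta>\<^sub>2 * \<rho>" using mult_right_mono[OF dK less_imp_le[OF rho]] by (simp add: mult.assoc)
          finally show ?thesis using chainD(6)[OF ch, of t j] that ij by auto
        qed
        have "chain a \<delta>\<^sub>2 V y n l i j"
          by (rule chain_slack_mono[OF chain_subinterval[OF ch] dle2]) (use ij in auto)
        then have conf: "norm (y t - y j) \<le> \<Lambda> * \<rho>" if "t \<in> {i..j}" for t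
          using d2(2)[OF V, unfolded confined_def, rule_format, of y n l i j "y j" \<rho> t]
            chainD(1)[OF ch, of j] ij rho chord s2 Kr virt that by auto
        have "D' \<le> norm (y t0 - y j) + norm (y i - y j)"
          unfolding t0(2) using norm_triangle_ineq4[of "y t0 - y j" "y i - y j"] by simp
        also have "\<dots> \<le> (\<Lambda> + 1) * \<rho>" using conf[OF t0(1)] chord by (simp add: algebra_simps)
        finally have "K * D' \<le> K * ((\<Lambda> + 1) * \<rho>)" using K by (intro mult_left_mono) auto
        also have "\<dots> = (\<Lambda> + 1) * (K * \<rho>)" by simp
        also have "\<dots> = (K - 1) * D'" unfolding Kr by (simp add: K_def)
        finally show False using D'0 by (simp add: algebra_simps)
      qed
    qed
    then have good: "sum l {i..<j} \<le> K * norm (y j - y i)" if "p \<le> i" "i < j" "j \<le> q" for i j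
      unfolding bad_def using that not_less by blast
    show "sum l {p..<q} \<le> C * D"
      by (rule good_sum[OF V(1) sq[OF V] chain_slack_mono[OF ch dle(2)] pq good]) (use D in auto)
  qed
  then show ?thesis using d C by blast
qed

section \<open>Induction on the dimension\<close>

text \<open>The two statements need each other: in dimension \<open>k\<close> they give
  \<open>squeezed\<close> in dimension \<open>Suc k\<close>, whence confinement and then the length
  bound. Working with subspaces of one type lets a projection change the dimension but not the type.
  In dimension 0 all points coincide, and slack \<open>a / 2\<close> forces every \<open>l i\<close>
  to vanish.\<close>

lemma chain_length_bounded:
  fixes a :: real
  assumes a: "0 < a"
  shows "(\<exists>\<delta>>0. \<exists>M>0. \<forall>V::'a::euclidean_space set. subspace V \<and> dim V = k \<longrightarrow> length_bounded V a \<delta> M) \<and>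
    (\<exists>\<Lambda>\<ge>1. \<forall>K>0. \<exists>\<delta>>0. \<forall>V::'a set. subspace V \<and> dim V = k \<longrightarrow> confined V a \<delta> \<Lambda> K)"
proof (induction k)
  case 0
  have y0: "y i = 0" if "chain a \<delta> V y n l p q" "dim V = 0" "p \<le> i" "i \<le> q"
    for V :: "'a set" and \<delta> y n l p q i
    using chainD(1)[OF that(1,3,4)] that(2) by (auto simp: dim_eq_0)
  have "length_bounded V a (a / 2) 1" if V: "dim V = 0" for V :: "'a set"
    unfolding length_bounded_def
  proof (intro allI impI, elim conjE)
    fix y n :: "nat \<Rightarrow> 'a" and l p q D
    assume ch: "chain a (a / 2) V y n l p q" and pq: "p \<le> q" and D: "\<forall>i\<in>{p..q}. norm (y i - y p) \<le> D"
    have "l i \<le> 0" if "i \<in> {p..<q}" for i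
    proof -
      have "n i \<bullet> (y (Suc i) - y i) \<le> - a * l i + a / 2 * sum l {i..<Suc i}"
        by (rule chainD(6)[OF ch]) (use that in auto)
      then have "a * l i \<le> 0" using y0[OF ch V, of i] y0[OF ch V, of "Suc i"] that by simp
      then show ?thesis using a by (simp add: mult_le_0_iff)
    qed
    then have "sum l {p..<q} \<le> 0" by (rule sum_nonpos)
    moreover have "norm (y p - y p) \<le> D" using D pq by (intro bspec[OF D]) auto
    then have "0 \<le> D" by simp
    ultimately show "sum l {p..<q} \<le> 1 * D" by simp
  qed
  then have "\<exists>\<delta>>0. \<exists>M>0. \<forall>V::'a set. subspace V \<and> dim V = 0 \<longrightarrow> length_bounded V a \<delta> M"
    using a half_gt_zero[OF a] zero_less_one by blast
  moreover have "confined V a 1 1 K" if V: "dim V = 0" for V :: "'a set" and K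
    unfolding confined_def
  proof (intro allI impI ballI, elim conjE)
    fix y n :: "nat \<Rightarrow> 'a" and l p q c \<rho> i
    assume "chain a 1 V y n l p q" "c \<in> V" "0 < (\<rho>::real)" "i \<in> {p..q}"
    then show "norm (y i - c) \<le> 1 * \<rho>" using y0[of 1 V y n l p q i] V by (auto simp: dim_eq_0)
  qed
  then have "\<exists>\<Lambda>\<ge>1. \<forall>K>0. \<exists>\<delta>>0. \<forall>V::'a set. subspace V \<and> dim V = 0 \<longrightarrow> confined V a \<delta> \<Lambda> K"
    using zero_less_one order_refl by blast
  ultimately show ?case by (rule conjI)
next
  case (Suc k)
  obtain \<delta>\<^sub>0 M where T: "0 < \<delta>\<^sub>0" "0 < M" "\<And>V::'a set. subspace V \<Longrightarrow> dim V = k \<Longrightarrow> length_bounded V a \<delta>\<^sub>0 M"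
    using Suc by blast
  obtain \<Lambda> where L: "1 \<le> \<Lambda>" "\<And>K. 0 < K \<Longrightarrow> \<exists>\<delta>>0. \<forall>V::'a set. subspace V \<and> dim V = k \<longrightarrow> confined V a \<delta> \<Lambda> K"
    using Suc by blast
  obtain \<sigma> B where sq: "0 < \<sigma>" "1 < B" "\<And>V::'a set. subspace V \<Longrightarrow> dim V = Suc k \<Longrightarrow> squeezed V a \<sigma> B"
    using squeezed_step[OF a T L] by blast
  have E: "\<exists>\<Lambda>\<ge>1. \<forall>K>0. \<exists>\<delta>>0. \<forall>V::'a set. subspace V \<and> dim V = Suc k \<longrightarrow> confined V a \<delta> \<Lambda> K"
    by (rule confined_step[OF a sq])
  then obtain \<Lambda>' where L': "1 \<le> \<Lambda>'"
    "\<And>K. 0 < K \<Longrightarrow> \<exists>\<delta>>0. \<forall>V::'a set. subspace V \<and> dim V = Suc k \<longrightarrow> confined V a \<delta> \<Lambda>' K" by blast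
  show ?case using length_bounded_step[OF a sq L'] E by blast
qed

section \<open>Descent with relative errors on a convex function\<close>

text \<open>A path without slack is a chain for every positive slack, in particular for the one that
  the length bound tolerates; so its partial sums are bounded.\<close>

lemma exact_chain_summable:
  fixes y n :: "nat \<Rightarrow> 'a::euclidean_space" and l :: "nat \<Rightarrow> real"
  assumes a: "0 < a" and "\<And>i. norm (n i) \<le> 1" "\<And>i. 0 \<le> l i" "\<And>i. norm (y (Suc i) - y i) \<le> l i"
    "\<And>i j. i < j \<Longrightarrow> n i \<bullet> (y j - y i) \<le> - a * l i" and b: "\<And>i. norm (y i) \<le> b"
  shows "summable l"
proof -
  obtain \<delta> M where d: "0 < \<delta>" "0 < M"
    "\<And>V::'a set. subspace V \<Longrightarrow> dim V = DIM('a) \<Longrightarrow> length_bounded V a \<delta> M"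
    using chain_length_bounded[OF a, of "DIM('a)", where 'a = 'a] by blast
  have "sum l {..<q} \<le> M * (2 * b)" for q
  proof -
    have "chain a 0 UNIV y n l 0 q" using assms by (auto simp: chain_def)
    then have "chain a \<delta> UNIV y n l 0 q" by (rule chain_slack_mono) (use d in auto)
    moreover have "norm (y i - y 0) \<le> 2 * b" for i
      using norm_triangle_ineq4[of "y i" "y 0"] b[of i] b[of 0] by linarith
    ultimately show ?thesis
      using d(3)[of UNIV, unfolded length_bounded_def, rule_format, of y n l 0 q "2 * b"]
      by (auto simp: atLeast0LessThan)
  qed
  then show ?thesis by (rule summableI_nonneg_bounded[OF assms(3)])
qed

text \<open>The times at which \<^term>\<open>r\<close> first drops below half of its value at the previous such time
  cut the sequence into blocks. Since no step of a block is shorter than half its first one, the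
  energy spent on a block bounds its length from below on the half space that the convexity
  inequality at its first point cuts off. The error \<^term>\<open>C * (r k)\<^sup>2\<close> is harmless for long blocks,
  and the short blocks following a long one can be charged to it.\<close>

theorem relative_error_descent_summable:
  fixes z g :: "nat \<Rightarrow> 'a::euclidean_space" and r L :: "nat \<Rightarrow> real"
  assumes a: "0 < a" and C: "0 < C"
    and r: "\<And>k. 0 \<le> r k" "\<And>k. norm (z (Suc k) - z k) \<le> r k"
    and descent: "\<And>k. L (Suc k) + a * (r k)\<^sup>2 \<le> L k"
    and grad: "\<And>k. norm (g k) \<le> C * r k"
    and conv: "\<And>k s. k < s \<Longrightarrow> L (Suc k) + g k \<bullet> (z s - z (Suc k)) - C * (r k)\<^sup>2 \<le> L s"
    and b: "\<And>k. norm (z k) \<le> b"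
  shows "summable r"
\<comment> \<open>The blocks need \<open>r\<close> positive. If \<open>r k = 0\<close>, then
  \<open>g k = 0\<close> and \<open>conv\<close> keeps \<open>L\<close> from falling below
  \<open>L (Suc k)\<close>, so by \<open>descent\<close> all later \<open>r i\<close>
  vanish.\<close>
proof (cases "\<exists>k. r k = 0")
  case True
  have dec: "decseq L"
  proof (rule decseq_SucI)
    show "L (Suc n) \<le> L n" for n
      using descent[of n] mult_nonneg_nonneg[OF less_imp_le[OF a] zero_le_power2[of "r n"]] by linarith
  qed
  from True obtain k where k: "r k = 0" by blast
  then have gk: "g k = 0" using grad[of k] by simp
  have "r i = 0" if "k < i" for i
  proof -
    have "L (Suc k) \<le> L (Suc i)" using conv[of k "Suc i"] k gk that by simp
    moreover have "L i \<le> L (Suc k)" using decseqD[OF dec, of "Suc k" i] that by simp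
    ultimately have "a * (r i)\<^sup>2 \<le> 0" using descent[of i] by linarith
    then show ?thesis using a by (simp add: mult_le_0_iff)
  qed
  then show ?thesis by (intro summable_finite[of "{..k}"]) auto
next
  case False
  then have rpos: "0 < r k" for k using r(1)[of k] by (metis less_eq_real_def)
  have energy: "L s + a * (\<Sum>i\<in>{k..<s}. (r i)\<^sup>2) \<le> L k" if "k \<le> s" for k s
    using that
  proof (induction s rule: dec_induct)
    case (step s)
    then show ?case using descent[of s] by (simp add: distrib_left)
  qed simp
  have "summable (\<lambda>k. (r k)\<^sup>2)"
  proof (rule summableI_nonneg_bounded)
    fix s
    \<comment> \<open>The lower bound on \<open>L\<close> comes from \<open>conv\<close> at time 0
      and the boundedness of \<open>z\<close>; \<open>L 0\<close> covers the index 0, about which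
      \<open>conv\<close> says nothing.\<close>
    define lb where "lb = min (L 0) (L 1 - C * r 0 * (2 * b) - C * (r 0)\<^sup>2)"
    have "lb \<le> L s"
    proof (cases "s = 0")
      case False
      have "\<bar>g 0 \<bullet> (z s - z 1)\<bar> \<le> norm (g 0) * norm (z s - z 1)" by (rule Cauchy_Schwarz_ineq2)
      also have "\<dots> \<le> C * r 0 * (2 * b)"
        using grad[of 0] norm_triangle_ineq4[of "z s" "z 1"] b[of s] b[of 1] C r(1)[of 0]
        by (intro mult_mono) auto
      finally show ?thesis using conv[of 0 s] False by (simp add: lb_def)
    qed (simp add: lb_def)
    then have "a * (\<Sum>i<s. (r i)\<^sup>2) \<le> L 0 - lb" using energy[of 0 s] by (simp add: atLeast0LessThan)
    then show "(\<Sum>i<s. (r i)\<^sup>2) \<le> (L 0 - lb) / a" using a by (simp add: field_simps)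
  qed simp
  then have "(\<lambda>k. (r k)\<^sup>2) \<longlonglongrightarrow> 0" by (rule summable_LIMSEQ_zero)
  then have "(\<lambda>k. sqrt ((r k)\<^sup>2)) \<longlonglongrightarrow> sqrt 0" by (rule tendsto_real_sqrt)
  then have r_lim: "r \<longlonglongrightarrow> 0" using r(1) by simp
  define nx where "nx k = (LEAST e. k < e \<and> r e < r k / 2)" for k
  have nx: "k < nx k \<and> r (nx k) < r k / 2" for k
  proof -
    have "eventually (\<lambda>e. r e < r k / 2) sequentially"
      by (rule order_tendstoD(2)[OF r_lim]) (use rpos[of k] in simp)
    moreover have "eventually (\<lambda>e. k < e) sequentially" by (rule eventually_gt_at_top)
    ultimately have "eventually (\<lambda>e. k < e \<and> r e < r k / 2) sequentially" by (rule eventually_conj[rotated])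
    then have "\<exists>e. k < e \<and> r e < r k / 2" using eventually_happens trivial_limit_sequentially by blast
    then show ?thesis unfolding nx_def by (rule LeastI_ex)
  qed
  have nx_before: "r k / 2 \<le> r i" if "k \<le> i" "i < nx k" for i k
  proof (cases "i = k")
    case False
    then show ?thesis using not_less_Least[of i "\<lambda>e. k < e \<and> r e < r k / 2"] that by (auto simp: nx_def)
  qed (use rpos[of k] in simp)
  define t where "t j = (nx ^^ j) 0" for j
  have tS: "t (Suc j) = nx (t j)" for j by (simp add: t_def)
  have t: "strict_mono t" by (rule strict_monoI_Suc) (use nx tS in simp)
  define R where "R j = r (t j)" for j
  define l where "l j = sum r {t j..<t (Suc j)}" for j
  have R: "0 < R j" "R (Suc j) \<le> R j / 2" for j
    using rpos nx[of "t j"] by (auto simp: R_def tS less_imp_le)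
  have l0: "0 \<le> l j" for j unfolding l_def by (rule sum_nonneg) (rule r(1))
  have Rsum: "sum R {j..<m} \<le> 2 * R j" if "j \<le> m" for j m
    using that
  proof (induction j rule: inc_induct)
    case (step j)
    then show ?case using R(2)[of j] by (simp add: sum.atLeast_Suc_lessThan)
  qed (use R in \<open>auto simp: less_imp_le\<close>)
  have sumR: "summable R"
  proof (rule summableI_nonneg_bounded)
    show "sum R {..<m} \<le> 2 * R 0" for m using Rsum[of 0 m] by (simp add: atLeast0LessThan)
  qed (use R in \<open>auto simp: less_imp_le\<close>)
  have l_sum: "sum l {i..<j} = sum r {t i..<t j}" if "i \<le> j" for i j
    using that
  proof (induction j rule: dec_induct)
    case (step j)
    have "t i \<le> t j" "t j \<le> t (Suc j)" using step t by (auto simp: strict_mono_less_eq)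
    then show ?case using step by (simp add: l_def sum.atLeastLessThan_concat)
  qed simp
  have z_dist: "norm (z j - z i) \<le> sum r {i..<j}" if "i \<le> j" for i j
    using that
  proof (induction j rule: dec_induct)
    case (step k)
    have "norm (z (Suc k) - z i) \<le> norm (z (Suc k) - z k) + norm (z k - z i)"
      using norm_triangle_ineq[of "z (Suc k) - z k" "z k - z i"] by simp
    then show ?case using step r(2)[of k] by simp
  qed simp
  \<comment> \<open>The error collects the energy \<open>a * (r k)\<^sup>2\<close> of the first
    step, since \<open>conv\<close> starts only at \<open>Suc k\<close>, and two terms with
    \<open>C\<close>: one from \<open>conv\<close>, one from moving the base point from
    \<open>z (Suc k)\<close> to \<open>z k\<close>.\<close>
  have key: "g (t j) \<bullet> (z (t m) - z (t j)) \<le> - (a / 2) * R j * l j + (a + 2 * C) * (R j)\<^sup>2" if "j < m" for j m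
  proof -
    define k s where "k = t j" and "s = t m"
    have ks: "k < s" "t (Suc j) \<le> s" "k < t (Suc j)"
      using that t by (auto simp: k_def s_def strict_mono_less strict_mono_less_eq)
    have Rk: "R j = r k" by (simp add: R_def k_def)
    have "R j / 2 * l j = (\<Sum>i\<in>{k..<t (Suc j)}. R j / 2 * r i)"
      by (simp add: l_def k_def sum_distrib_left)
    also have "\<dots> \<le> (\<Sum>i\<in>{k..<t (Suc j)}. (r i)\<^sup>2)"
      unfolding power2_eq_square
      using nx_before[of k] by (intro sum_mono mult_right_mono r(1)) (auto simp: Rk tS k_def)
    also have "\<dots> \<le> (\<Sum>i\<in>{k..<s}. (r i)\<^sup>2)" using ks by (intro sum_mono2) auto
    also have "\<dots> = (r k)\<^sup>2 + (\<Sum>i\<in>{Suc k..<s}. (r i)\<^sup>2)" using ks by (simp add: sum.atLeast_Suc_lessThan)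
    finally have "a * (R j / 2 * l j) \<le> a * ((r k)\<^sup>2 + (\<Sum>i\<in>{Suc k..<s}. (r i)\<^sup>2))"
      using a by (intro mult_left_mono) auto
    moreover have "L s + a * (\<Sum>i\<in>{Suc k..<s}. (r i)\<^sup>2) \<le> L (Suc k)" using ks by (intro energy) auto
    moreover have "L (Suc k) + g k \<bullet> (z s - z (Suc k)) - C * (r k)\<^sup>2 \<le> L s" using ks by (intro conv)
    moreover have "g k \<bullet> (z (Suc k) - z k) \<le> C * (r k)\<^sup>2"
    proof -
      have "g k \<bullet> (z (Suc k) - z k) \<le> norm (g k) * norm (z (Suc k) - z k)" by (rule norm_cauchy_schwarz)
      also have "\<dots> \<le> C * r k * r k" using grad[of k] r C by (intro mult_mono) auto
      finally show ?thesis by (simp add: power2_eq_square mult.assoc)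
    qed
    moreover have "g k \<bullet> (z s - z k) = g k \<bullet> (z s - z (Suc k)) + g k \<bullet> (z (Suc k) - z k)"
      by (simp add: inner_diff_right)
    ultimately show ?thesis unfolding k_def[symmetric] s_def[symmetric] Rk
      by (simp add: algebra_simps)
  qed
  \<comment> \<open>Chosen so that on the blocks in \<open>G\<close> the error consumes at most half
    of the gain.\<close>
  define B where "B = 4 * (a + 2 * C) / a"
  have B: "1 \<le> B" "0 < B" using a C by (auto simp: B_def field_simps)
  define G where "G = {j. B * R j \<le> l j}"
  have short: "l j \<le> B * R j" if "j \<notin> G" for j using that by (simp add: G_def)
  have "summable (\<lambda>j. if j \<in> G then l j else 0)"
  proof (cases "finite G")
    case True
    then show ?thesis by (intro summable_finite[of G]) auto
  next
    case False
    define e where "e = enumerate G"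
    have e: "strict_mono e" "range e = G" "e i \<in> G" for i
      using False by (auto simp: e_def strict_mono_enumerate range_enumerate enumerate_in_set)
    \<comment> \<open>Scaled to norm at most 1 by \<open>grad\<close>. The short blocks before the
      next long one add at most \<open>l (e i)\<close>, so the step is given weight
      \<open>2 * l (e i)\<close> and the chain constant becomes \<open>a / (8 * C)\<close>.\<close>
    define n where "n i = (1 / (C * R (e i))) *\<^sub>R g (t (e i))" for i
    have "summable (\<lambda>i. 2 * l (e i))"
    proof (rule exact_chain_summable[where y = "\<lambda>i. z (t (e i))" and n = n and a = "a / (8 * C)" and b = b])
      show "0 < a / (8 * C)" using a C by simp
      show "norm (n i) \<le> 1" for i
        using grad[of "t (e i)"] C R(1)[of "e i"] by (simp add: n_def R_def field_simps)
      show "0 \<le> 2 * l (e i)" for i using l0 by simp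
      show "norm (z (t (e (Suc i))) - z (t (e i))) \<le> 2 * l (e i)" for i
      proof -
        have ei: "e i < e (Suc i)" using e(1) by (simp add: strict_mono_less)
        have gap: "j \<notin> G" if "e i < j" "j < e (Suc i)" for j
          using not_less_Least[of j "\<lambda>s. s \<in> G \<and> e i < s"] that enumerate_Suc''[OF False, of i]
          by (auto simp: e_def)
        have "norm (z (t (e (Suc i))) - z (t (e i))) \<le> sum r {t (e i)..<t (e (Suc i))}"
          using ei t by (intro z_dist) (auto simp: strict_mono_less_eq)
        also have "\<dots> = sum l {e i..<e (Suc i)}" using ei by (intro l_sum[symmetric]) auto
        also have "\<dots> = l (e i) + sum l {Suc (e i)..<e (Suc i)}" using ei by (rule sum.atLeast_Suc_lessThan)
        also have "sum l {Suc (e i)..<e (Suc i)} \<le> (\<Sum>j\<in>{Suc (e i)..<e (Suc i)}. B * R j)"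
          using short gap by (intro sum_mono) auto
        also have "\<dots> = B * sum R {Suc (e i)..<e (Suc i)}" by (simp add: sum_distrib_left)
        also have "\<dots> \<le> B * R (e i)"
          using Rsum[of "Suc (e i)" "e (Suc i)"] R(2)[of "e i"] ei B by (intro mult_left_mono) auto
        also have "\<dots> \<le> l (e i)" using e(3)[of i] by (simp add: G_def)
        finally show ?thesis by simp
      qed
      show "n i \<bullet> (z (t (e j)) - z (t (e i))) \<le> - (a / (8 * C)) * (2 * l (e i))" if "i < j" for i j
      proof -
        define p where "p = e i"
        have 1: "g (t p) \<bullet> (z (t (e j)) - z (t p)) \<le> - (a / 2) * R p * l p + (a + 2 * C) * (R p)\<^sup>2"
          unfolding p_def using that e(1) by (intro key) (simp add: strict_mono_less)
        have "(a + 2 * C) * R p = a / 4 * (B * R p)" using a by (simp add: B_def field_simps)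
        also have "\<dots> \<le> a / 4 * l p" using e(3)[of i] a by (intro mult_left_mono) (auto simp: G_def p_def)
        finally have "(a + 2 * C) * R p * R p \<le> a / 4 * l p * R p"
          using R(1)[of p] by (intro mult_right_mono) auto
        with 1 have "g (t p) \<bullet> (z (t (e j)) - z (t p)) \<le> - (a / 4) * l p * R p"
          by (simp add: power2_eq_square algebra_simps)
        then have "(1 / (C * R p)) * (g (t p) \<bullet> (z (t (e j)) - z (t p))) \<le> (1 / (C * R p)) * (- (a / 4) * l p * R p)"
          using C R(1)[of p] by (intro mult_left_mono) auto
        also have "\<dots> = - (a / (8 * C)) * (2 * l p)"
        proof -
          have "C \<noteq> 0" "R p \<noteq> 0" using C R(1)[of p] by auto
          then show ?thesis by (simp add: divide_simps)
        qed
        finally show ?thesis unfolding n_def p_def[symmetric] inner_scaleR_left .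
      qed
    qed (rule b)
    then have "summable (\<lambda>i. l (e i))" by (simp add: summable_cmult_iff)
    moreover define f where "f j = (if j \<in> G then l j else 0)" for j
    ultimately have "summable (\<lambda>i. f (e i))" using e(3) by simp
    moreover have "f j = 0" if "j \<notin> range e" for j using that e(2) by (simp add: f_def)
    ultimately have "summable f" using summable_mono_reindex[OF e(1), of f] by blast
    then show ?thesis by (simp add: f_def[abs_def])
  qed
  then have "summable (\<lambda>j. (if j \<in> G then l j else 0) + B * R j)"
    by (intro summable_add summable_mult sumR)
  then have "summable l"
    by (rule summable_comparison_test'[where N = 0])
      (use l0 short B R in \<open>auto simp: less_imp_le\<close>)
  show ?thesis
  proof (rule summableI_nonneg_bounded[OF r(1)])
    fix n
    have "n \<le> t n" using t by (rule strict_mono_imp_increasing)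
    then have "sum r {..<n} \<le> sum r {..<t n}" using r(1) by (intro sum_mono2) auto
    also have "\<dots> = sum l {..<n}" using l_sum[of 0 n] by (simp add: t_def atLeast0LessThan)
    also have "\<dots> \<le> suminf l" by (rule sum_le_suminf[OF \<open>summable l\<close>]) (use l0 in auto)
    finally show "sum r {..<n} \<le> suminf l" .
  qed
qed

section \<open>Convex analysis\<close>

lemma subdiff_finite:
  assumes "proper_fun f" "v \<in> subdiff f x"
  obtains a where "f x = ereal a"
proof -
  obtain y where "f y \<noteq> \<infinity>" using assms(1) by (auto simp: proper_fun_def)
  moreover have "f x + ereal (v \<bullet> (y - x)) \<le> f y" using assms(2) by (auto simp: subdiff_def)
  ultimately have "f x \<noteq> \<infinity>" by auto
  moreover have "f x \<noteq> - \<infinity>" using assms(1) by (auto simp: proper_fun_def)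
  ultimately show ?thesis using that by (cases "f x") auto
qed

lemma subdiffD: "v \<in> subdiff f x \<Longrightarrow> f x + ereal (v \<bullet> (y - x)) \<le> f y"
  by (simp add: subdiff_def)

text \<open>Strong convexity on the segment and the subgradient inequality at its point with
  parameter \<open>t\<close> are combined and divided by \<open>t\<close>; then \<open>t\<close>
  tends to 0.\<close>

lemma subdiff_strongly_convex:
  fixes f :: "'a::real_inner \<Rightarrow> ereal"
  assumes f: "strongly_convex_fun \<mu> f" and v: "v \<in> subdiff f x"
    and fx: "f x = ereal a" "f y = ereal c"
  shows "a + v \<bullet> (y - x) + \<mu> / 2 * (norm (y - x))\<^sup>2 \<le> c"
proof -
  have *: "a + v \<bullet> (y - x) + \<mu> / 2 * (1 - t) * (norm (x - y))\<^sup>2 \<le> c" if t: "0 < t" "t < 1" for t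
  proof -
    define w where "w = (1 - t) *\<^sub>R x + t *\<^sub>R y"
    have 1: "f w + ereal (\<mu> / 2 * t * (1 - t) * (norm (x - y))\<^sup>2) \<le> ereal (1 - t) * f x + ereal t * f y"
      using f t unfolding strongly_convex_fun_def w_def by blast
    have wx: "w - x = t *\<^sub>R (y - x)" by (simp add: w_def algebra_simps)
    have 2: "f x + ereal (t * (v \<bullet> (y - x))) \<le> f w"
      using subdiffD[OF v, of w] by (simp add: wx)
    have "t * (a + v \<bullet> (y - x) + \<mu> / 2 * (1 - t) * (norm (x - y))\<^sup>2) \<le> t * c"
      using 1 2 by (cases "f w") (auto simp: fx algebra_simps)
    then show ?thesis using t by simp
  qed
  have "((\<lambda>t. a + v \<bullet> (y - x) + \<mu> / 2 * (1 - t) * (norm (x - y))\<^sup>2) \<longlongrightarrow>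
      a + v \<bullet> (y - x) + \<mu> / 2 * (1 - 0) * (norm (x - y))\<^sup>2) (at_right 0)"
    by (intro tendsto_intros)
  moreover have "eventually (\<lambda>t. a + v \<bullet> (y - x) + \<mu> / 2 * (1 - t) * (norm (x - y))\<^sup>2 \<le> c) (at_right (0::real))"
    unfolding eventually_at_right_field using * by (intro exI[of _ 1]) auto
  ultimately show ?thesis
    using tendsto_upperbound[of _ _ "at_right (0::real)" c] by (simp add: norm_minus_commute)
qed

text \<open>For fixed \<open>y\<close> with finite value, the subgradient inequality says that a
  point depending continuously on \<open>x k\<close> and \<open>v k\<close> lies in the closed
  epigraph.\<close>

lemma subdiff_closed:
  fixes f :: "'a::real_inner \<Rightarrow> ereal"
  assumes f: "proper_fun f" "closed_fun f"
    and lim: "x \<longlonglongrightarrow> x'" "v \<longlonglongrightarrow> v'" and v: "\<And>k. v k \<in> subdiff f (x k)"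
  shows "v' \<in> subdiff f x'"
  unfolding subdiff_def
proof (intro CollectI allI)
  fix y
  show "f x' + ereal (v' \<bullet> (y - x')) \<le> f y"
  proof (cases "f y")
    case (real c)
    have "f (x k) \<le> ereal (c - v k \<bullet> (y - x k))" for k
    proof -
      have "f (x k) + ereal (v k \<bullet> (y - x k)) \<le> ereal c" using subdiffD[OF v[of k], of y] real by simp
      then show ?thesis by (cases "f (x k)") auto
    qed
    then have "(x k, c - v k \<bullet> (y - x k)) \<in> {(x, r::real). f x \<le> ereal r}" for k by simp
    moreover have "(\<lambda>k. (x k, c - v k \<bullet> (y - x k))) \<longlonglongrightarrow> (x', c - v' \<bullet> (y - x'))"
      by (intro tendsto_intros lim)
    ultimately have "(x', c - v' \<bullet> (y - x')) \<in> {(x, r::real). f x \<le> ereal r}"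
      using f(2) unfolding closed_fun_def by (rule closed_sequentially[rotated])
    then show ?thesis using real by (cases "f x'") auto
  next
    case MInf
    then show ?thesis using f(1) by (simp add: proper_fun_def)
  qed simp
qed

lemma closed_fun_bounded_below:
  fixes f :: "'a::metric_space \<Rightarrow> ereal"
  assumes f: "proper_fun f" "closed_fun f" and S: "compact S"
  shows "\<exists>m. \<forall>y\<in>S. ereal m \<le> f y"
proof (rule ccontr)
  assume "\<nexists>m. \<forall>y\<in>S. ereal m \<le> f y"
  then have "\<forall>n::nat. \<exists>y. y \<in> S \<and> f y < ereal (- real n)" by (meson not_le)
  then obtain y where y: "\<And>n. y n \<in> S" "\<And>n. f (y n) < ereal (- real n)" by metis
  obtain x r where x: "strict_mono r" "(y \<circ> r) \<longlonglongrightarrow> x"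
    using S y(1) unfolding compact_def by metis
  have le: "f x \<le> ereal (- real N)" for N
  proof -
    have "(y (r (n + N)), - real N) \<in> {(x, r::real). f x \<le> ereal r}" for n
    proof -
      have "N \<le> r (n + N)" using strict_mono_imp_increasing[OF x(1), of "n + N"] by simp
      then have "ereal (- real (r (n + N))) \<le> ereal (- real N)" by simp
      then show ?thesis using y(2)[of "r (n + N)"] by (auto intro: order_trans less_imp_le)
    qed
    moreover have "(\<lambda>n. (y (r (n + N)), - real N)) \<longlonglongrightarrow> (x, - real N)"
      using LIMSEQ_ignore_initial_segment[OF x(2), of N] by (intro tendsto_intros) (simp add: o_def)
    ultimately have "(x, - real N) \<in> {(x, r::real). f x \<le> ereal r}"
      using f(2) unfolding closed_fun_def by (rule closed_sequentially[rotated])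
    then show ?thesis by simp
  qed
  have "f x \<noteq> \<infinity>" using le[of 0] by auto
  then obtain a where a: "f x = ereal a" using f(1) by (cases "f x") (auto simp: proper_fun_def)
  obtain N where "- a < real N" using reals_Archimedean2 by blast
  then show False using le[of N] a by simp
qed

text \<open>Growth along rays from \<open>x0\<close> bounds the relevant sublevel set. The minimum
  is taken over a compact piece of the epigraph, where the objective is continuous although
  \<open>f\<close> itself need not be.\<close>

lemma strongly_convex_attains_min:
  fixes f :: "'a::euclidean_space \<Rightarrow> ereal"
  assumes f: "proper_fun f" "closed_fun f" "strongly_convex_fun \<mu> f" "0 < \<mu>"
    and q: "continuous_on UNIV q" "\<And>y. 0 \<le> q y"
  shows "\<exists>x. \<forall>y. f x + ereal (q x) \<le> f y + ereal (q y)"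
proof -
  obtain x0 a where x0: "f x0 = ereal a" using f(1) unfolding proper_fun_def by (metis ereal_cases)
  obtain m where m: "\<And>y. y \<in> cball x0 1 \<Longrightarrow> ereal m \<le> f y"
    using closed_fun_bounded_below[OF f(1,2) compact_cball] by blast
  define c where "c = a + q x0"
  \<comment> \<open>For \<open>d = norm (y - x0) > 1\<close>, comparison with the point at distance
    1 from \<open>x0\<close> towards \<open>y\<close>, where \<open>f\<close> is at least
    \<open>m\<close>, yields \<open>\<mu> / 2 * (d - 1) \<le> \<bar>m\<bar> + \<bar>a\<bar> +
    \<bar>c\<bar>\<close>.\<close>
  define \<rho> where "\<rho> = max 1 (1 + 2 / \<mu> * (\<bar>m\<bar> + \<bar>a\<bar> + \<bar>c\<bar>))"
  have growth: "norm (y - x0) \<le> \<rho>" if "f y \<le> ereal c" for y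
  proof (rule ccontr)
    define d where "d = norm (y - x0)"
    assume "\<not> norm (y - x0) \<le> \<rho>"
    then have d: "1 < d" "1 + 2 / \<mu> * (\<bar>m\<bar> + \<bar>a\<bar> + \<bar>c\<bar>) < d" by (auto simp: \<rho>_def d_def)
    define t where "t = 1 / d"
    have t: "0 < t" "t < 1" "t * d = 1" using d by (auto simp: t_def)
    define w where "w = (1 - t) *\<^sub>R x0 + t *\<^sub>R y"
    have "w - x0 = t *\<^sub>R (y - x0)" by (simp add: w_def algebra_simps)
    then have "norm (w - x0) = 1" using t by (simp add: d_def)
    then have mw: "ereal m \<le> f w" by (intro m) (simp add: dist_norm norm_minus_commute)
    have 1: "f w + ereal (\<mu> / 2 * t * (1 - t) * d\<^sup>2) \<le> ereal (1 - t) * f x0 + ereal t * f y"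
      using f(3) t unfolding strongly_convex_fun_def w_def d_def norm_minus_commute[of y x0] by blast
    have "ereal (m + \<mu> / 2 * t * (1 - t) * d\<^sup>2) \<le> ereal (1 - t) * f x0 + ereal t * f y"
      using order_trans[OF add_right_mono[OF mw] 1] by simp
    also have "\<dots> \<le> ereal (1 - t) * f x0 + ereal t * ereal c"
      using that t by (intro add_left_mono ereal_mult_left_mono) auto
    also have "\<dots> = ereal ((1 - t) * a + t * c)" by (simp add: x0)
    finally have 2: "m + \<mu> / 2 * t * (1 - t) * d\<^sup>2 \<le> (1 - t) * a + t * c" by simp
    have "t * (1 - t) * d\<^sup>2 = (t * d) * (d - t * d)" by (simp add: power2_eq_square algebra_simps)
    then have 3: "t * (1 - t) * d\<^sup>2 = d - 1" using t by simp
    have "(1 - t) * a \<le> 1 * \<bar>a\<bar>" "t * c \<le> 1 * \<bar>c\<bar>" 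
      by (rule order_trans[OF mult_left_mono[OF abs_ge_self] mult_right_mono]; use t in simp)+
    then have "\<mu> / 2 * (d - 1) \<le> \<bar>m\<bar> + \<bar>a\<bar> + \<bar>c\<bar>" using 2 3 by (simp add: mult.assoc)
    then show False using d(2) f(4) by (simp add: field_simps)
  qed
  obtain m' where m': "\<And>y. y \<in> cball x0 \<rho> \<Longrightarrow> ereal m' \<le> f y"
    using closed_fun_bounded_below[OF f(1,2) compact_cball] by blast
  define E where "E = {(y, r::real). f y \<le> ereal r} \<inter> {p. snd p + q (fst p) \<le> c}"
  have "closed {p. snd p + q (fst p) \<le> c}"
    by (intro closed_Collect_le continuous_intros continuous_on_compose2[OF q(1)]) auto
  then have "closed E" unfolding E_def using f(2) by (auto simp: closed_fun_def)
  moreover have "E \<subseteq> cball x0 \<rho> \<times> {m'..c}"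
  proof
    fix p assume "p \<in> E"
    then obtain y r where p: "p = (y, r)" "f y \<le> ereal r" "r + q y \<le> c" by (cases p) (auto simp: E_def)
    then have rc: "r \<le> c" using q(2)[of y] by linarith
    then have "f y \<le> ereal c" using p(2) by (meson ereal_less_eq(3) order_trans)
    then have "dist y x0 \<le> \<rho>" using growth by (simp add: dist_norm)
    then have y: "y \<in> cball x0 \<rho>" by (simp add: dist_commute)
    have "ereal m' \<le> ereal r" using m'[OF y] p(2) by (rule order_trans)
    then show "p \<in> cball x0 \<rho> \<times> {m'..c}" using p(1) y rc by simp
  qed
  ultimately have "compact E"
    using bounded_Times[OF bounded_cball bounded_closed_interval] bounded_subset compact_eq_bounded_closed by metis
  moreover have ne: "(x0, a) \<in> E" by (simp add: E_def x0 c_def)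
  moreover have "continuous_on E (\<lambda>p. snd p + q (fst p))"
    by (intro continuous_intros continuous_on_compose2[OF q(1)]) auto
  ultimately obtain p where p: "p \<in> E" "\<And>p'. p' \<in> E \<Longrightarrow> snd p + q (fst p) \<le> snd p' + q (fst p')"
    using continuous_attains_inf[of E "\<lambda>p. snd p + q (fst p)"] by blast
  show ?thesis
  proof (intro exI allI)
    fix y
    have fp: "f (fst p) + ereal (q (fst p)) \<le> ereal (snd p + q (fst p))"
      using p(1) add_right_mono[of "f (fst p)" "ereal (snd p)" "ereal (q (fst p))"] by (auto simp: E_def)
    show "f (fst p) + ereal (q (fst p)) \<le> f y + ereal (q y)"
    proof (cases "f y")
      case (real s)
      have "snd p + q (fst p) \<le> s + q y"
      proof (cases "s + q y \<le> c")
        case True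
        then have "(y, s) \<in> E" using real by (simp add: E_def)
        from p(2)[OF this] show ?thesis by simp
      next
        case False
        then show ?thesis using p(1) by (auto simp: E_def)
      qed
      then show ?thesis using order_trans[OF fp, of "ereal (s + q y)"] real by simp
    next
      case MInf
      then show ?thesis using f(1) by (simp add: proper_fun_def)
    qed simp
  qed
qed

section \<open>Optimality of the proximal step\<close>

lemma pos_def_symmetric: "pos_def M \<Longrightarrow> u \<bullet> (M *v w) = w \<bullet> (M *v u)"
  by (metis dot_lmul_matrix inner_commute pos_def_def transpose_matrix_vector)

lemma pos_def_nonneg: "pos_def M \<Longrightarrow> 0 \<le> v \<bullet> (M *v v)"
  by (cases "v = 0") (auto simp: pos_def_def less_imp_le)

text \<open>\<open>prox\<close> is a choice among minimisers, so existence comes first. Comparing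
  the minimiser with points towards \<open>y\<close> and letting \<open>t\<close> tend to 0 leaves
  only the linear part of the quadratic term.\<close>

lemma prox_optimality:
  fixes f :: "real^'n \<Rightarrow> ereal"
  assumes f: "proper_fun f" "closed_fun f" "convex_fun f" "strongly_convex_fun \<mu> f" "0 < \<mu>"
    and M: "pos_def M"
  shows "M *v (b - prox M f b) \<in> subdiff f (prox M f b)"
proof -
  define q where "q y = 1 / 2 * ((y - b) \<bullet> (M *v (y - b)))" for y
  have cq: "continuous_on UNIV q"
    unfolding q_def by (intro continuous_intros bounded_linear.continuous_on[OF matrix_vector_mul_bounded_linear])
  have "\<exists>x. \<forall>y. f x + ereal (q x) \<le> f y + ereal (q y)"
    by (rule strongly_convex_attains_min[OF f(1,2,4,5) cq]) (simp add: q_def pos_def_nonneg[OF M])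
  then have "\<exists>x. is_arg_min (\<lambda>y. f y + ereal (q y)) (\<lambda>_. True) x"
    by (auto simp: is_arg_min_def not_less)
  then have "is_arg_min (\<lambda>y. f y + ereal (q y)) (\<lambda>_. True) (prox M f b)"
    unfolding prox_def arg_min_def q_def by (rule someI_ex)
  then have min: "f (prox M f b) + ereal (q (prox M f b)) \<le> f y + ereal (q y)" for y
    by (auto simp: is_arg_min_def not_less)
  define x where "x = prox M f b"
  obtain x0 a0 where x0: "f x0 = ereal a0" using f(1) unfolding proper_fun_def by (metis ereal_cases)
  obtain a where a: "f x = ereal a"
    using min[of x0] f(1) x0 unfolding x_def[symmetric] proper_fun_def by (cases "f x") auto
  show ?thesis unfolding x_def[symmetric] subdiff_def
  proof (intro CollectI allI)
    fix y
    show "f x + ereal ((M *v (b - x)) \<bullet> (y - x)) \<le> f y"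
    proof (cases "f y")
      case (real c)
      define d where "d = y - x"
      define Q where "Q = d \<bullet> (M *v d)"
      have *: "a - c \<le> d \<bullet> (M *v (x - b)) + t / 2 * Q" if t: "0 < t" "t < 1" for t
      proof -
        define w where "w = (1 - t) *\<^sub>R x + t *\<^sub>R y"
        have w: "w - b = (x - b) + t *\<^sub>R d" by (simp add: w_def d_def algebra_simps)
        have "f w \<le> ereal (1 - t) * f x + ereal t * f y"
          using f(3) t unfolding convex_fun_def w_def by blast
        then have "f w + ereal (q w) \<le> ereal ((1 - t) * a + t * c) + ereal (q w)"
          using add_right_mono a real by (metis plus_ereal.simps(1) times_ereal.simps(1))
        then have "a + q x \<le> (1 - t) * a + t * c + q w"
          using order_trans[OF min[of w]] a unfolding x_def[symmetric] by fastforce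
        moreover have "q w = q x + t * (d \<bullet> (M *v (x - b))) + t * (t / 2 * Q)"
          unfolding q_def w Q_def
          by (simp add: matrix_vector_right_distrib matrix_vector_mult_scaleR inner_add_left inner_add_right
              pos_def_symmetric[OF M, of x d]
              pos_def_symmetric[OF M, of b d] algebra_simps)
        ultimately have "t * (a - c) \<le> t * (d \<bullet> (M *v (x - b)) + t / 2 * Q)" by (simp add: algebra_simps)
        then show ?thesis using t by simp
      qed
      have "((\<lambda>t. d \<bullet> (M *v (x - b)) + t / 2 * Q) \<longlongrightarrow> d \<bullet> (M *v (x - b)) + 0 / 2 * Q) (at_right 0)"
        by (intro tendsto_intros) auto
      moreover have "eventually (\<lambda>t. a - c \<le> d \<bullet> (M *v (x - b)) + t / 2 * Q) (at_right (0::real))"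
        unfolding eventually_at_right_field using * by (intro exI[of _ 1]) auto
      ultimately have "a - c \<le> d \<bullet> (M *v (x - b))"
        using tendsto_lowerbound[of _ _ "at_right (0::real)" "a - c"] by simp
      moreover have "M *v (b - x) = - (M *v (x - b))" by (simp add: matrix_vector_mult_diff_distrib)
      ultimately show ?thesis using a real by (simp add: d_def inner_commute)
    next
      case MInf
      then show ?thesis using f(1) by (simp add: proper_fun_def)
    qed simp
  qed
qed

section \<open>Subgradients of the conjugate\<close>

lemma conjugate_ge: "ereal (v \<bullet> x) - f x \<le> conjugate f v"
  unfolding conjugate_def by (rule SUP_upper) simp

text \<open>The core is the biconjugate theorem at one point. If \<open>g b\<close> exceeded
  \<open>\<beta>\<close>, the pair \<open>(b, \<beta>)\<close> would be strictly separated from the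
  epigraph of \<open>g\<close>, and the hyperplane would yield a point where
  \<open>conjugate g\<close> is below the affine minorant with slope \<open>b\<close>.\<close>

lemma subdiff_conjugateD:
  fixes g :: "'a::euclidean_space \<Rightarrow> ereal"
  assumes g: "proper_fun g" "closed_fun g" "convex_fun g" and g': "proper_fun (conjugate g)"
    and b: "b \<in> subdiff (conjugate g) z"
  shows "z \<in> subdiff g b"
proof -
  obtain \<gamma> where \<gamma>: "conjugate g z = ereal \<gamma>" by (rule subdiff_finite[OF g' b])
  have sub: "ereal (\<gamma> + b \<bullet> (w - z)) \<le> conjugate g w" for w
    using b \<gamma> unfolding subdiff_def by (metis (mono_tags, lifting) mem_Collect_eq plus_ereal.simps(1))
  define \<beta> where "\<beta> = z \<bullet> b - \<gamma>"
  have conj_le: "conjugate g w \<le> ereal e" if "\<And>y r. g y = ereal r \<Longrightarrow> w \<bullet> y - r \<le> e" for w e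
    unfolding conjugate_def
  proof (rule SUP_least)
    fix y
    show "ereal (w \<bullet> y) - g y \<le> ereal e"
      using that[of y] g(1) by (cases "g y") (auto simp: proper_fun_def)
  qed
  have lower: "z \<bullet> y - \<gamma> \<le> r" if "g y = ereal r" for y r
    using conjugate_ge[of z y g] \<gamma> that by simp
  have "g b \<le> ereal \<beta>"
  proof (rule ccontr)
    assume nle: "\<not> g b \<le> ereal \<beta>"
    define E where "E = {(y, r::real). g y \<le> ereal r}"
    have "closed E" using g(2) by (simp add: closed_fun_def E_def)
    moreover have "convex E"
    proof (rule convexI)
      fix p p' :: "'a \<times> real" and u v :: real
      assume pp: "p \<in> E" "p' \<in> E" and uv: "0 \<le> u" "0 \<le> v" "u + v = 1"
      obtain y r y' r' where p: "p = (y, r)" "p' = (y', r')" by (cases p, cases p') auto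
      show "u *\<^sub>R p + v *\<^sub>R p' \<in> E"
      proof (cases "v = 0 \<or> v = 1")
        case True
        then show ?thesis using uv pp by auto
      next
        case False
        then have v: "0 < v" "v < 1" "u = 1 - v" using uv by auto
        have "g (u *\<^sub>R y + v *\<^sub>R y') \<le> ereal u * g y + ereal v * g y'"
          using g(3) v unfolding convex_fun_def by blast
        also have "\<dots> \<le> ereal u * ereal r + ereal v * ereal r'"
          using pp p uv by (intro add_mono ereal_mult_left_mono) (auto simp: E_def)
        finally show ?thesis by (simp add: p E_def)
      qed
    qed
    moreover have "(b, \<beta>) \<notin> E" using nle by (simp add: E_def)
    ultimately obtain n k where n: "n \<bullet> (b, \<beta>) < k" "\<And>p. p \<in> E \<Longrightarrow> k < n \<bullet> p"
      using separating_hyperplane_closed_point[of E "(b, \<beta>)"] by blast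
    obtain p s where ps: "n = (p, s)" by (cases n)
    have sep: "p \<bullet> b + s * \<beta> < k" using n(1) by (simp add: ps)
    have sepE: "k < p \<bullet> y + s * r" if "g y \<le> ereal r" for y r
      using n(2)[of "(y, r)"] that by (simp add: ps E_def)
    obtain x0 a where x0: "g x0 = ereal a" using g(1) unfolding proper_fun_def by (metis ereal_cases)
    have "0 \<le> s"
    proof (rule ccontr)
      assume "\<not> 0 \<le> s"
      then have s: "s < 0" by simp
      define r where "r = max a ((k - p \<bullet> x0) / s)"
      have "k < p \<bullet> x0 + s * r" by (rule sepE) (simp add: x0 r_def)
      moreover have "s * r \<le> s * ((k - p \<bullet> x0) / s)" using s by (intro mult_left_mono_neg) (auto simp: r_def)
      ultimately show False using s by simp
    qed
    show False
    \<comment> \<open>A vertical hyperplane is exploited by tilting \<open>z\<close> to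
      \<open>z - p\<close>; otherwise the hyperplane is the graph of an affine function with slope
      \<open>w\<close>.\<close>
    proof (cases "s = 0")
      case True
      have "conjugate g (z - p) \<le> ereal (\<gamma> - k)"
      proof (rule conj_le)
        fix y r assume "g y = ereal r"
        then show "(z - p) \<bullet> y - r \<le> \<gamma> - k" using lower[of y r] sepE[of y r] True by (simp add: inner_diff_left)
      qed
      from order_trans[OF sub this] show False using sep True by (simp add: inner_commute)
    next
      case False
      then have s: "0 < s" using \<open>0 \<le> s\<close> by simp
      define w where "w = - (1 / s) *\<^sub>R p"
      have "conjugate g w \<le> ereal (- (k / s))"
      proof (rule conj_le)
        fix y r assume "g y = ereal r"
        then have "k / s < (p \<bullet> y + s * r) / s" using sepE[of y r] s by (intro divide_strict_right_mono) auto
        then show "w \<bullet> y - r \<le> - (k / s)" using s by (simp add: w_def add_divide_distrib)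
      qed
      from order_trans[OF sub this] have "\<gamma> + b \<bullet> w - b \<bullet> z \<le> - (k / s)" by (simp add: inner_diff_right)
      then have "k / s + b \<bullet> w \<le> \<beta>" by (simp add: \<beta>_def inner_commute)
      then have "s * (k / s + b \<bullet> w) \<le> s * \<beta>" using s by (intro mult_left_mono) auto
      then show False using sep s by (simp add: w_def inner_commute algebra_simps)
    qed
  qed
  then have gb: "g b + ereal (z \<bullet> (y - b)) \<le> ereal (z \<bullet> y - \<gamma>)" for y
    using add_right_mono[of "g b" "ereal \<beta>" "ereal (z \<bullet> (y - b))"] by (simp add: \<beta>_def inner_diff_right)
  show ?thesis unfolding subdiff_def
  proof (intro CollectI allI)
    fix y
    show "g b + ereal (z \<bullet> (y - b)) \<le> g y"
    proof (cases "g y")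
      case (real r)
      have "ereal (z \<bullet> y - \<gamma>) \<le> g y" using lower[OF real] real by simp
      with gb[of y] show ?thesis by (rule order_trans)
    next
      case MInf
      then show ?thesis using g(1) by (simp add: proper_fun_def)
    qed simp
  qed
qed

section \<open>The augmented Lagrangian\<close>

lemma pos_def_lower_bound:
  fixes M :: "real^'n^'n"
  assumes "pos_def M"
  obtains e where "0 < e" "\<And>v. e * (norm v)\<^sup>2 \<le> v \<bullet> (M *v v)"
proof -
  have "continuous_on (sphere 0 1) (\<lambda>v. v \<bullet> (M *v v))"
    by (intro continuous_intros bounded_linear.continuous_on[OF matrix_vector_mul_bounded_linear])
  moreover have "sphere (0::real^'n) 1 \<noteq> {}" by simp
  ultimately obtain w where w: "norm w = 1" "\<And>v. norm v = 1 \<Longrightarrow> w \<bullet> (M *v w) \<le> v \<bullet> (M *v v)"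
    using continuous_attains_inf[of "sphere (0::real^'n) 1" "\<lambda>v. v \<bullet> (M *v v)"] by auto
  show ?thesis
  proof (rule that)
    have "w \<noteq> 0" using w(1) by auto
    then show "0 < w \<bullet> (M *v w)" using assms by (simp add: pos_def_def)
    fix v :: "real^'n"
    show "w \<bullet> (M *v w) * (norm v)\<^sup>2 \<le> v \<bullet> (M *v v)"
    proof (cases "v = 0")
      case False
      define u where "u = v /\<^sub>R norm v"
      have v: "v = norm v *\<^sub>R u" using False by (simp add: u_def)
      have "w \<bullet> (M *v w) \<le> u \<bullet> (M *v u)" using False by (intro w) (simp add: u_def)
      from mult_right_mono[OF this zero_le_power2[of "norm v"]]
      have "w \<bullet> (M *v w) * (norm v)\<^sup>2 \<le> (norm v *\<^sub>R u) \<bullet> (M *v (norm v *\<^sub>R u))"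
        by (simp add: matrix_vector_mult_scaleR power2_eq_square mult_ac)
      then show ?thesis using v by simp
    qed simp
  qed
qed

lemma pos_def_matrix_inv:
  fixes M :: "real^'n^'n"
  assumes "pos_def M"
  shows "M *v (matrix_inv M *v v) = v" "matrix_inv M *v (M *v v) = v"
proof -
  have "inj ((*v) M)"
    unfolding linear_injective_0[OF matrix_vector_mul_linear]
    using assms unfolding pos_def_def by (metis inner_zero_right less_irrefl)
  then have "invertible M"
    unfolding invertible_left_inverse matrix_left_invertible_injective[symmetric] .
  then have "M ** matrix_inv M = mat 1 \<and> matrix_inv M ** M = mat 1"
    unfolding invertible_def matrix_inv_def by (rule someI_ex)
  then show "M *v (matrix_inv M *v v) = v" "matrix_inv M *v (M *v v) = v"
    by (simp_all add: matrix_vector_mul_assoc)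
qed

lemma norm_le_spectral_norm: "norm (M *v v) \<le> spectral_norm M * norm v"
  for M :: "real^'n^'m"
  unfolding spectral_norm_def by (rule onorm[OF matrix_vector_mul_bounded_linear])

lemma inner_le_spectral_norm: "v \<bullet> (M *v v) \<le> spectral_norm M * (norm v)\<^sup>2"
  for M :: "real^'n^'n"
proof -
  have "v \<bullet> (M *v v) \<le> norm v * norm (M *v v)" by (rule norm_cauchy_schwarz)
  also have "\<dots> \<le> norm v * (spectral_norm M * norm v)"
    by (intro mult_left_mono norm_le_spectral_norm) simp
  finally show ?thesis by (simp add: power2_eq_square mult_ac)
qed

text \<open>The quadratic form of \<open>M\<close> is nonnegative at
  \<open>t - c *\<^sub>R s\<close>, with \<open>c\<close> the inverse of the spectral norm;
  expanding it replaces a diagonalisation.\<close>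

lemma pos_def_inverse_lower:
  fixes M :: "real^'n^'n"
  assumes M: "pos_def M" and N: "\<And>v. M *v (N *v v) = v"
  shows "(norm s)\<^sup>2 \<le> spectral_norm M * (s \<bullet> (N *v s))"
proof -
  define t where "t = N *v s"
  have s: "s = M *v t" using N by (simp add: t_def)
  have sg: "0 \<le> spectral_norm M"
    unfolding spectral_norm_def by (rule onorm_pos_le[OF matrix_vector_mul_bounded_linear])
  show ?thesis
  proof (cases "spectral_norm M = 0")
    case True
    then have "norm (M *v t) \<le> 0" using norm_le_spectral_norm[of M t] by simp
    then show ?thesis using True s by simp
  next
    case False
    then have sg: "0 < spectral_norm M" using sg by simp
    define c where "c = 1 / spectral_norm M"
    have c: "0 < c" "c * spectral_norm M = 1" using sg by (auto simp: c_def)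
    have "0 \<le> (t - c *\<^sub>R s) \<bullet> (M *v (t - c *\<^sub>R s))" by (rule pos_def_nonneg[OF M])
    also have "\<dots> = t \<bullet> (M *v t) - c * (t \<bullet> (M *v s)) - c * (s \<bullet> (M *v t)) + c * c * (s \<bullet> (M *v s))"
      by (simp add: matrix_vector_mult_diff_distrib matrix_vector_mult_scaleR inner_simps algebra_simps)
    also have "t \<bullet> (M *v s) = s \<bullet> (M *v t)" by (rule pos_def_symmetric[OF M])
    also have "s \<bullet> (M *v t) = (norm s)\<^sup>2" by (simp add: t_def N power2_norm_eq_inner)
    also have "t \<bullet> (M *v t) = s \<bullet> (N *v s)" by (simp add: t_def N inner_commute)
    finally have "2 * c * (norm s)\<^sup>2 \<le> s \<bullet> (N *v s) + c * c * (s \<bullet> (M *v s))" by simp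
    also have "c * c * (s \<bullet> (M *v s)) \<le> c * c * (spectral_norm M * (norm s)\<^sup>2)"
      using c by (intro mult_left_mono inner_le_spectral_norm) auto
    also have "\<dots> = c * (c * spectral_norm M) * (norm s)\<^sup>2" by simp
    finally have "c * (norm s)\<^sup>2 \<le> s \<bullet> (N *v s)" unfolding c(2) by simp
    then have "spectral_norm M * (c * (norm s)\<^sup>2) \<le> spectral_norm M * (s \<bullet> (N *v s))"
      using sg by (intro mult_left_mono) auto
    then show ?thesis using c(2) by (simp add: mult.assoc[symmetric] mult.commute)
  qed
qed

text \<open>Two lower bounds on \<open>N\<close>, one from \<open>pos_def_inverse_lower\<close> and
  one from \<open>C\<close>, are multiplied so that the spectral norm cancels. The result lets the
  quadratic term of \<open>lyapunov\<close> majorise the smooth conjugate of a strongly convex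
  function.\<close>

lemma step_size_lower:
  fixes M :: "real^'n^'n"
  assumes M: "pos_def M" and N: "\<And>v. M *v (N *v v) = v" and \<mu>: "0 < \<mu>"
    and C: "pos_def ((1/2) *\<^sub>R N - (spectral_norm M / \<mu>\<^sup>2) *\<^sub>R mat 1)"
  shows "(norm s)\<^sup>2 \<le> \<mu> * (s \<bullet> (N *v s))"
proof -
  define P q \<sigma> where "P = s \<bullet> (N *v s)" and "q = (norm s)\<^sup>2" and "\<sigma> = spectral_norm M"
  have 1: "q \<le> \<sigma> * P" unfolding P_def q_def \<sigma>_def by (rule pos_def_inverse_lower[OF M N])
  have q: "0 \<le> q" by (simp add: q_def)
  have sg: "0 \<le> \<sigma>"
    unfolding \<sigma>_def spectral_norm_def by (rule onorm_pos_le[OF matrix_vector_mul_bounded_linear])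
  have "0 \<le> s \<bullet> (((1/2) *\<^sub>R N - (\<sigma> / \<mu>\<^sup>2) *\<^sub>R mat 1) *v s)"
    unfolding \<sigma>_def by (rule pos_def_nonneg[OF C])
  also have "\<dots> = P / 2 - \<sigma> / \<mu>\<^sup>2 * q"
    by (simp add: matrix_vector_mult_diff_rdistrib scaleR_matrix_vector_assoc[symmetric] inner_diff_right
        P_def q_def power2_norm_eq_inner)
  finally have 2: "2 * \<sigma> * q \<le> \<mu>\<^sup>2 * P" using \<mu> by (simp add: field_simps)
  have P: "0 \<le> P"
  proof (rule ccontr)
    assume "\<not> 0 \<le> P"
    then have "\<mu>\<^sup>2 * P < 0" using \<mu> by (simp add: mult_pos_neg)
    moreover have "0 \<le> 2 * \<sigma> * q" using sg q by simp
    ultimately show False using 2 by linarith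
  qed
  have "q * q \<le> \<sigma> * P * q" using 1 q by (rule mult_right_mono)
  also have "\<dots> = P * (\<sigma> * q)" by simp
  also have "\<dots> \<le> P * (\<mu>\<^sup>2 * P)"
    using 2 mult_nonneg_nonneg[OF sg q] P by (intro mult_left_mono; linarith)
  finally have "q\<^sup>2 \<le> (\<mu> * P)\<^sup>2" by (simp add: power2_eq_square algebra_simps)
  then have "q \<le> \<mu> * P" by (rule power2_le_imp_le) (use \<mu> P in simp)
  then show ?thesis by (simp add: P_def q_def)
qed

text \<open>The algorithm is a linearised ADMM for the dual problem, in which \<^term>\<open>x\<close> is the multiplier;
  the function that decreases is its augmented Lagrangian.\<close>

definition lyapunov :: "real^'m^'n \<Rightarrow> real^'n^'n \<Rightarrow> real \<Rightarrow> real \<Rightarrow> real^'n \<Rightarrow> real^'n \<Rightarrow> real^'m \<Rightarrow> real" where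
  "lyapunov T N gz fx x y z = gz - fx - x \<bullet> (T *v z) + 1 / 2 * ((T *v z + y) \<bullet> (N *v (T *v z + y)))"

text \<open>Both quadratic terms are expanded about \<open>e0\<close>, which is
  \<open>- (M1 *v dx)\<close>: the old one sits at \<open>e0 - dy\<close>, the new one at
  \<open>e0 + T *v dz\<close>. After cancellation only \<open>dx \<bullet> (M1 *v dx)\<close>, half
  the form of \<open>A ** N ** T\<close> at \<open>dz\<close> and the error \<open>e\<close> work
  against the descent, and \<open>lip\<close> bounds the first by a multiple of
  \<open>(norm dy)\<^sup>2\<close>.\<close>

lemma lyapunov_descent:
  fixes A :: "real^'n^'m" and T :: "real^'m^'n" and M1 N :: "real^'n^'n" and M2 :: "real^'m^'m"
  assumes adj: "\<And>w v. (T *v w) \<bullet> v = w \<bullet> (A *v v)"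
    and N: "\<And>v. N *v (M1 *v v) = v" "\<And>u v. u \<bullet> (N *v v) = v \<bullet> (N *v u)"
    and y': "y' = M1 *v (x - x') - T *v z"
    and u': "u' = A *v (2 *\<^sub>R x' - x) - M2 *v (z' - z) - e" and e: "norm e \<le> c * norm (z' - z)"
    and f: "fx + y \<bullet> (x' - x) \<le> fx'" and g: "gz' + u' \<bullet> (z - z') \<le> gz"
    and lip: "\<mu> * norm (x' - x) \<le> norm (y' - y)" "0 < \<mu>"
  shows "lyapunov T N gz' fx' x' y' z'
    + (y' - y) \<bullet> (((1/2) *\<^sub>R N - (spectral_norm M1 / \<mu>\<^sup>2) *\<^sub>R mat 1) *v (y' - y))
    + (z' - z) \<bullet> ((M2 - (1/2) *\<^sub>R (A ** N ** T) - c *\<^sub>R mat 1) *v (z' - z))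
    \<le> lyapunov T N gz fx x y z"
proof -
  define dy dz dx e0 where "dy = y' - y" and "dz = z' - z" and "dx = x' - x" and "e0 = T *v z + y'"
  define q where "q u v = u \<bullet> (N *v v)" for u v
  have q: "q (u + v) w = q u w + q v w" "q u (v + w) = q u v + q u w" "q (u - v) w = q u w - q v w"
    "q u (v - w) = q u v - q u w" "q u v = q v u" for u v w
    unfolding q_def by (simp_all add: inner_simps matrix_vector_right_distrib matrix_vector_mult_diff_distrib)
      (rule N(2))
  have Ne0: "N *v e0 = - dx" unfolding e0_def y' using N(1)[of "x - x'"] by (simp add: dx_def)
  have e0: "e0 = - (M1 *v dx)" unfolding e0_def y' dx_def by (simp add: matrix_vector_mult_diff_distrib)
  have 1: "q (T *v z + y) (T *v z + y) = q e0 e0 + 2 * (dy \<bullet> dx) + q dy dy"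
  proof -
    have "T *v z + y = e0 - dy" by (simp add: e0_def dy_def)
    moreover have "q dy e0 = - (dy \<bullet> dx)" by (simp add: q_def Ne0)
    ultimately show ?thesis by (simp add: q(3,4) q(5)[of e0 dy])
  qed
  have 2: "q (T *v z' + y') (T *v z' + y') = q e0 e0 - 2 * (dz \<bullet> (A *v dx)) + dz \<bullet> ((A ** N ** T) *v dz)"
  proof -
    have "T *v z' + y' = e0 + T *v dz" by (simp add: e0_def dz_def matrix_vector_mult_diff_distrib)
    moreover have "q (T *v dz) e0 = - (dz \<bullet> (A *v dx))" by (simp add: q_def Ne0 adj)
    moreover have "q (T *v dz) (T *v dz) = dz \<bullet> ((A ** N ** T) *v dz)"
      by (simp add: q_def adj matrix_vector_mul_assoc matrix_mul_assoc)
    ultimately show ?thesis by (simp add: q(1,2) q(5)[of e0 "T *v dz"])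
  qed
  have C1: "dy \<bullet> (((1/2) *\<^sub>R N - (spectral_norm M1 / \<mu>\<^sup>2) *\<^sub>R mat 1) *v dy)
      = q dy dy / 2 - spectral_norm M1 / \<mu>\<^sup>2 * (norm dy)\<^sup>2"
    by (simp add: matrix_vector_mult_diff_rdistrib scaleR_matrix_vector_assoc[symmetric] inner_diff_right
        q_def power2_norm_eq_inner)
  have C2: "dz \<bullet> ((M2 - (1/2) *\<^sub>R (A ** N ** T) - c *\<^sub>R mat 1) *v dz)
      = dz \<bullet> (M2 *v dz) - dz \<bullet> ((A ** N ** T) *v dz) / 2 - c * (norm dz)\<^sup>2"
    by (simp add: matrix_vector_mult_diff_rdistrib scaleR_matrix_vector_assoc[symmetric] inner_diff_right
        power2_norm_eq_inner)
  have dx: "dx \<bullet> (M1 *v dx) \<le> spectral_norm M1 / \<mu>\<^sup>2 * (norm dy)\<^sup>2"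
  proof -
    have sg: "0 \<le> spectral_norm M1"
      unfolding spectral_norm_def by (rule onorm_pos_le[OF matrix_vector_mul_bounded_linear])
    have "(\<mu> * norm dx)\<^sup>2 \<le> (norm dy)\<^sup>2" using lip by (intro power_mono) (auto simp: dx_def dy_def)
    then have "(norm dx)\<^sup>2 \<le> (norm dy)\<^sup>2 / \<mu>\<^sup>2" using lip(2) by (simp add: field_simps)
    then have "spectral_norm M1 * (norm dx)\<^sup>2 \<le> spectral_norm M1 * ((norm dy)\<^sup>2 / \<mu>\<^sup>2)"
      using sg by (rule mult_left_mono)
    then show ?thesis using inner_le_spectral_norm[of dx M1] by simp
  qed
  have ez: "- (c * (norm dz)\<^sup>2) \<le> dz \<bullet> e"
  proof -
    have "\<bar>dz \<bullet> e\<bar> \<le> norm dz * norm e" by (rule Cauchy_Schwarz_ineq2)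
    also have "\<dots> \<le> norm dz * (c * norm dz)" using e by (intro mult_left_mono) (auto simp: dz_def)
    finally show ?thesis by (simp add: power2_eq_square mult_ac)
  qed
  have g': "gz' - dz \<bullet> (A *v x') - dz \<bullet> (A *v dx) + dz \<bullet> (M2 *v dz) + dz \<bullet> e \<le> gz"
  proof -
    have "2 *\<^sub>R x' - x = x' + dx" by (simp add: dx_def scaleR_2)
    then have "u' \<bullet> (z - z') = - (dz \<bullet> (A *v x')) - dz \<bullet> (A *v dx) + dz \<bullet> (M2 *v dz) + dz \<bullet> e"
      unfolding u' dz_def
      by (simp add: matrix_vector_right_distrib matrix_vector_mult_diff_distrib inner_simps inner_commute
          algebra_simps)
    with g show ?thesis by simp
  qed
  have f': "fx + dx \<bullet> y \<le> fx'" using f by (simp add: dx_def inner_commute)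
  have yz: "dx \<bullet> y = - (dx \<bullet> (M1 *v dx)) - z \<bullet> (A *v dx) - dy \<bullet> dx"
  proof -
    have "y = e0 - T *v z - dy" by (simp add: e0_def dy_def)
    then have "y = - (M1 *v dx) - T *v z - dy" unfolding e0 .
    then have "dx \<bullet> y = - (dx \<bullet> (M1 *v dx)) - dx \<bullet> (T *v z) - dx \<bullet> dy" by (simp add: inner_diff_right)
    then show ?thesis using adj[of z dx] by (simp add: inner_commute)
  qed
  have xz: "x \<bullet> (T *v z) = z \<bullet> (A *v x') - z \<bullet> (A *v dx)"
    "x' \<bullet> (T *v z') = z \<bullet> (A *v x') + dz \<bullet> (A *v x')"
    using adj[of z x] adj[of z' x']
    by (simp_all add: dx_def dz_def inner_commute inner_diff_left inner_diff_right matrix_vector_mult_diff_distrib)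
  show ?thesis
    unfolding lyapunov_def dy_def[symmetric] dz_def[symmetric] C1 C2 q_def[symmetric] 1 2 xz
    using dx ez g' f' yz by (simp add: algebra_simps)
qed

section \<open>Convergence of the iterates\<close>

lemma convergent_of_summable_steps:
  fixes z :: "nat \<Rightarrow> 'a::banach"
  assumes "summable (\<lambda>k. norm (z (Suc k) - z k))"
  obtains w where "z \<longlonglongrightarrow> w"
proof -
  have "summable (\<lambda>k. z (Suc k) - z k)" using assms by (rule summable_norm_cancel)
  then have "(\<lambda>n. \<Sum>k<n. z (Suc k) - z k) \<longlonglongrightarrow> (\<Sum>k. z (Suc k) - z k)" by (rule summable_LIMSEQ)
  then have "(\<lambda>n. z n - z 0) \<longlonglongrightarrow> (\<Sum>k. z (Suc k) - z k)" by (simp add: sum_lessThan_telescope)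
  from tendsto_add[OF this tendsto_const[of "z 0"]] show ?thesis by (intro that) simp
qed

theorem theorem3p10:
  fixes f :: "real^'n \<Rightarrow> ereal" and g :: "real^'m \<Rightarrow> ereal"
    and A :: "real^'n^'m" and M1 :: "real^'n^'n" and M2 :: "real^'m^'m"
    and S :: "real^'m \<Rightarrow> real^'n \<Rightarrow> real^'n \<Rightarrow> real^'m"
    and p :: nat and c :: "nat \<Rightarrow> real" and \<mu>f :: real
    and x :: "nat \<Rightarrow> real^'n" and z :: "nat \<Rightarrow> real^'m"
  assumes f: "proper_fun f" "closed_fun f" "convex_fun f"
    and g: "proper_fun g" "closed_fun g" "convex_fun g"
    and solution_exists: "\<exists>xs zs. primal_dual_solution f g A xs zs"
    and strong: "\<mu>f > 0" "strongly_convex_fun \<mu>f f"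
    and coercive: "((\<lambda>w. conjugate g w + conjugate f (- (transpose A *v w))) \<longlongrightarrow> \<infinity>) at_infinity"
    and KL: "KL_function (conjugate g)"
    and M: "pos_def M1" "pos_def M2"
    and p: "p \<ge> 1"
    and algorithm: "iPrePDHG f A M1 S p x z"
    and c_pos: "c p > 0"
    and error: "bounded_relative_error g A M2 (c p) x z"
    and C1: "pos_def ((1/2) *\<^sub>R matrix_inv M1 - (spectral_norm M1 / \<mu>f\<^sup>2) *\<^sub>R mat 1)"
    and C2: "pos_def (M2 - (1/2) *\<^sub>R (A ** matrix_inv M1 ** transpose A) - c p *\<^sub>R mat 1)"
  shows "\<exists>xs zs. primal_dual_solution f g A xs zs \<and> (\<lambda>k. (x k, z k)) \<longlonglongrightarrow> (xs, zs)"
proof -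
  define T where "T = transpose A"
  define N where "N = matrix_inv M1"
  have adj: "(T *v w) \<bullet> v = w \<bullet> (A *v v)" for w v
    by (simp add: T_def dot_lmul_matrix)
  have N: "M1 *v (N *v v) = v" "N *v (M1 *v v) = v" for v
    unfolding N_def by (rule pos_def_matrix_inv[OF M(1)])+
  have Nsym: "u \<bullet> (N *v v) = v \<bullet> (N *v u)" for u v
    using pos_def_symmetric[OF M(1), of "N *v v" "N *v u"] by (simp add: N inner_commute)
  have M2inv: "M2 *v (matrix_inv M2 *v v) = v" for v by (rule pos_def_matrix_inv[OF M(2)])
  have g': "proper_fun (conjugate g)" "closed_fun (conjugate g)" using KL by (auto simp: KL_function_def)

  \<comment> \<open>Indices are shifted by one because the starting pair is arbitrary: subgradients
    are available only from the first computed iterates on.\<close>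
  define X Y Z where "X j = x (Suc j)" and "Y j = M1 *v (x j - x (Suc j)) - T *v z j" and "Z j = z (Suc j)" for j
  have Y: "Y j \<in> subdiff f (X j)" for j
  proof -
    have "x (Suc j) = prox M1 f (x j - N *v (T *v z j))"
      using algorithm by (simp add: iPrePDHG_def N_def T_def)
    then have "M1 *v ((x j - N *v (T *v z j)) - x (Suc j)) \<in> subdiff f (x (Suc j))"
      using prox_optimality[OF f strong(2,1) M(1)] by simp
    moreover have "M1 *v ((x j - N *v (T *v z j)) - x (Suc j)) = Y j"
      by (simp add: Y_def matrix_vector_mult_diff_distrib N)
    ultimately show ?thesis by (simp add: X_def)
  qed
  have YS: "Y (Suc j) = M1 *v (X j - X (Suc j)) - T *v Z j" for j by (simp add: X_def Y_def Z_def)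
  have "\<forall>j. \<exists>u e. u \<in> subdiff (conjugate g) (Z j) \<and>
      u = A *v (2 *\<^sub>R x (Suc j) - x j) - M2 *v (z (Suc j) - z j) - e \<and>
      norm e \<le> c p * norm (z (Suc j) - z j)"
  proof
    fix j
    obtain e u where e: "u \<in> subdiff (conjugate g) (Z j)" "norm e \<le> c p * norm (z (Suc j) - z j)"
      "u + M2 *v (z (Suc j) - z j - matrix_inv M2 *v (A *v (2 *\<^sub>R x (Suc j) - x j))) + e = 0"
      using error unfolding bounded_relative_error_def Z_def by blast
    have "M2 *v (z (Suc j) - z j - matrix_inv M2 *v (A *v (2 *\<^sub>R x (Suc j) - x j)))
        = M2 *v (z (Suc j) - z j) - A *v (2 *\<^sub>R x (Suc j) - x j)"
      by (simp add: matrix_vector_mult_diff_distrib[of M2] M2inv)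
    moreover have "u + (v - w) + e = 0 \<Longrightarrow> u = w - v - e" for v w by (simp add: algebra_simps)
    ultimately have "u = A *v (2 *\<^sub>R x (Suc j) - x j) - M2 *v (z (Suc j) - z j) - e"
      using e(3) by metis
    with e show "\<exists>u e. u \<in> subdiff (conjugate g) (Z j) \<and>
        u = A *v (2 *\<^sub>R x (Suc j) - x j) - M2 *v (z (Suc j) - z j) - e \<and>
        norm e \<le> c p * norm (z (Suc j) - z j)" by blast
  qed
  from choice[OF this] obtain U where "\<forall>j. \<exists>e. U j \<in> subdiff (conjugate g) (Z j) \<and>
      U j = A *v (2 *\<^sub>R x (Suc j) - x j) - M2 *v (z (Suc j) - z j) - e \<and>
      norm e \<le> c p * norm (z (Suc j) - z j)" by blast
  from choice[OF this] obtain E where U: "\<And>j. U j \<in> subdiff (conjugate g) (Z j)"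
    and UE: "\<And>j. U j = A *v (2 *\<^sub>R x (Suc j) - x j) - M2 *v (z (Suc j) - z j) - E j"
    and E: "\<And>j. norm (E j) \<le> c p * norm (z (Suc j) - z j)" by blast
  have US: "U (Suc j) = A *v (2 *\<^sub>R X (Suc j) - X j) - M2 *v (Z (Suc j) - Z j) - E (Suc j)"
    and ES: "norm (E (Suc j)) \<le> c p * norm (Z (Suc j) - Z j)" for j
    using UE[of "Suc j"] E[of "Suc j"] by (simp_all add: X_def Z_def)

  have "\<forall>j. \<exists>a. f (X j) = ereal a" using subdiff_finite[OF f(1) Y] by metis
  from choice[OF this] obtain fr where fr: "\<And>j. f (X j) = ereal (fr j)" by blast
  have "\<forall>j. \<exists>a. conjugate g (Z j) = ereal a" using subdiff_finite[OF g'(1) U] by metis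
  from choice[OF this] obtain G where G: "\<And>j. conjugate g (Z j) = ereal (G j)" by blast
  have f_sub: "fr i + Y i \<bullet> (X j - X i) + \<mu>f / 2 * (norm (X j - X i))\<^sup>2 \<le> fr j" for i j
    by (rule subdiff_strongly_convex[OF strong(2) Y fr fr])
  have g_sub: "G i + U i \<bullet> (Z j - Z i) \<le> G j" for i j
    using subdiffD[OF U[of i], of "Z j"] by (simp add: G)
  have lip: "\<mu>f * norm (X j - X i) \<le> norm (Y j - Y i)" for i j
  proof -
    have "\<mu>f * (norm (X j - X i))\<^sup>2 \<le> (Y j - Y i) \<bullet> (X j - X i)"
      using f_sub[of i j] f_sub[of j i] by (simp add: norm_minus_commute[of "X i"] inner_simps algebra_simps)
    also have "\<dots> \<le> norm (Y j - Y i) * norm (X j - X i)" by (rule norm_cauchy_schwarz)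
    finally show ?thesis
      by (cases "norm (X j - X i) = 0") (auto simp: power2_eq_square mult.assoc[symmetric])
  qed

  define L where "L j = lyapunov T N (G j) (fr j) (X j) (Y j) (Z j)" for j
  obtain e1 where e1: "0 < e1" "\<And>v. e1 * (norm v)\<^sup>2 \<le>
      v \<bullet> (((1/2) *\<^sub>R N - (spectral_norm M1 / \<mu>f\<^sup>2) *\<^sub>R mat 1) *v v)"
    using pos_def_lower_bound[OF C1[folded N_def]] by blast
  obtain e2 where e2: "0 < e2" "\<And>v. e2 * (norm v)\<^sup>2 \<le>
      v \<bullet> ((M2 - (1/2) *\<^sub>R (A ** N ** T) - c p *\<^sub>R mat 1) *v v)"
    using pos_def_lower_bound[OF C2[folded N_def T_def]] by blast
  define r where "r j = norm (Z (Suc j) - Z j) + norm (Y (Suc j) - Y j)" for j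
  define a where "a = min e1 e2 / 2"
  have a: "0 < a" using e1 e2 by (simp add: a_def)
  have descent: "L (Suc j) + a * (r j)\<^sup>2 \<le> L j" for j
  proof -
    have "L (Suc j) + e1 * (norm (Y (Suc j) - Y j))\<^sup>2 + e2 * (norm (Z (Suc j) - Z j))\<^sup>2 \<le> L j"
    proof -
      have "0 \<le> \<mu>f / 2 * (norm (X (Suc j) - X j))\<^sup>2" using strong(1) by simp
      then have "fr j + Y j \<bullet> (X (Suc j) - X j) \<le> fr (Suc j)" using f_sub[of j "Suc j"] by linarith
      then have "L (Suc j)
          + (Y (Suc j) - Y j) \<bullet> (((1/2) *\<^sub>R N - (spectral_norm M1 / \<mu>f\<^sup>2) *\<^sub>R mat 1) *v (Y (Suc j) - Y j))
          + (Z (Suc j) - Z j) \<bullet> ((M2 - (1/2) *\<^sub>R (A ** N ** T) - c p *\<^sub>R mat 1) *v (Z (Suc j) - Z j)) \<le> L j"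
        unfolding L_def
        by (intro lyapunov_descent[OF adj N(2) Nsym YS US ES _ g_sub lip strong(1)]) simp
      then show ?thesis using e1(2)[of "Y (Suc j) - Y j"] e2(2)[of "Z (Suc j) - Z j"] by linarith
    qed
    moreover have "a * (r j)\<^sup>2 \<le> e1 * (norm (Y (Suc j) - Y j))\<^sup>2 + e2 * (norm (Z (Suc j) - Z j))\<^sup>2"
    proof -
      define s t where "s = norm (Y (Suc j) - Y j)" and "t = norm (Z (Suc j) - Z j)"
      have "(r j)\<^sup>2 \<le> 2 * (s\<^sup>2 + t\<^sup>2)"
        unfolding r_def s_def[symmetric] t_def[symmetric] using zero_le_power2[of "s - t"]
        by (simp add: power2_eq_square algebra_simps)
      then have "a * (r j)\<^sup>2 \<le> a * (2 * (s\<^sup>2 + t\<^sup>2))" using a by (intro mult_left_mono) auto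
      also have "\<dots> = min e1 e2 * s\<^sup>2 + min e1 e2 * t\<^sup>2" by (simp add: a_def algebra_simps)
      also have "\<dots> \<le> e1 * s\<^sup>2 + e2 * t\<^sup>2" by (intro add_mono mult_right_mono) auto
      finally show ?thesis by (simp add: s_def t_def)
    qed
    ultimately show ?thesis by linarith
  qed

  \<comment> \<open>The conjugate of \<open>f\<close> at \<open>- (T *v Z j)\<close> is at most its
    expansion about \<open>Y j\<close>, where its gradient is \<open>X j\<close>, plus a quadratic
    term with constant \<open>1 / \<mu>f\<close>; \<open>step_size_lower\<close> replaces that term
    by the one in \<open>L\<close>.\<close>
  have dual_le: "conjugate g (Z j) + conjugate f (- (T *v Z j)) \<le> ereal (L j)" for j
  proof -
    define s where "s = T *v Z j + Y j"
    have "conjugate f (- (T *v Z j)) \<le> ereal (- fr j - X j \<bullet> (T *v Z j) + 1 / 2 * (s \<bullet> (N *v s)))"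
      unfolding conjugate_def
    proof (rule SUP_least)
      fix v
      show "ereal (- (T *v Z j) \<bullet> v) - f v \<le> ereal (- fr j - X j \<bullet> (T *v Z j) + 1 / 2 * (s \<bullet> (N *v s)))"
      proof (cases "f v")
        case (real w)
        define d where "d = v - X j"
        have 1: "fr j + Y j \<bullet> d + \<mu>f / 2 * (norm d)\<^sup>2 \<le> w"
          unfolding d_def by (rule subdiff_strongly_convex[OF strong(2) Y fr real])
        have "\<bar>s \<bullet> d\<bar> \<le> norm s * norm d" by (rule Cauchy_Schwarz_ineq2)
        moreover have "\<mu>f * (norm s * norm d) \<le> \<mu>f * (1 / 2 * (s \<bullet> (N *v s)) + \<mu>f / 2 * (norm d)\<^sup>2)"
          using zero_le_power2[of "norm s - \<mu>f * norm d"]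
            step_size_lower[OF M(1) N(1) strong(1) C1[folded N_def], of s]
          by (simp add: power2_eq_square algebra_simps)
        then have "norm s * norm d \<le> 1 / 2 * (s \<bullet> (N *v s)) + \<mu>f / 2 * (norm d)\<^sup>2"
          using strong(1) by (rule mult_left_le_imp_le)
        moreover have "s \<bullet> d = (T *v Z j) \<bullet> v - X j \<bullet> (T *v Z j) + Y j \<bullet> d"
          by (simp add: s_def d_def inner_simps inner_commute)
        ultimately show ?thesis using 1 real by (simp add: abs_le_iff)
      qed (use f(1) in \<open>auto simp: proper_fun_def\<close>)
    qed
    then have "conjugate g (Z j) + conjugate f (- (T *v Z j))
        \<le> ereal (G j) + ereal (- fr j - X j \<bullet> (T *v Z j) + 1 / 2 * (s \<bullet> (N *v s)))"
      unfolding G by (rule add_left_mono)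
    also have "\<dots> = ereal (L j)" by (simp add: L_def lyapunov_def s_def)
    finally show ?thesis .
  qed

  have dec: "decseq L"
  proof (rule decseq_SucI)
    show "L (Suc j) \<le> L j" for j
      using descent[of j] mult_nonneg_nonneg[OF less_imp_le[OF a] zero_le_power2[of "r j"]] by linarith
  qed
  \<comment> \<open>The coercive dual objective lies below the decreasing \<open>L\<close>, so
    \<open>Z\<close> stays bounded.\<close>
  have "eventually (\<lambda>w. ereal (L 0) < conjugate g w + conjugate f (- (T *v w))) at_infinity"
    using coercive[folded T_def] by (rule order_tendstoD) simp
  then obtain b where b: "\<And>w. b \<le> norm w \<Longrightarrow> ereal (L 0) < conjugate g w + conjugate f (- (T *v w))"
    unfolding eventually_at_infinity by blast
  have Zb: "norm (Z j) \<le> b" for j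
  proof (rule ccontr)
    assume "\<not> norm (Z j) \<le> b"
    then have "ereal (L 0) < ereal (L j)" using less_le_trans[OF b[of "Z j"] dual_le[of j]] by linarith
    then show False using decseqD[OF dec, of 0 j] by simp
  qed

  \<comment> \<open>In the dual objective the conjugate of \<open>f\<close> is replaced by its
    affine minorant given by \<open>X (Suc j)\<close>. Then \<open>h j\<close> is a subgradient at
    \<open>Z (Suc j)\<close>, and \<open>q j\<close> is the gap to \<open>L (Suc j)\<close>
    there.\<close>
  define h where "h j = U (Suc j) - A *v X (Suc j)" for j
  define q where "q j = 1 / 2 * ((T *v Z (Suc j) + Y (Suc j)) \<bullet> (N *v (T *v Z (Suc j) + Y (Suc j))))" for j
  have conv0: "L (Suc j) + h j \<bullet> (Z s - Z (Suc j)) - q j \<le> L s" for j s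
  proof -
    have "conjugate g (Z s) + (ereal (- (T *v Z s) \<bullet> X (Suc j)) - f (X (Suc j))) \<le> ereal (L s)"
      by (rule order_trans[OF add_left_mono[OF conjugate_ge] dual_le])
    then have "G s - (T *v Z s) \<bullet> X (Suc j) - fr (Suc j) \<le> L s" by (simp add: G fr)
    moreover have "G (Suc j) + U (Suc j) \<bullet> (Z s - Z (Suc j)) \<le> G s" by (rule g_sub)
    moreover have "L (Suc j) - q j = G (Suc j) - fr (Suc j) - (T *v Z (Suc j)) \<bullet> X (Suc j)"
      by (simp add: L_def lyapunov_def q_def inner_commute)
    ultimately show ?thesis unfolding h_def adj by (simp add: inner_simps inner_commute algebra_simps)
  qed

  obtain kA where kA: "0 < kA" "\<And>v. norm (A *v v) \<le> norm v * kA"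
    using bounded_linear.pos_bounded[OF matrix_vector_mul_bounded_linear] by blast
  obtain kT where kT: "0 < kT" "\<And>v. norm (T *v v) \<le> norm v * kT"
    using bounded_linear.pos_bounded[OF matrix_vector_mul_bounded_linear] by blast
  obtain k1 where k1: "0 < k1" "\<And>v. norm (M1 *v v) \<le> norm v * k1"
    using bounded_linear.pos_bounded[OF matrix_vector_mul_bounded_linear] by blast
  obtain k2 where k2: "0 < k2" "\<And>v. norm (M2 *v v) \<le> norm v * k2"
    using bounded_linear.pos_bounded[OF matrix_vector_mul_bounded_linear] by blast
  obtain kN where kN: "0 < kN" "\<And>v. norm (N *v v) \<le> norm v * kN"
    using bounded_linear.pos_bounded[OF matrix_vector_mul_bounded_linear] by blast
  have dZ: "norm (Z (Suc j) - Z j) \<le> r j" and dX: "norm (X (Suc j) - X j) \<le> r j / \<mu>f" and r0: "0 \<le> r j" for j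
  proof -
    show "norm (Z (Suc j) - Z j) \<le> r j" "0 \<le> r j" by (simp_all add: r_def)
    have "\<mu>f * norm (X (Suc j) - X j) \<le> r j" using lip[of "Suc j" j] by (simp add: r_def add_increasing)
    then show "norm (X (Suc j) - X j) \<le> r j / \<mu>f" using strong(1) by (simp add: field_simps)
  qed
  define K1 where "K1 = kA / \<mu>f + k2 + c p"
  define K2 where "K2 = 1 / 2 * (kT + k1 / \<mu>f)\<^sup>2 * kN"
  \<comment> \<open>After inserting the formula for \<open>U\<close>, the iterate itself cancels and
    only increments and the error remain.\<close>
  have hK: "norm (h j) \<le> K1 * r j" for j
  proof -
    have "2 *\<^sub>R X (Suc j) - X j = X (Suc j) + (X (Suc j) - X j)" unfolding scaleR_2 by simp
    then have "h j = A *v (X (Suc j) - X j) - M2 *v (Z (Suc j) - Z j) - E (Suc j)"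
      unfolding h_def US by (simp only: matrix_vector_right_distrib) simp
    then have "norm (h j) \<le> norm (A *v (X (Suc j) - X j)) + norm (M2 *v (Z (Suc j) - Z j)) + norm (E (Suc j))"
      using norm_triangle_ineq4[of "A *v (X (Suc j) - X j)" "M2 *v (Z (Suc j) - Z j)"]
        norm_triangle_ineq4[of "A *v (X (Suc j) - X j) - M2 *v (Z (Suc j) - Z j)" "E (Suc j)"] by simp
    also have "\<dots> \<le> r j / \<mu>f * kA + r j * k2 + c p * r j"
    proof (intro add_mono)
      show "norm (A *v (X (Suc j) - X j)) \<le> r j / \<mu>f * kA"
        by (rule order_trans[OF kA(2) mult_right_mono[OF dX]]) (use kA in simp)
      show "norm (M2 *v (Z (Suc j) - Z j)) \<le> r j * k2"
        by (rule order_trans[OF k2(2) mult_right_mono[OF dZ]]) (use k2 in simp)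
      show "norm (E (Suc j)) \<le> c p * r j"
        by (rule order_trans[OF ES mult_left_mono[OF dZ]]) (use c_pos in simp)
    qed
    finally show ?thesis by (simp add: K1_def algebra_simps)
  qed
  \<comment> \<open>The vector \<open>s\<close> consists of increments too, so the gap is of second
    order in \<open>r j\<close>.\<close>
  have qK: "q j \<le> K2 * (r j)\<^sup>2" for j
  proof -
    define s where "s = T *v Z (Suc j) + Y (Suc j)"
    have "s = T *v (Z (Suc j) - Z j) - M1 *v (X (Suc j) - X j)"
      by (simp add: s_def YS matrix_vector_mult_diff_distrib)
    then have "norm s \<le> norm (T *v (Z (Suc j) - Z j)) + norm (M1 *v (X (Suc j) - X j))"
      by (simp add: norm_triangle_ineq4)
    also have "\<dots> \<le> r j * kT + r j / \<mu>f * k1"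
    proof (rule add_mono)
      show "norm (T *v (Z (Suc j) - Z j)) \<le> r j * kT"
        by (rule order_trans[OF kT(2) mult_right_mono[OF dZ]]) (use kT in simp)
      show "norm (M1 *v (X (Suc j) - X j)) \<le> r j / \<mu>f * k1"
        by (rule order_trans[OF k1(2) mult_right_mono[OF dX]]) (use k1 in simp)
    qed
    also have "\<dots> = (kT + k1 / \<mu>f) * r j" by (simp add: algebra_simps)
    finally have s: "norm s \<le> (kT + k1 / \<mu>f) * r j" .
    have "s \<bullet> (N *v s) \<le> norm s * norm (N *v s)" by (rule norm_cauchy_schwarz)
    also have "\<dots> \<le> norm s * (norm s * kN)" by (intro mult_left_mono kN) simp
    also have "\<dots> = (norm s)\<^sup>2 * kN" by (simp add: power2_eq_square)
    also have "\<dots> \<le> ((kT + k1 / \<mu>f) * r j)\<^sup>2 * kN"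
      using s kN by (intro mult_right_mono power_mono) auto
    finally show ?thesis by (simp add: q_def s_def[symmetric] K2_def power_mult_distrib mult_ac)
  qed
  have "summable r"
  proof (rule relative_error_descent_summable[where z = Z and g = h and L = L and a = a and C = "K1 + K2" and b = b])
    have K: "0 < K1" "0 \<le> K2" using kA k2 c_pos strong(1) kN by (simp_all add: K1_def K2_def add_pos_pos)
    then show "0 < K1 + K2" by simp
    show "norm (h j) \<le> (K1 + K2) * r j" for j
      using hK[of j] mult_nonneg_nonneg[OF K(2) r0[of j]] unfolding distrib_right by linarith
    show "L (Suc j) + h j \<bullet> (Z s - Z (Suc j)) - (K1 + K2) * (r j)\<^sup>2 \<le> L s" if "j < s" for j s
      using conv0[of j s] qK[of j] mult_nonneg_nonneg[OF less_imp_le[OF K(1)] zero_le_power2[of "r j"]]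
      unfolding distrib_right by linarith
  qed (rule a r0 dZ descent Zb)+

  have "summable (\<lambda>j. norm (Z (Suc j) - Z j))"
    by (rule summable_comparison_test'[OF \<open>summable r\<close>, of 0]) (simp add: dZ)
  then obtain zs where Zlim: "Z \<longlonglongrightarrow> zs" by (rule convergent_of_summable_steps)
  have "summable (\<lambda>j. norm (X (Suc j) - X j))"
    by (rule summable_comparison_test'[OF summable_divide[OF \<open>summable r\<close>, of \<mu>f], of 0]) (simp add: dX)
  then obtain xs where Xlim: "X \<longlonglongrightarrow> xs" by (rule convergent_of_summable_steps)
  have ZS: "(\<lambda>j. Z (Suc j)) \<longlonglongrightarrow> zs" and XS: "(\<lambda>j. X (Suc j)) \<longlonglongrightarrow> xs"
    using Zlim Xlim by (simp_all add: LIMSEQ_Suc)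
  note mat_lim = bounded_linear.tendsto[OF matrix_vector_mul_bounded_linear]
  \<comment> \<open>The increments vanish in the limit, which leaves \<open>- (T *v zs)\<close> as
    subgradient of \<open>f\<close> at \<open>xs\<close> and \<open>A *v xs\<close> as subgradient
    of \<open>conjugate g\<close> at \<open>zs\<close>.\<close>
  have "(\<lambda>j. Y (Suc j)) \<longlonglongrightarrow> M1 *v (xs - xs) - T *v zs"
    unfolding YS by (intro tendsto_intros mat_lim Xlim XS Zlim)
  then have "M1 *v (xs - xs) - T *v zs \<in> subdiff f xs" by (rule subdiff_closed[OF f(1,2) XS _ Y])
  moreover have "z \<longlonglongrightarrow> zs" "x \<longlonglongrightarrow> xs" using Zlim Xlim unfolding Z_def X_def by (simp_all add: LIMSEQ_imp_Suc)
  moreover have "A *v xs \<in> subdiff (conjugate g) zs"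
  proof (rule subdiff_closed[OF g' ZS _ U])
    have "(\<lambda>j. c p * norm (Z (Suc j) - Z j)) \<longlonglongrightarrow> c p * norm (zs - zs)"
      by (intro tendsto_intros ZS Zlim)
    then have "(\<lambda>j. c p * norm (Z (Suc j) - Z j)) \<longlonglongrightarrow> 0" by simp
    then have "(\<lambda>j. E (Suc j)) \<longlonglongrightarrow> 0"
      by (rule Lim_null_comparison[rotated]) (simp add: ES)
    then have "(\<lambda>j. U (Suc j)) \<longlonglongrightarrow> A *v (2 *\<^sub>R xs - xs) - M2 *v (zs - zs) - 0"
      unfolding US by (intro tendsto_intros mat_lim XS Xlim ZS Zlim)
    then show "(\<lambda>j. U (Suc j)) \<longlonglongrightarrow> A *v xs" unfolding scaleR_2 by simp
  qed
  then have "zs \<in> subdiff g (A *v xs)" by (rule subdiff_conjugateD[OF g g'(1)])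
  ultimately show ?thesis
    unfolding primal_dual_solution_def T_def[symmetric]
    by (intro exI[of _ xs] exI[of _ zs] conjI bexI[of _ "- (T *v zs)"] bexI[of _ zs] tendsto_Pair) auto
qed

end
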